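(* Let $1/2<p\leq\infty$, $0<r\leq\infty$, and $1/p-1<s<\min\{1/p,1\}$. Let $\{\psi_{j,\nu}\}_{j,\nu}$ be a Daubechies wavelet system such that the characterization $$\|f\|_{B^s_{p,q}}\asymp\Big(\sum_{j=0}^\infty\Big\|2^{js}\sum_{\nu\in\mathbb{Z}}\lambda_{j,\nu}(f)\mathbf{1}_{j,\nu}\Big\|_{L_p(\mathbb{R})}^q\Big)^{1/q}$$ (usual modification if $q=\infty$) holds for all $0<q\leq\infty$, and let $P_N$ be the associated partial sum operators $P_Nf=\sum_{0\le j\leq N}\sum_{\nu\in\mathbb{Z}}\lambda_{j,\nu}(f)\psi_{j,\nu}$. Then there is a constant $C:=C(p,r,s)>0$ such that for all $f\in B^s_{p,\infty}(\mathbb{R})$ $$\sup_{N\in\mathbb{N}}\|\mathbb{E}_Nf-P_Nf\|_{B^s_{p,r}}\leq C\,\|f\|_{B^s_{p,\infty}}.$$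
   Context: $\mathbb{N}=\{1,2,\dots\}$. For $N\in\mathbb{N}$ and $\mu\in\mathbb{Z}$ let $I_{N,\mu}=[2^{-N}\mu,2^{-N}(\mu+1))$. The dyadic averaging operator is $$\mathbb{E}_N f(x)=\sum_{\mu\in\mathbb{Z}}\mathbf{1}_{I_{N,\mu}}(x)\,2^N\int_{I_{N,\mu}}f(t)\,dt .$$ $B^s_{p,q}=B^s_{p,q}(\mathbb{R})$ is the usual inhomogeneous Besov space of tempered distributions on the real line, with its usual (quasi-)norm. Daubechies wavelet system: $\psi_0$ and $\psi$ are an orthogonal compactly supported Daubechies scaling function and its corresponding wavelet, both of class $C^K$ and with $\psi$ having $L$ vanishing moments, where $K,L\in\mathbb{N}$ are sufficiently large. Put $\psi_{0,\nu}(x)=\psi_0(x-\nu)$ and $\psi_{j,\nu}(x)=\frac1{\sqrt2}\psi(2^{j-1}x-\nu)$ for $j\in\mathbb{N}$, $\nu\in\mathbb{Z}$. Further, $\lambda_{j,\nu}(f)=2^j\langle f,\psi_{j,\nu}\rangle$ (distributional pairing, understood in the usual way), and $\mathbf{1}_{j,\nu}$ is the characteristic function of $[2^{-j}\nu,2^{-j}(\nu+1)]$. With $f_j=\sum_{\nu\in\mathbb{Z}}\lambda_{j,\nu}(f)\psi_{j,\nu}$ for $j\ge0$ one has $f=\sum_{j\ge0}f_j$. The wavelet system is fixed throughout, so the constant may depend on it. For distributions $f$ that are not locally integrable, $\int_{I_{N,\mu}}f(t)\,dt$ is the usual pairing of $f$ with $\mathbf{1}_{I_{N,\mu}}$, i.e.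 $\int_{I_{N,\mu}}f(t)\,dt=\sum_{j\ge0}\int_{I_{N,\mu}}f_j(t)\,dt$ (the series converges absolutely because $s>1/p-1$). *)

theory Defs
  imports "HOL-Probability.Probability"
begin

abbreviation iter_deriv :: "nat \<Rightarrow> (real \<Rightarrow> 'a::real_normed_vector) \<Rightarrow> real \<Rightarrow> 'a" where
  "iter_deriv n g \<equiv> ((\<lambda>h x. vector_derivative h (at x)) ^^ n) g"

definition C_k :: "nat \<Rightarrow> (real \<Rightarrow> 'a::real_normed_vector) \<Rightarrow> bool" where
  "C_k k g \<longleftrightarrow> (\<forall>i<k. \<forall>x. iter_deriv i g differentiable (at x)) \<and>
     continuous_on UNIV (iter_deriv k g)"

definition schwartz :: "(real \<Rightarrow> complex) \<Rightarrow> bool" where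
  "schwartz \<phi> \<longleftrightarrow> (\<forall>k. C_k k \<phi>) \<and>
     (\<forall>m n. bounded (range (\<lambda>x. x ^ m *\<^sub>R iter_deriv n \<phi> x)))"

definition schwartz_seminorm :: "nat \<Rightarrow> nat \<Rightarrow> (real \<Rightarrow> complex) \<Rightarrow> real" where
  "schwartz_seminorm m n \<phi> = (SUP x. norm (x ^ m *\<^sub>R iter_deriv n \<phi> x))"

text \<open>A distribution is a functional on all functions of which only the values at
  Schwartz functions are ever used.\<close>

type_synonym distribution = "(real \<Rightarrow> complex) \<Rightarrow> complex"

definition tempered :: "distribution \<Rightarrow> bool" where
  "tempered f \<longleftrightarrow>
     (\<forall>a b \<phi> \<theta>. schwartz \<phi> \<longrightarrow> schwartz \<theta> \<longrightarrow>
        f (\<lambda>x. a * \<phi> x + b * \<theta> x) = a * f \<phi> + b * f \<theta>) \<and>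
     (\<exists>C M. \<forall>\<phi>. schwartz \<phi> \<longrightarrow>
        norm (f \<phi>) \<le> C * (\<Sum>m\<le>M. \<Sum>n\<le>M. schwartz_seminorm m n \<phi>))"

definition distr_of :: "(real \<Rightarrow> complex) \<Rightarrow> distribution" where
  "distr_of g \<phi> = (LINT x|lborel. g x * \<phi> x)"

definition supported_in :: "real \<Rightarrow> (real \<Rightarrow> 'a::zero) \<Rightarrow> bool" where
  "supported_in R g \<longleftrightarrow> (\<forall>x. \<bar>x\<bar> > R \<longrightarrow> g x = 0)"

text \<open>The pairing \<open>\<langle>f, g\<rangle>\<close> with a compactly supported \<open>C\<^sup>m\<close> function \<open>g\<close>, for
  a distribution \<open>f\<close> of (local) order at most \<open>m\<close>: the extension of \<open>f\<close> by continuity from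
  test functions to \<open>g\<close>, where convergence is uniform convergence of the derivatives up to order
  \<open>m\<close> with all supports in one compact set. As test functions are dense, the value is unique
  and does not depend on \<open>m\<close>.\<close>

definition pairing :: "distribution \<Rightarrow> (real \<Rightarrow> complex) \<Rightarrow> complex" where
  "pairing f g = (THE c. \<exists>m. C_k m g \<and>
     (\<forall>\<phi> R. (\<forall>n k. C_k k (\<phi> n)) \<longrightarrow> (\<forall>n. supported_in R (\<phi> n)) \<longrightarrow>
        (\<forall>i\<le>m. uniform_limit UNIV (\<lambda>n. iter_deriv i (\<phi> n)) (iter_deriv i g) sequentially) \<longrightarrow>
        (\<lambda>n. f (\<phi> n)) \<longlonglongrightarrow> c))"

text \<open>Only used with positive exponent \<open>a\<close>.\<close>

definition ennreal_powr :: "ennreal \<Rightarrow> real \<Rightarrow> ennreal" where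
  "ennreal_powr x a = (if x = \<infinity> then \<infinity> else ennreal (enn2real x powr a))"

definition Lp_norm :: "ereal \<Rightarrow> (real \<Rightarrow> complex) \<Rightarrow> ennreal" where
  "Lp_norm p g =
     (if p = \<infinity> then esssup lborel (\<lambda>x. ennreal (norm (g x)))
      else ennreal_powr (\<integral>\<^sup>+x. ennreal (norm (g x) powr real_of_ereal p) \<partial>lborel)
             (1 / real_of_ereal p))"

definition lq_norm :: "ereal \<Rightarrow> (nat \<Rightarrow> ennreal) \<Rightarrow> ennreal" where
  "lq_norm q a =
     (if q = \<infinity> then (SUP j. a j)
      else ennreal_powr (\<Sum>j. ennreal_powr (a j) (real_of_ereal q)) (1 / real_of_ereal q))"

text \<open>\<open>\<phi>\<^sub>0\<close> generates the smooth dyadic resolution of unity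
  \<open>\<phi>\<^sub>j(\<xi>) = \<phi>\<^sub>0(2\<^sup>-\<^sup>j \<xi>) - \<phi>\<^sub>0(2\<^sup>-\<^sup>j\<^sup>+\<^sup>1 \<xi>)\<close>, \<open>j \<ge> 1\<close>.\<close>

definition resolution_generator :: "(real \<Rightarrow> complex) \<Rightarrow> bool" where
  "resolution_generator \<phi>0 \<longleftrightarrow> schwartz \<phi>0 \<and>
     (\<forall>\<xi>. \<bar>\<xi>\<bar> \<le> 1 \<longrightarrow> \<phi>0 \<xi> = 1) \<and> (\<forall>\<xi>. \<bar>\<xi>\<bar> \<ge> 3/2 \<longrightarrow> \<phi>0 \<xi> = 0)"

definition resolution :: "(real \<Rightarrow> complex) \<Rightarrow> nat \<Rightarrow> real \<Rightarrow> complex" where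
  "resolution \<phi>0 j \<xi> = (if j = 0 then \<phi>0 \<xi> else \<phi>0 (\<xi> / 2 ^ j) - \<phi>0 (\<xi> / 2 ^ (j - 1)))"

definition inv_fourier :: "(real \<Rightarrow> complex) \<Rightarrow> real \<Rightarrow> complex" where
  "inv_fourier \<phi> x = (LINT \<xi>|lborel. \<phi> \<xi> * cis (x * \<xi>)) / of_real (2 * pi)"

text \<open>The smooth function \<open>F\<^sup>-\<^sup>1[\<phi>\<^sub>j F f]\<close>, i.e. the convolution of \<open>f\<close> with the
  Schwartz function \<open>F\<^sup>-\<^sup>1 \<phi>\<^sub>j\<close>.\<close>

definition LP_block :: "(real \<Rightarrow> complex) \<Rightarrow> nat \<Rightarrow> distribution \<Rightarrow> real \<Rightarrow> complex" where
  "LP_block \<phi>0 j f x = f (\<lambda>y. inv_fourier (resolution \<phi>0 j) (x - y))"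

definition besov_norm ::
    "(real \<Rightarrow> complex) \<Rightarrow> real \<Rightarrow> ereal \<Rightarrow> ereal \<Rightarrow> distribution \<Rightarrow> ennreal" where
  "besov_norm \<phi>0 s p q f =
     lq_norm q (\<lambda>j. ennreal (2 powr (real j * s)) * Lp_norm p (LP_block \<phi>0 j f))"

definition besov_space ::
    "(real \<Rightarrow> complex) \<Rightarrow> real \<Rightarrow> ereal \<Rightarrow> ereal \<Rightarrow> distribution set" where
  "besov_space \<phi>0 s p q = {f. tempered f \<and> besov_norm \<phi>0 s p q f < \<infinity>}"

text \<open>\<open>h\<close> is the (finite, real) low-pass filter of the multiresolution analysis. The
  wavelet belonging to \<open>\<psi>\<^sub>0\<close> is determined up to sign and integer translation,
  whence the sign \<open>c\<close> and the odd integer \<open>m\<close>; the choice \<open>c = 1\<close>, \<open>m = 1\<close> is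
  the most common one.\<close>

definition daubechies_system ::
    "nat \<Rightarrow> nat \<Rightarrow> (real \<Rightarrow> real) \<Rightarrow> (real \<Rightarrow> real) \<Rightarrow> bool" where
  "daubechies_system K L \<psi>0 \<psi> \<longleftrightarrow>
     C_k K \<psi>0 \<and> C_k K \<psi> \<and>
     (\<exists>R. supported_in R \<psi>0) \<and> (\<exists>R. supported_in R \<psi>) \<and>
     (LINT x|lborel. \<psi>0 x) = 1 \<and>
     (\<forall>\<nu>::int. (LINT x|lborel. \<psi>0 x * \<psi>0 (x - of_int \<nu>)) = (if \<nu> = 0 then 1 else 0)) \<and>
     (\<exists>(h::int \<Rightarrow> real) (c::real) (m::int). finite {k. h k \<noteq> 0} \<and> \<bar>c\<bar> = 1 \<and> odd m \<and>
        (\<forall>x. \<psi>0 x = sqrt 2 * (\<Sum>k | h k \<noteq> 0. h k * \<psi>0 (2 * x - of_int k))) \<and>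
        (\<forall>x. \<psi> x = c * sqrt 2 *
           (\<Sum>k | h (m - k) \<noteq> 0. (-1) powi k * h (m - k) * \<psi>0 (2 * x - of_int k)))) \<and>
     (\<forall>n<L. (LINT x|lborel. x ^ n * \<psi> x) = 0)"

definition wavelet :: "(real \<Rightarrow> real) \<Rightarrow> (real \<Rightarrow> real) \<Rightarrow> nat \<Rightarrow> int \<Rightarrow> real \<Rightarrow> real" where
  "wavelet \<psi>0 \<psi> j \<nu> x =
     (if j = 0 then \<psi>0 (x - of_int \<nu>) else 1 / sqrt 2 * \<psi> (2 ^ (j - 1) * x - of_int \<nu>))"

definition wavelet_coeff ::
    "(real \<Rightarrow> real) \<Rightarrow> (real \<Rightarrow> real) \<Rightarrow> nat \<Rightarrow> int \<Rightarrow> distribution \<Rightarrow> complex" where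
  "wavelet_coeff \<psi>0 \<psi> j \<nu> f = 2 ^ j * pairing f (\<lambda>x. of_real (wavelet \<psi>0 \<psi> j \<nu> x))"

text \<open>The sums over \<open>\<nu> \<in> \<int>\<close> and \<open>\<mu> \<in> \<int>\<close> below have only finitely many nonzero terms
  at each point.\<close>

definition wavelet_block ::
    "(real \<Rightarrow> real) \<Rightarrow> (real \<Rightarrow> real) \<Rightarrow> nat \<Rightarrow> distribution \<Rightarrow> real \<Rightarrow> complex" where
  "wavelet_block \<psi>0 \<psi> j f x =
     (\<Sum>\<^sub>\<infinity>\<nu>. wavelet_coeff \<psi>0 \<psi> j \<nu> f * of_real (wavelet \<psi>0 \<psi> j \<nu> x))"

definition partial_sum_op ::
    "(real \<Rightarrow> real) \<Rightarrow> (real \<Rightarrow> real) \<Rightarrow> nat \<Rightarrow> distribution \<Rightarrow> real \<Rightarrow> complex" where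
  "partial_sum_op \<psi>0 \<psi> N f x = (\<Sum>j\<le>N. wavelet_block \<psi>0 \<psi> j f x)"

definition wavelet_norm ::
    "(real \<Rightarrow> real) \<Rightarrow> (real \<Rightarrow> real) \<Rightarrow> real \<Rightarrow> ereal \<Rightarrow> ereal \<Rightarrow> distribution \<Rightarrow> ennreal" where
  "wavelet_norm \<psi>0 \<psi> s p q f =
     lq_norm q (\<lambda>j. Lp_norm p (\<lambda>x. of_real (2 powr (real j * s)) *
       (\<Sum>\<^sub>\<infinity>\<nu>::int. wavelet_coeff \<psi>0 \<psi> j \<nu> f *
          indicator {of_int \<nu> / 2 ^ j .. (of_int \<nu> + 1) / 2 ^ j} x)))"

definition wavelet_characterization ::
    "(real \<Rightarrow> complex) \<Rightarrow> (real \<Rightarrow> real) \<Rightarrow> (real \<Rightarrow> real) \<Rightarrow> real \<Rightarrow> ereal \<Rightarrow> bool" where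
  "wavelet_characterization \<phi>0 \<psi>0 \<psi> s p \<longleftrightarrow>
     (\<forall>q>0. \<exists>A>0. \<exists>B>0. \<forall>f\<in>besov_space \<phi>0 s p q.
        ennreal A * besov_norm \<phi>0 s p q f \<le> wavelet_norm \<psi>0 \<psi> s p q f \<and>
        wavelet_norm \<psi>0 \<psi> s p q f \<le> ennreal B * besov_norm \<phi>0 s p q f)"

definition dyadic_interval :: "nat \<Rightarrow> int \<Rightarrow> real set" where
  "dyadic_interval N \<mu> = {of_int \<mu> / 2 ^ N ..< (of_int \<mu> + 1) / 2 ^ N}"

text \<open>The integral of the distribution \<open>f\<close> over an interval \<open>I\<close>, as the pairing with the
  characteristic function of \<open>I\<close> along the decomposition of \<open>f\<close> into its wavelet blocks.\<close>

definition distr_integral ::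
    "(real \<Rightarrow> real) \<Rightarrow> (real \<Rightarrow> real) \<Rightarrow> real set \<Rightarrow> distribution \<Rightarrow> complex" where
  "distr_integral \<psi>0 \<psi> I f = (\<Sum>j. LBINT t:I. wavelet_block \<psi>0 \<psi> j f t)"

definition dyadic_avg ::
    "(real \<Rightarrow> real) \<Rightarrow> (real \<Rightarrow> real) \<Rightarrow> nat \<Rightarrow> distribution \<Rightarrow> real \<Rightarrow> complex" where
  "dyadic_avg \<psi>0 \<psi> N f x =
     (\<Sum>\<^sub>\<infinity>\<mu>. indicator (dyadic_interval N \<mu>) x *
        (2 ^ N * distr_integral \<psi>0 \<psi> (dyadic_interval N \<mu>) f))"

end

theory Submission
  imports Defs
begin

text \<open>Write \<open>t = 1 / p\<close>. A distribution \<open>f\<close> enters the remainder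
\<open>G = E\<^sub>N f - P\<^sub>N f\<close> only through its wavelet coefficients, and the wavelet
characterization with \<open>q = \<infinity>\<close> says that the coefficients of level \<open>j\<close> have
\<open>l\<^sub>p\<close> norm at most a constant times \<open>2 powr (- j * (s - t))\<close> times the norm of
\<open>f\<close>. So the task is to estimate the Littlewood-Paley blocks of \<open>G\<close> by the coefficients.

The function \<open>G\<close> behaves like a function of frequency \<open>2\<^sup>N\<close>, and one sequence
witnesses this: \<open>g \<mu>\<close>, the sum over all levels \<open>j\<close> of \<open>2 powr (- \<bar>j - N\<bar>)\<close>
times the coefficients of level \<open>j\<close> that live near the cell \<open>I\<^sub>\<mu>\<close> of length
\<open>2 powr (- N)\<close>. On a cell, \<open>G\<close> is a constant minus \<open>P\<^sub>N f\<close>. Levels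
\<open>j \<le> N\<close> contribute smooth functions with derivatives of size \<open>2\<^sup>j\<close>, so
\<open>P\<^sub>N f\<close> has derivative at most \<open>2\<^sup>N * g \<mu>\<close> there. A level \<open>j > N\<close>
contributes only its mean over the cell; as the wavelet has integral zero, the mean is the difference
of a compactly supported primitive at the two end points, of size \<open>2 powr (N - j)\<close>. Hence, up to
constants, \<open>G\<close> is at most \<open>g \<mu>\<close> on the cell. Moreover \<open>G\<close> has a primitive that is
continuous across the cells and at most \<open>2 powr (- N) * g \<mu>\<close> (\<open>wavelet_remainder\<close>,
\<open>cell_value_bound\<close>).

For \<open>k \<le> N\<close> the convolution of \<open>G\<close> with the \<open>k\<close>-th Littlewood-Paley kernel is
integrated by parts with this primitive, the derivative falling on the kernel
(\<open>integral_against_smooth_kernel\<close>). For \<open>k > N\<close> the kernel itself is the derivative of a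
rapidly decaying function, and integration by parts on each cell leaves the jumps of \<open>G\<close> and its
derivative (\<open>integral_against_rough_kernel\<close>). Both times the block is bounded pointwise by
\<open>g\<close> summed against bumps centred at the grid points.

What remains are linear estimates between \<open>L\<^sub>p\<close> spaces of positive kernels, from the
coefficients to \<open>g\<close> (\<open>cell_majorant_norm\<close>) and from \<open>g\<close> to the blocks
(\<open>bump_sum_norm_low\<close>, \<open>bump_sum_norm_high\<close>). They follow from Schur tests, in a separate
form for \<open>p < 1\<close>. The result is that \<open>2 powr (k * s)\<close> times the \<open>L\<^sub>p\<close> norm
of block \<open>k\<close> decays like \<open>2 powr (- \<delta> * \<bar>k - N\<bar>)\<close>, where \<open>\<delta>\<close> is the minimum
of \<open>2 + s - max 1 t\<close> and \<open>min 1 t - s\<close> (\<open>besov_level_bound\<close>). It is positive in the given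
range of \<open>s\<close>, and a sequence with this decay is in \<open>l\<^sub>r\<close> for every \<open>r > 0\<close>, with
a norm that does not depend on \<open>N\<close>.\<close>

section \<open>Real powers of extended nonnegative reals\<close>

lemma ennreal_powr_ennreal: "0 \<le> x \<Longrightarrow> ennreal_powr (ennreal x) a = ennreal (x powr a)"
  by (simp add: ennreal_powr_def)

lemma ennreal_powr_top [simp]: "ennreal_powr \<infinity> a = \<infinity>" "ennreal_powr top a = top"
  by (simp_all add: ennreal_powr_def)

lemma ennreal_powr_0 [simp]: "ennreal_powr 0 a = 0"
  by (simp add: ennreal_powr_def)

lemma ennreal_powr_mono: "x \<le> y \<Longrightarrow> 0 \<le> a \<Longrightarrow> ennreal_powr x a \<le> ennreal_powr y a"
  by (cases x; cases y) (auto simp: ennreal_powr_ennreal powr_mono2 top_unique)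

lemma ennreal_powr_mult:
  assumes "0 < a"
  shows "ennreal_powr (x * y) a = ennreal_powr x a * ennreal_powr y a"
proof (cases x; cases y)
  fix r s :: real
  assume "0 \<le> r" "x = ennreal r" "0 \<le> s" "y = ennreal s"
  then show ?thesis
    by (simp add: ennreal_powr_ennreal ennreal_mult[symmetric] powr_mult)
next
  fix r :: real
  assume r: "0 \<le> r" "x = ennreal r" "y = top"
  show ?thesis
    using r assms by (cases "r = 0") (auto simp: ennreal_powr_ennreal ennreal_mult_top)
next
  fix r :: real
  assume r: "0 \<le> r" "y = ennreal r" "x = top"
  show ?thesis
    using r assms by (cases "r = 0") (auto simp: ennreal_powr_ennreal ennreal_top_mult)
qed simp_all

lemma ennreal_powr_inverse: "0 < a \<Longrightarrow> ennreal_powr (ennreal_powr x (1 / a)) a = x"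
  by (cases x) (simp_all add: ennreal_powr_ennreal powr_powr)

lemma borel_measurable_ennreal_powr [measurable]:
  "f \<in> borel_measurable M \<Longrightarrow> (\<lambda>x. ennreal_powr (f x) a) \<in> borel_measurable M"
  unfolding ennreal_powr_def infinity_ennreal_def by simp

abbreviation count_sum :: "('i \<Rightarrow> ennreal) \<Rightarrow> ennreal" (binder "\<Sum>\<^sup>+" 10) where
  "count_sum f \<equiv> integral\<^sup>N (count_space UNIV) f"

text \<open>If \<open>Q\<close> denotes the right-hand side, each \<open>x i\<close> is at most \<open>Q powr (1 / p)\<close>;
  hence \<open>x i = x i powr p * x i powr (1 - p)\<close> is at most \<open>x i powr p\<close> times a constant power of
  \<open>Q\<close>, and these bounds add up to \<open>Q powr (1 / p)\<close>.\<close>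

lemma ennreal_powr_sum_le:
  fixes x :: "'i \<Rightarrow> ennreal"
  assumes p: "0 < p" "p \<le> 1"
  shows "ennreal_powr (\<Sum>\<^sup>+i. x i) p \<le> (\<Sum>\<^sup>+i. ennreal_powr (x i) p)"
    (is "_ \<le> ?Q")
proof (cases ?Q)
  case (real q)
  have "x i \<le> ennreal_powr (x i) p * ennreal (q powr ((1 - p) / p))" for i
  proof -
    have le: "ennreal_powr (x i) p \<le> ennreal q"
      unfolding real(2)[symmetric] by (rule nn_integral_ge_point) simp
    show ?thesis
    proof (cases "x i")
      case (real r)
      have "r powr p \<le> q"
        using le real \<open>0 \<le> q\<close> by (simp add: ennreal_powr_ennreal)
      then have "(r powr p) powr ((1 - p) / p) \<le> q powr ((1 - p) / p)"
        using p by (intro powr_mono2) auto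
      moreover have "r = r powr p * (r powr p) powr ((1 - p) / p)"
        using p real by (simp add: powr_powr powr_add[symmetric])
      ultimately have "r \<le> r powr p * q powr ((1 - p) / p)"
        by (metis mult_left_mono powr_ge_zero)
      then show ?thesis
        using real by (simp add: ennreal_powr_ennreal ennreal_mult[symmetric])
    qed (use le in \<open>simp add: top_unique\<close>)
  qed
  then have "(\<Sum>\<^sup>+i. x i)
      \<le> (\<Sum>\<^sup>+i. ennreal_powr (x i) p * ennreal (q powr ((1 - p) / p)))"
    by (intro nn_integral_mono) auto
  also have "\<dots> = ?Q * ennreal (q powr ((1 - p) / p))"
    by (rule nn_integral_multc) simp
  also have "\<dots> = ennreal (q * q powr ((1 - p) / p))"
    using real by (simp add: ennreal_mult)
  also have "q * q powr ((1 - p) / p) = q powr (1 / p)"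
  proof -
    have "q * q powr ((1 - p) / p) = q powr 1 * q powr ((1 - p) / p)"
      using real(1) by simp
    also have "\<dots> = q powr (1 / p)"
      unfolding powr_add[symmetric] using p by (simp add: field_simps)
    finally show ?thesis .
  qed
  finally have "ennreal_powr (\<Sum>\<^sup>+i. x i) p \<le> ennreal_powr (ennreal (q powr (1 / p))) p"
    using p by (intro ennreal_powr_mono) auto
  also have "\<dots> = ?Q"
    using p real by (simp add: ennreal_powr_ennreal powr_powr)
  finally show ?thesis .
qed simp

text \<open>The power function lies above its tangent at \<open>m\<close>.\<close>

lemma powr_tangent_le:
  fixes u m p :: real
  assumes "1 \<le> p" "0 \<le> u" "0 < m"
  shows "p * m powr (p - 1) * u \<le> u powr p + (p - 1) * m powr p"
proof (cases "p = 1")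
  case False
  then have p: "1 < p" using assms by simp
  have "u * m powr (p - 1) \<le> u powr p / p + (m powr (p - 1)) powr (p / (p - 1)) / (p / (p - 1))"
    using p assms by (intro Youngs_inequality) (auto simp: field_simps)
  also have "(m powr (p - 1)) powr (p / (p - 1)) = m powr p"
    using p by (simp add: powr_powr)
  finally show ?thesis
    using p by (simp add: field_simps)
qed (use assms in auto)

text \<open>Jensen's inequality for weights of total mass at most \<open>\<alpha>\<close>: the tangent inequality at
  \<open>m\<close> is integrated, and the choice of \<open>m\<close> as the mean value \<open>S / \<alpha>\<close> is optimal.\<close>

lemma ennreal_powr_jensen:
  fixes w x :: "'i \<Rightarrow> ennreal"
  assumes p: "1 \<le> p" and \<alpha>: "0 \<le> \<alpha>" and W: "(\<Sum>\<^sup>+i. w i) \<le> ennreal \<alpha>"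
  shows "ennreal_powr (\<Sum>\<^sup>+i. w i * x i) p
    \<le> ennreal (\<alpha> powr (p - 1)) * (\<Sum>\<^sup>+i. w i * ennreal_powr (x i) p)"
    (is "ennreal_powr ?S p \<le> _ * ?T")
proof (cases "?S = 0 \<or> ?T = top")
  case True
  moreover have "?S = 0" if "\<alpha> = 0"
  proof -
    have "w i = 0" for i
      using nn_integral_ge_point[of i UNIV w] W that by simp
    then show ?thesis by simp
  qed
  ultimately show ?thesis
    using \<alpha> by (cases "\<alpha> = 0") (auto simp: ennreal_mult_top)
next
  case False
  then obtain T where T: "?T = ennreal T" "0 \<le> T" by (cases ?T) auto
  have tan: "ennreal (p * m powr (p - 1)) * ?S \<le> ?T + ennreal ((p - 1) * m powr p * \<alpha>)"
    if m: "0 < m" for m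
  proof -
    have pt: "ennreal (p * m powr (p - 1)) * y \<le> ennreal_powr y p + ennreal ((p - 1) * m powr p)" for y
    proof (cases y)
      case (real u)
      then show ?thesis
        using powr_tangent_le[OF p real(1) m] p
        by (simp add: ennreal_powr_ennreal ennreal_mult[symmetric] ennreal_plus[symmetric] del: ennreal_plus)
    qed simp
    have "ennreal (p * m powr (p - 1)) * ?S
        = (\<Sum>\<^sup>+i. w i * (ennreal (p * m powr (p - 1)) * x i))"
      by (subst nn_integral_cmult[symmetric]) (auto simp: ac_simps)
    also have "\<dots> \<le> (\<Sum>\<^sup>+i. w i * (ennreal_powr (x i) p + ennreal ((p - 1) * m powr p)))"
      by (intro nn_integral_mono mult_left_mono pt) auto
    also have "\<dots> = ?T + (\<Sum>\<^sup>+i. w i) * ennreal ((p - 1) * m powr p)"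
      by (simp add: distrib_left nn_integral_add nn_integral_multc)
    also have "\<dots> \<le> ?T + ennreal \<alpha> * ennreal ((p - 1) * m powr p)"
      by (intro add_left_mono mult_right_mono W) auto
    also have "\<dots> = ?T + ennreal ((p - 1) * m powr p * \<alpha>)"
      using \<alpha> p by (simp add: ennreal_mult[symmetric] ac_simps)
    finally show ?thesis .
  qed
  have "ennreal p * ?S < top"
    using tan[of 1] T p by (simp add: le_less_trans top.not_eq_extremum)
  then have "?S \<noteq> top" using p by (auto simp: ennreal_mult_top)
  then obtain S where S: "?S = ennreal S" "0 \<le> S" by (cases ?S) auto
  have S0: "0 < S" using S False by (cases "S = 0") auto
  have \<alpha>0: "0 < \<alpha>"
  proof (rule ccontr)
    assume "\<not> 0 < \<alpha>"
    then have "\<alpha> = 0" using \<alpha> by simp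
    then have "w i = 0" for i
      using nn_integral_ge_point[of i UNIV w] W by simp
    then show False using False by simp
  qed
  define m where "m = S / \<alpha>"
  have m: "0 < m" using S0 \<alpha>0 by (simp add: m_def)
  have "p * m powr (p - 1) * S \<le> T + (p - 1) * m powr p * \<alpha>"
    using tan[OF m] S T p \<alpha>0 m
    by (simp add: ennreal_mult[symmetric] ennreal_plus[symmetric] del: ennreal_plus)
  moreover have "m powr (p - 1) * S = m powr p * \<alpha>"
    using m \<alpha>0 S0 by (simp add: powr_diff m_def)
  ultimately have "p * (m powr p * \<alpha>) \<le> T + (p - 1) * (m powr p * \<alpha>)"
    by (metis mult.assoc)
  then have "m powr p * \<alpha> \<le> T"
    by (simp add: left_diff_distrib)
  then have "\<alpha> powr (p - 1) * (m powr p * \<alpha>) \<le> \<alpha> powr (p - 1) * T"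
    by (intro mult_left_mono) auto
  moreover have "\<alpha> powr (p - 1) * (m powr p * \<alpha>) = S powr p"
    using \<alpha>0 S0 by (simp add: m_def powr_divide powr_diff)
  ultimately show ?thesis
    using S T by (simp add: ennreal_powr_ennreal ennreal_mult[symmetric])
qed

section \<open>Schur tests for all Lebesgue exponents\<close>

text \<open>The \<open>L\<^sub>p\<close> norm of a nonnegative function, parametrized by \<open>t = 1 / p\<close>: exponents of
  scale factors are affine in \<open>t\<close>, and \<open>p = \<infinity>\<close> becomes the ordinary value
  \<open>t = 0\<close>. There the supremum replaces the essential supremum, as only upper bounds of functions
  and norms of sequences are taken.\<close>

definition recip_norm :: "real \<Rightarrow> 'a measure \<Rightarrow> ('a \<Rightarrow> ennreal) \<Rightarrow> ennreal" where
  "recip_norm t M f = (if t = 0 then (SUP x\<in>space M. f x)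
     else ennreal_powr (\<integral>\<^sup>+x. ennreal_powr (f x) (1 / t) \<partial>M) t)"

abbreviation seq_norm :: "real \<Rightarrow> ('i \<Rightarrow> ennreal) \<Rightarrow> ennreal" where
  "seq_norm t \<equiv> recip_norm t (count_space UNIV)"

lemma recip_norm_mono:
  assumes "0 \<le> t" "\<And>x. x \<in> space M \<Longrightarrow> f x \<le> g x"
  shows "recip_norm t M f \<le> recip_norm t M g"
  using assms unfolding recip_norm_def
  by (auto intro!: ennreal_powr_mono nn_integral_mono SUP_subset_mono)

lemma recip_norm_cmult:
  assumes "0 \<le> t" "f \<in> borel_measurable M"
  shows "recip_norm t M (\<lambda>x. c * f x) = c * recip_norm t M f"
proof (cases "t = 0")
  case True
  then show ?thesis by (simp add: recip_norm_def SUP_mult_left_ennreal)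
next
  case False
  with assms have t: "0 < t" by simp
  have "(\<integral>\<^sup>+x. ennreal_powr (c * f x) (1 / t) \<partial>M) = ennreal_powr c (1 / t) * (\<integral>\<^sup>+x. ennreal_powr (f x) (1 / t) \<partial>M)"
    using t assms(2) by (simp add: ennreal_powr_mult nn_integral_cmult)
  then show ?thesis
    using t by (simp add: recip_norm_def ennreal_powr_mult ennreal_powr_inverse)
qed

text \<open>For \<open>p \<le> 1\<close> the \<open>p\<close>-th power is subadditive, so that it is enough to bound each column
  of the kernel in \<open>L\<^sub>p\<close>.\<close>

lemma schur_quasi:
  fixes K :: "'a \<Rightarrow> 'i::countable \<Rightarrow> ennreal"
  assumes t: "1 \<le> t" and [measurable]: "\<And>i. (\<lambda>x. K x i) \<in> borel_measurable M"
    and \<beta>: "0 \<le> \<beta>" "\<And>i. (\<integral>\<^sup>+x. ennreal_powr (K x i) (1 / t) \<partial>M) \<le> ennreal \<beta>"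
  shows "recip_norm t M (\<lambda>x. \<Sum>\<^sup>+i. K x i * a i)
    \<le> ennreal (\<beta> powr t) * seq_norm t a"
proof -
  have "(\<integral>\<^sup>+x. ennreal_powr (\<Sum>\<^sup>+i. K x i * a i) (1 / t) \<partial>M)
      \<le> (\<integral>\<^sup>+x. (\<Sum>\<^sup>+i. ennreal_powr (K x i * a i) (1 / t)) \<partial>M)"
    using t by (intro nn_integral_mono ennreal_powr_sum_le) auto
  also have "\<dots> = (\<Sum>\<^sup>+i. (\<integral>\<^sup>+x. ennreal_powr (K x i * a i) (1 / t) \<partial>M))"
    by (rule nn_integral_count_space_nn_integral) auto
  also have "\<dots> = (\<Sum>\<^sup>+i. (\<integral>\<^sup>+x. ennreal_powr (K x i) (1 / t) \<partial>M) * ennreal_powr (a i) (1 / t))"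
    using t by (simp add: ennreal_powr_mult nn_integral_multc)
  also have "\<dots> \<le> (\<Sum>\<^sup>+i. ennreal \<beta> * ennreal_powr (a i) (1 / t))"
    by (intro nn_integral_mono mult_right_mono \<beta>) auto
  also have "\<dots> = ennreal \<beta> * (\<Sum>\<^sup>+i. ennreal_powr (a i) (1 / t))"
    by (simp add: nn_integral_cmult)
  finally show ?thesis
    using t \<beta> by (auto simp: recip_norm_def ennreal_powr_mult[symmetric] ennreal_powr_ennreal[symmetric]
        intro!: ennreal_powr_mono)
qed

text \<open>Jensen's inequality with the kernel as weight, followed by Tonelli's theorem.\<close>

lemma schur_test:
  fixes K :: "'a \<Rightarrow> 'i::countable \<Rightarrow> ennreal"
  assumes t: "0 \<le> t" "t \<le> 1" and [measurable]: "\<And>i. (\<lambda>x. K x i) \<in> borel_measurable M"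
    and \<alpha>: "0 \<le> \<alpha>" "\<And>x. x \<in> space M \<Longrightarrow> (\<Sum>\<^sup>+i. K x i) \<le> ennreal \<alpha>"
    and \<beta>: "0 < \<beta>" "\<And>i. (\<integral>\<^sup>+x. K x i \<partial>M) \<le> ennreal \<beta>"
  shows "recip_norm t M (\<lambda>x. \<Sum>\<^sup>+i. K x i * a i)
    \<le> ennreal (\<alpha> powr (1 - t) * \<beta> powr t) * seq_norm t a"
proof (cases "t = 0")
  case True
  have "(\<Sum>\<^sup>+i. K x i * a i) \<le> ennreal \<alpha> * (SUP i. a i)" if "x \<in> space M" for x
  proof -
    have "(\<Sum>\<^sup>+i. K x i * a i) \<le> (\<Sum>\<^sup>+i. K x i * (SUP i. a i))"
      by (intro nn_integral_mono mult_left_mono SUP_upper) auto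
    also have "\<dots> \<le> ennreal \<alpha> * (SUP i. a i)"
      using \<alpha>(2)[OF that] by (simp add: nn_integral_multc mult_right_mono)
    finally show ?thesis .
  qed
  then show ?thesis
    using True \<alpha> \<beta> by (auto simp: recip_norm_def intro!: SUP_least)
next
  case False
  with t have t0: "0 < t" by simp
  let ?p = "1 / t"
  have p: "1 \<le> ?p" using t0 t by simp
  have inner: "(\<Sum>\<^sup>+i. (\<integral>\<^sup>+x. K x i * ennreal_powr (a i) ?p \<partial>M))
      \<le> ennreal \<beta> * (\<Sum>\<^sup>+i. ennreal_powr (a i) ?p)"
  proof -
    have "(\<Sum>\<^sup>+i. (\<integral>\<^sup>+x. K x i * ennreal_powr (a i) ?p \<partial>M))
        = (\<Sum>\<^sup>+i. (\<integral>\<^sup>+x. K x i \<partial>M) * ennreal_powr (a i) ?p)"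
      by (simp add: nn_integral_multc)
    also have "\<dots> \<le> (\<Sum>\<^sup>+i. ennreal \<beta> * ennreal_powr (a i) ?p)"
      by (intro nn_integral_mono mult_right_mono \<beta>) auto
    finally show ?thesis by (simp add: nn_integral_cmult)
  qed
  have "(\<integral>\<^sup>+x. ennreal_powr (\<Sum>\<^sup>+i. K x i * a i) ?p \<partial>M)
      \<le> (\<integral>\<^sup>+x. ennreal (\<alpha> powr (?p - 1)) * (\<Sum>\<^sup>+i. K x i * ennreal_powr (a i) ?p) \<partial>M)"
    using p by (intro nn_integral_mono ennreal_powr_jensen \<alpha>) auto
  also have "\<dots> = (\<integral>\<^sup>+x. (\<Sum>\<^sup>+i. ennreal (\<alpha> powr (?p - 1)) * (K x i * ennreal_powr (a i) ?p)) \<partial>M)"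
    by (simp add: nn_integral_cmult)
  also have "\<dots> = (\<Sum>\<^sup>+i. (\<integral>\<^sup>+x. ennreal (\<alpha> powr (?p - 1)) * (K x i * ennreal_powr (a i) ?p) \<partial>M))"
    by (rule nn_integral_count_space_nn_integral) auto
  also have "\<dots> = ennreal (\<alpha> powr (?p - 1)) * (\<Sum>\<^sup>+i. (\<integral>\<^sup>+x. K x i * ennreal_powr (a i) ?p \<partial>M))"
    by (simp add: nn_integral_cmult)
  also have "\<dots> \<le> ennreal (\<alpha> powr (?p - 1)) * (ennreal \<beta> * (\<Sum>\<^sup>+i. ennreal_powr (a i) ?p))"
    by (intro mult_left_mono inner) auto
  finally have *: "(\<integral>\<^sup>+x. ennreal_powr (\<Sum>\<^sup>+i. K x i * a i) ?p \<partial>M)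
      \<le> ennreal (\<alpha> powr (?p - 1)) * (ennreal \<beta> * (\<Sum>\<^sup>+i. ennreal_powr (a i) ?p))" .
  have "ennreal_powr (ennreal (\<alpha> powr (?p - 1))) t = ennreal (\<alpha> powr (1 - t))"
    using t0 by (simp add: ennreal_powr_ennreal powr_powr algebra_simps)
  moreover have "ennreal_powr (ennreal \<beta>) t = ennreal (\<beta> powr t)"
    using \<beta> by (simp add: ennreal_powr_ennreal)
  ultimately show ?thesis
    using ennreal_powr_mono[OF *, of t] t0
    by (simp add: recip_norm_def ennreal_powr_mult ennreal_mult mult.assoc)
qed

section \<open>Bump functions on dyadic grids\<close>

definition bump :: "nat \<Rightarrow> real \<Rightarrow> real" where
  "bump n u = 1 / (1 + \<bar>u\<bar>) ^ n"

lemma bump_pos [simp]: "0 < bump n u" and bump_nonneg [simp]: "0 \<le> bump n u"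
  by (simp_all add: bump_def add_pos_nonneg)

lemma bump_antimono: "\<bar>u\<bar> \<le> \<bar>v\<bar> \<Longrightarrow> bump n v \<le> bump n u"
  unfolding bump_def by (intro divide_left_mono power_mono mult_pos_pos zero_less_power) auto

lemma bump_exponent_antimono: "m \<le> n \<Longrightarrow> bump n u \<le> bump m u"
  unfolding bump_def by (intro divide_left_mono power_increasing mult_pos_pos zero_less_power) auto

lemma bump_add: "bump (m + n) u = bump m u * bump n u"
  by (simp add: bump_def power_add)

text \<open>Bumps are comparable at points of distance at most one, so a bump may be moved freely within a
  grid cell that is not longer than its own scale.\<close>

lemma bump_shift:
  assumes "\<bar>u - v\<bar> \<le> 1"
  shows "bump n v \<le> 2 ^ n * bump n u"
proof -
  have "(1 + \<bar>u\<bar>) ^ n \<le> (2 * (1 + \<bar>v\<bar>)) ^ n"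
    using assms by (intro power_mono) auto
  then have "(1 + \<bar>u\<bar>) ^ n \<le> 2 ^ n * (1 + \<bar>v\<bar>) ^ n"
    by (simp only: power_mult_distrib)
  moreover have "0 < (1 + \<bar>u\<bar>) ^ n" "0 < (1 + \<bar>v\<bar>) ^ n"
    by (auto intro!: zero_less_power)
  ultimately show ?thesis
    by (simp add: bump_def divide_simps mult.commute)
qed

lemma borel_measurable_bump [measurable]: "bump n \<in> borel_measurable borel"
  unfolding bump_def by measurable

text \<open>This is where \<open>p > 1 / 2\<close> meets the decay of order four: \<open>p\<close>-th powers of bumps remain
  integrable.\<close>

lemma bump_powr_le:
  assumes "1 / 2 \<le> q"
  shows "bump 4 u powr q \<le> bump 2 u"
proof -
  have "bump 4 u powr q = (1 + \<bar>u\<bar>) powr (- (4 * q))"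
    unfolding bump_def by (simp add: powr_divide powr_minus powr_powr field_simps flip: powr_numeral)
  also have "\<dots> \<le> (1 + \<bar>u\<bar>) powr (-2)"
    using assms by (intro powr_mono) auto
  also have "\<dots> = bump 2 u"
    by (simp add: bump_def powr_minus field_simps)
  finally show ?thesis .
qed

lemma powr_add_le:
  fixes a b q :: real
  assumes "0 \<le> a" "0 \<le> b" "0 < q" "q \<le> 1"
  shows "(a + b) powr q \<le> a powr q + b powr q"
proof (cases "a = 0 \<or> b = 0")
  case False
  then have ab: "0 < a" "0 < b" using assms by auto
  have "x * (a + b) powr (q - 1) \<le> x powr q" if "0 < x" "x \<le> a + b" for x
  proof -
    have "(a + b) powr (q - 1) \<le> x powr (q - 1)"
      using that assms by (intro powr_mono2') auto
    then have "x * (a + b) powr (q - 1) \<le> x * x powr (q - 1)"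
      using that by (intro mult_left_mono) auto
    also have "\<dots> = x powr q"
      using that by (simp add: powr_diff)
    finally show ?thesis .
  qed
  from this[of a] this[of b] have "(a + b) * (a + b) powr (q - 1) \<le> a powr q + b powr q"
    using ab by (simp add: distrib_right)
  moreover have "(a + b) * (a + b) powr (q - 1) = (a + b) powr q"
    using ab by (simp add: powr_diff)
  ultimately show ?thesis by simp
qed (use assms in auto)

lemma nn_integral_bump_half: "(\<integral>\<^sup>+u. ennreal (bump 2 u) * indicator {0..} u \<partial>lborel) = 1"
proof -
  have "(\<integral>\<^sup>+u. ennreal (bump 2 u) * indicator {0..} u \<partial>lborel) = ennreal (0 - (- 1 / (1 + 0)))"
  proof (rule nn_integral_FTC_atLeast)
    fix x :: real assume "0 \<le> x"
    then show "((\<lambda>u. - 1 / (1 + u)) has_real_derivative bump 2 x) (at x)"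
      by (auto intro!: derivative_eq_intros simp: bump_def power2_eq_square)
  next
    show "((\<lambda>u::real. - 1 / (1 + u)) \<longlongrightarrow> 0) at_top"
      by real_asymp
  qed auto
  then show ?thesis by simp
qed

lemma nn_integral_bump: "(\<integral>\<^sup>+u. ennreal (bump 2 u) \<partial>lborel) \<le> 2"
proof -
  have "(\<integral>\<^sup>+u. ennreal (bump 2 u) * indicator {..0} u \<partial>lborel)
      = (\<integral>\<^sup>+u. ennreal (bump 2 u) * indicator {0..} u \<partial>lborel)"
    using nn_integral_real_affine[of "\<lambda>u. ennreal (bump 2 u) * indicator {..0} u" "-1" 0]
    by (simp add: bump_def indicator_def)
  then have m: "(\<integral>\<^sup>+u. ennreal (bump 2 u) * indicator {..0} u \<partial>lborel) = 1"
    by (simp add: nn_integral_bump_half)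
  have "(\<integral>\<^sup>+u. ennreal (bump 2 u) \<partial>lborel)
      \<le> (\<integral>\<^sup>+u. ennreal (bump 2 u) * indicator {..0} u + ennreal (bump 2 u) * indicator {0..} u \<partial>lborel)"
    by (intro nn_integral_mono) (auto simp: indicator_def)
  also have "\<dots> = 1 + 1"
    by (simp add: nn_integral_add m nn_integral_bump_half)
  finally show ?thesis by simp
qed

lemma nn_integral_bump_scaled:
  assumes "0 < a"
  shows "(\<integral>\<^sup>+x. ennreal (bump 2 (a * (x - c))) \<partial>lborel) \<le> ennreal (2 / a)"
proof -
  have "(\<integral>\<^sup>+x. ennreal (bump 2 (a * (x - c))) \<partial>lborel)
      = ennreal (1 / a) * (\<integral>\<^sup>+u. ennreal (bump 2 u) \<partial>lborel)"
    using nn_integral_real_affine[of "\<lambda>x. ennreal (bump 2 (a * (x - c)))" "1 / a" c] assms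
    by simp
  also have "\<dots> \<le> ennreal (1 / a) * 2"
    by (intro mult_left_mono nn_integral_bump) auto
  also have "\<dots> = ennreal (2 / a)"
    using assms by (simp add: ennreal_mult'[symmetric] flip: ennreal_numeral)
  finally show ?thesis .
qed

lemma bump_reflect: "bump n (a * (x - y)) = bump n (a * (y - x))"
  by (simp add: bump_def abs_mult abs_minus_commute)

text \<open>A grid of mesh \<open>h\<close> finer than the scale \<open>1 / a\<close> of the bump gives a Riemann sum, whose
  terms are compared with the integrals over the grid cells.\<close>

lemma sum_bump_fine:
  assumes a: "0 < a" and h: "0 < h" and ah: "a * h \<le> 1"
  shows "(\<Sum>\<^sup>+\<nu>. ennreal (bump 2 (a * (x - h * of_int \<nu>)))) \<le> ennreal (8 / (a * h))"
proof -
  let ?I = "\<lambda>\<nu>::int. {h * of_int \<nu> ..< h * (of_int \<nu> + 1)}"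
  have 1: "ennreal (bump 2 (a * (x - h * of_int \<nu>)))
      \<le> (\<integral>\<^sup>+y. ennreal (4 / h * bump 2 (a * (x - y))) * indicator (?I \<nu>) y \<partial>lborel)" for \<nu> :: int
  proof -
    have "ennreal (bump 2 (a * (x - h * of_int \<nu>)))
        = (\<integral>\<^sup>+y. ennreal (1 / h * bump 2 (a * (x - h * of_int \<nu>))) * indicator (?I \<nu>) y \<partial>lborel)"
    proof (subst nn_integral_cmult_indicator)
      have "emeasure lborel (?I \<nu>) = ennreal h"
        using h by (simp add: algebra_simps)
      then show "ennreal (bump 2 (a * (x - h * of_int \<nu>)))
          = ennreal (1 / h * bump 2 (a * (x - h * of_int \<nu>))) * emeasure lborel (?I \<nu>)"
        using h by (simp add: ennreal_mult[symmetric])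
    qed simp
    also have "\<dots> \<le> (\<integral>\<^sup>+y. ennreal (4 / h * bump 2 (a * (x - y))) * indicator (?I \<nu>) y \<partial>lborel)"
    proof (intro nn_integral_mono)
      fix y
      show "ennreal (1 / h * bump 2 (a * (x - h * of_int \<nu>))) * indicator (?I \<nu>) y
        \<le> ennreal (4 / h * bump 2 (a * (x - y))) * indicator (?I \<nu>) y"
      proof (cases "y \<in> ?I \<nu>")
        case True
        have "\<bar>a * (x - y) - a * (x - h * of_int \<nu>)\<bar> = a * \<bar>y - h * of_int \<nu>\<bar>"
        proof -
          have "a * (x - y) - a * (x - h * of_int \<nu>) = - (a * (y - h * of_int \<nu>))"
            by (simp add: algebra_simps)
          then show ?thesis
            using a by (simp only: abs_minus_cancel abs_mult)
        qed
        also have "\<dots> \<le> a * h"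
          using True a by (intro mult_left_mono) (auto simp: algebra_simps)
        finally have "bump 2 (a * (x - h * of_int \<nu>)) \<le> 2 ^ 2 * bump 2 (a * (x - y))"
          using ah by (intro bump_shift) auto
        then show ?thesis
          using True h by (auto simp: divide_simps intro!: ennreal_leI)
      qed simp
    qed
    finally show ?thesis .
  qed
  have "(\<Sum>\<^sup>+\<nu>. ennreal (bump 2 (a * (x - h * of_int \<nu>))))
      \<le> (\<Sum>\<^sup>+\<nu>. (\<integral>\<^sup>+y. ennreal (4 / h * bump 2 (a * (x - y))) * indicator (?I \<nu>) y \<partial>lborel))"
    by (intro nn_integral_mono 1)
  also have "\<dots> = (\<integral>\<^sup>+y. (\<Sum>\<^sup>+\<nu>. ennreal (4 / h * bump 2 (a * (x - y))) * indicator (?I \<nu>) y) \<partial>lborel)"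
    by (rule nn_integral_count_space_nn_integral[symmetric]) auto
  also have "\<dots> \<le> (\<integral>\<^sup>+y. ennreal (4 / h * bump 2 (a * (x - y))) \<partial>lborel)"
  proof (intro nn_integral_mono)
    fix y :: real
    have "y \<in> ?I \<nu> \<longleftrightarrow> \<nu> = \<lfloor>y / h\<rfloor>" for \<nu>
      using h by (auto simp: floor_eq_iff field_simps eq_commute[of \<nu>])
    then have "(\<Sum>\<^sup>+\<nu>. ennreal (4 / h * bump 2 (a * (x - y))) * indicator (?I \<nu>) y)
        = (\<Sum>\<^sup>+\<nu>. ennreal (4 / h * bump 2 (a * (x - y))) * indicator {\<lfloor>y / h\<rfloor>} \<nu>)"
      by (intro nn_integral_cong) (auto simp: indicator_def)
    also have "\<dots> = ennreal (4 / h * bump 2 (a * (x - y)))"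
      by (subst nn_integral_cmult_indicator) auto
    finally show "(\<Sum>\<^sup>+\<nu>. ennreal (4 / h * bump 2 (a * (x - y))) * indicator (?I \<nu>) y)
      \<le> ennreal (4 / h * bump 2 (a * (x - y)))" by simp
  qed
  also have "\<dots> = ennreal (4 / h) * (\<integral>\<^sup>+y. ennreal (bump 2 (a * (y - x))) \<partial>lborel)"
    unfolding bump_reflect[of 2 a x] using h
    by (subst nn_integral_cmult[symmetric]) (auto simp: ennreal_mult[symmetric])
  also have "\<dots> \<le> ennreal (4 / h) * ennreal (2 / a)"
    by (intro mult_left_mono nn_integral_bump_scaled a) auto
  also have "\<dots> = ennreal (8 / (a * h))"
    using a h by (simp add: ennreal_mult[symmetric])
  finally show ?thesis .
qed

text \<open>On a coarse grid the bumps only become larger if they are widened to the mesh size.\<close>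

lemma sum_bump_coarse:
  assumes h: "0 < h" and ah: "1 \<le> a * h"
  shows "(\<Sum>\<^sup>+\<nu>. ennreal (bump 2 (a * (x - h * of_int \<nu>)))) \<le> 8"
proof -
  have "1 / h \<le> a" using h ah by (simp add: field_simps)
  moreover from this have "0 < a" using h by (smt (verit) zero_less_divide_1_iff)
  ultimately have "bump 2 (a * (x - h * of_int \<nu>)) \<le> bump 2 (1 / h * (x - h * of_int \<nu>))" for \<nu> :: int
    using h by (intro bump_antimono) (simp only: abs_mult, intro mult_right_mono, auto)
  then have "(\<Sum>\<^sup>+\<nu>. ennreal (bump 2 (a * (x - h * of_int \<nu>))))
      \<le> (\<Sum>\<^sup>+\<nu>. ennreal (bump 2 (1 / h * (x - h * of_int \<nu>))))"
    by (intro nn_integral_mono ennreal_leI)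
  also have "\<dots> \<le> ennreal (8 / (1 / h * h))"
    using h by (intro sum_bump_fine) auto
  finally show ?thesis using h by simp
qed

text \<open>Synthesis with bumps that are wider than the mesh \<open>2 powr (- N)\<close>. For \<open>t \<le> 1\<close> the
  row sums are \<open>2 powr (N - k)\<close> and the column integrals \<open>2 powr (- k)\<close>.\<close>

lemma bump_sum_norm_low:
  fixes N k :: nat and g :: "int \<Rightarrow> ennreal"
  assumes t: "0 \<le> t" "t \<le> 2" and kN: "k \<le> N"
  shows "recip_norm t lborel (\<lambda>x. \<Sum>\<^sup>+\<mu>. ennreal (bump 4 (2 ^ k * (x - of_int \<mu> / 2 ^ N))) * g \<mu>)
    \<le> ennreal (16 * 2 powr ((real N - real k) * max 1 t - real N * t)) * seq_norm t g"
    (is "recip_norm t lborel (\<lambda>x. \<Sum>\<^sup>+\<mu>. ennreal (?K x \<mu>) * g \<mu>) \<le> _")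
proof -
  have h: "(2::real) ^ k * (1 / 2 ^ N) \<le> 1" using kN by (simp add: power_increasing)
  have K2: "?K x \<mu> \<le> bump 2 (2 ^ k * (x - of_int \<mu> / 2 ^ N))" for x \<mu>
    by (rule bump_exponent_antimono) simp
  have pows: "(2::real) ^ N = 2 powr real N" "(2::real) ^ k = 2 powr real k"
    by (simp_all add: powr_realpow)
  show ?thesis
  proof (cases "t \<le> 1")
    case True
    have "recip_norm t lborel (\<lambda>x. \<Sum>\<^sup>+\<mu>. ennreal (?K x \<mu>) * g \<mu>)
      \<le> ennreal ((8 * 2 powr (real N - real k)) powr (1 - t) * (2 * 2 powr (- real k)) powr t) * seq_norm t g"
    proof (rule schur_test)
      fix x
      have "(\<Sum>\<^sup>+\<mu>. ennreal (?K x \<mu>))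
          \<le> (\<Sum>\<^sup>+\<mu>. ennreal (bump 2 (2 ^ k * (x - 1 / 2 ^ N * of_int \<mu>))))"
        using K2 by (intro nn_integral_mono ennreal_leI) simp
      also have "\<dots> \<le> ennreal (8 / (2 ^ k * (1 / 2 ^ N)))"
        using h by (intro sum_bump_fine) auto
      also have "8 / (2 ^ k * (1 / 2 ^ N)) = 8 * (2::real) powr (real N - real k)"
        by (simp add: pows powr_diff)
      finally show "(\<Sum>\<^sup>+\<mu>. ennreal (?K x \<mu>)) \<le> ennreal (8 * 2 powr (real N - real k))" .
    next
      fix \<mu> :: int
      have "(\<integral>\<^sup>+x. ennreal (?K x \<mu>) \<partial>lborel) \<le> (\<integral>\<^sup>+x. ennreal (bump 2 (2 ^ k * (x - of_int \<mu> / 2 ^ N))) \<partial>lborel)"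
        using K2 by (intro nn_integral_mono ennreal_leI) simp
      also have "\<dots> \<le> ennreal (2 / 2 ^ k)"
        by (rule nn_integral_bump_scaled) simp
      finally show "(\<integral>\<^sup>+x. ennreal (?K x \<mu>) \<partial>lborel) \<le> ennreal (2 * 2 powr (- real k))"
        by (simp add: pows powr_minus divide_inverse)
    qed (use t True in auto)
    also have "(8 * 2 powr (real N - real k)) powr (1 - t) * (2 * 2 powr (- real k)) powr t
        = (8 powr (1 - t) * 2 powr t) * 2 powr ((real N - real k) * max 1 t - real N * t)"
      using True by (simp add: powr_mult powr_powr powr_add[symmetric] max_def algebra_simps)
    also have "\<dots> \<le> 16 * 2 powr ((real N - real k) * max 1 t - real N * t)"
    proof (intro mult_right_mono)
      have "(8::real) powr (1 - t) * 2 powr t \<le> 8 powr 1 * 2 powr 1"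
        using True t by (intro mult_mono powr_mono) auto
      then show "(8::real) powr (1 - t) * 2 powr t \<le> 16" by simp
    qed simp
    finally show ?thesis
      by (meson ennreal_leI mult_right_mono zero_le order_trans order_refl)
  next
    case False
    have "recip_norm t lborel (\<lambda>x. \<Sum>\<^sup>+\<mu>. ennreal (?K x \<mu>) * g \<mu>)
      \<le> ennreal ((2 * 2 powr (- real k)) powr t) * seq_norm t g"
    proof (rule schur_quasi)
      fix \<mu> :: int
      have "(\<integral>\<^sup>+x. ennreal_powr (ennreal (?K x \<mu>)) (1 / t) \<partial>lborel)
          \<le> (\<integral>\<^sup>+x. ennreal (bump 2 (2 ^ k * (x - of_int \<mu> / 2 ^ N))) \<partial>lborel)"
        using t False by (intro nn_integral_mono) (auto simp: ennreal_powr_ennreal field_simps intro!: ennreal_leI bump_powr_le)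
      also have "\<dots> \<le> ennreal (2 / 2 ^ k)"
        by (rule nn_integral_bump_scaled) simp
      finally show "(\<integral>\<^sup>+x. ennreal_powr (ennreal (?K x \<mu>)) (1 / t) \<partial>lborel) \<le> ennreal (2 * 2 powr (- real k))"
        by (simp add: pows powr_minus divide_inverse)
    qed (use t False in auto)
    also have "(2 * 2 powr (- real k)) powr t = 2 powr t * 2 powr ((real N - real k) * max 1 t - real N * t)"
      using False by (simp add: powr_mult powr_powr max_def algebra_simps)
    also have "\<dots> \<le> 16 * 2 powr ((real N - real k) * max 1 t - real N * t)"
    proof (intro mult_right_mono)
      have "(2::real) powr t \<le> 2 powr 2" using t by (intro powr_mono) auto
      then show "(2::real) powr t \<le> 16" by simp
    qed simp
    finally show ?thesis
      by (meson ennreal_leI mult_right_mono zero_le order_trans order_refl)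
  qed
qed

text \<open>The kernel describes the response of a fine block \<open>k \<ge> N\<close> to one cell: narrow bumps from
  the jumps at the end points, and a bump of the width of the cell from its interior. The former
  dominate for \<open>t \<le> 1\<close>, the latter for \<open>t \<ge> 1\<close>; hence the minimum in the exponent.\<close>

lemma bump_sum_norm_high:
  fixes N k :: nat and g :: "int \<Rightarrow> ennreal"
  assumes t: "0 \<le> t" "t \<le> 2" and kN: "N \<le> k"
  shows "recip_norm t lborel (\<lambda>x. \<Sum>\<^sup>+\<mu>. ennreal (bump 4 (2 ^ k * (x - of_int \<mu> / 2 ^ N)) +
        2 powr (real N - real k) * bump 4 (2 ^ N * (x - of_int \<mu> / 2 ^ N))) * g \<mu>)
    \<le> ennreal (64 * 2 powr ((real N - real k) * min 1 t - real N * t)) * seq_norm t g"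
    (is "recip_norm t lborel (\<lambda>x. \<Sum>\<^sup>+\<mu>. ennreal (?K x \<mu>) * g \<mu>) \<le> _")
proof -
  have pows: "(2::real) ^ N = 2 powr real N" "(2::real) ^ k = 2 powr real k"
    by (simp_all add: powr_realpow)
  have le1: "2 powr (real N - real k) \<le> 1"
    using powr_mono[of "real N - real k" 0 2] kN by simp
  define b where "b j x \<mu> = bump 2 (2 ^ j * (x - of_int \<mu> / 2 ^ N))" for j x and \<mu> :: int
  have [measurable]: "(\<lambda>x. b j x \<mu>) \<in> borel_measurable borel" for j \<mu>
    unfolding b_def by measurable
  have b0: "0 \<le> b j x \<mu>" for j x \<mu> by (simp add: b_def)
  have ib: "(\<integral>\<^sup>+x. ennreal (b j x \<mu>) \<partial>lborel) \<le> ennreal (2 * 2 powr (- real j))" for j \<mu>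
    using nn_integral_bump_scaled[of "2 ^ j" "of_int \<mu> / 2 ^ N"]
    by (simp add: b_def powr_minus divide_inverse powr_realpow)
  have sb: "(\<Sum>\<^sup>+\<mu>. ennreal (b j x \<mu>)) \<le> 8" if "N \<le> j" for j x
    using sum_bump_coarse[of "1 / 2 ^ N" "2 ^ j" x] that by (simp add: b_def power_increasing)
  have K2: "?K x \<mu> \<le> b k x \<mu> + 2 powr (real N - real k) * b N x \<mu>" for x \<mu>
    unfolding b_def by (intro add_mono mult_left_mono bump_exponent_antimono) auto
  show ?thesis
  proof (cases "t \<le> 1")
    case True
    have "recip_norm t lborel (\<lambda>x. \<Sum>\<^sup>+\<mu>. ennreal (?K x \<mu>) * g \<mu>)
      \<le> ennreal (16 powr (1 - t) * (4 * 2 powr (- real k)) powr t) * seq_norm t g"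
    proof (rule schur_test)
      fix x
      have "(\<Sum>\<^sup>+\<mu>. ennreal (?K x \<mu>))
          \<le> (\<Sum>\<^sup>+\<mu>. ennreal (b k x \<mu>) + ennreal (b N x \<mu>))"
      proof (intro nn_integral_mono)
        fix \<mu>
        have "?K x \<mu> \<le> b k x \<mu> + 1 * b N x \<mu>"
          using K2[of x \<mu>] mult_right_mono[OF le1 b0[of N x \<mu>]] by linarith
        then show "ennreal (?K x \<mu>) \<le> ennreal (b k x \<mu>) + ennreal (b N x \<mu>)"
          using b0 by (simp add: ennreal_plus[symmetric] ennreal_leI del: ennreal_plus)
      qed
      also have "\<dots> \<le> 8 + 8"
        using kN by (subst nn_integral_add) (auto intro!: add_mono sb simp del: numeral_plus_numeral)
      finally show "(\<Sum>\<^sup>+\<mu>. ennreal (?K x \<mu>)) \<le> ennreal 16" by simp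
    next
      fix \<mu> :: int
      have "(\<integral>\<^sup>+x. ennreal (?K x \<mu>) \<partial>lborel) \<le> (\<integral>\<^sup>+x. ennreal (b k x \<mu>) + ennreal (2 powr (real N - real k)) * ennreal (b N x \<mu>) \<partial>lborel)"
        using K2 b0 by (intro nn_integral_mono) (simp add: ennreal_plus[symmetric] ennreal_mult[symmetric] ennreal_leI del: ennreal_plus)
      also have "\<dots> = (\<integral>\<^sup>+x. ennreal (b k x \<mu>) \<partial>lborel) + ennreal (2 powr (real N - real k)) * (\<integral>\<^sup>+x. ennreal (b N x \<mu>) \<partial>lborel)"
        by (simp add: nn_integral_add nn_integral_cmult)
      also have "\<dots> \<le> ennreal (2 * 2 powr (- real k)) + ennreal (2 powr (real N - real k)) * ennreal (2 * 2 powr (- real N))"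
        by (intro add_mono mult_left_mono ib) auto
      also have "\<dots> = ennreal (2 * 2 powr (- real k) + 2 powr (real N - real k) * (2 * 2 powr (- real N)))"
        by (simp add: ennreal_plus[symmetric] ennreal_mult[symmetric] del: ennreal_plus)
      also have "2 * 2 powr (- real k) + 2 powr (real N - real k) * (2 * 2 powr (- real N)) = 4 * 2 powr (- real k)"
        by (simp add: powr_diff powr_minus field_simps)
      finally show "(\<integral>\<^sup>+x. ennreal (?K x \<mu>) \<partial>lborel) \<le> ennreal (4 * 2 powr (- real k))" .
    qed (use t True in auto)
    also have "16 powr (1 - t) * (4 * 2 powr (- real k)) powr t
        = (16 powr (1 - t) * 4 powr t) * 2 powr ((real N - real k) * min 1 t - real N * t)"
      using True by (simp add: powr_mult powr_powr min_def algebra_simps)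
    also have "\<dots> \<le> 64 * 2 powr ((real N - real k) * min 1 t - real N * t)"
    proof (intro mult_right_mono)
      have "(16::real) powr (1 - t) * 4 powr t \<le> 16 powr 1 * 4 powr 1"
        using True t by (intro mult_mono powr_mono) auto
      then show "(16::real) powr (1 - t) * 4 powr t \<le> 64" by simp
    qed simp
    finally show ?thesis
      by (meson ennreal_leI mult_right_mono zero_le order_trans order_refl)
  next
    case False
    let ?\<beta> = "4 * 2 powr ((real N - real k) / t - real N)"
    have "recip_norm t lborel (\<lambda>x. \<Sum>\<^sup>+\<mu>. ennreal (?K x \<mu>) * g \<mu>)
      \<le> ennreal (?\<beta> powr t) * seq_norm t g"
    proof (rule schur_quasi)
      fix \<mu> :: int
      let ?c = "(2 powr (real N - real k)) powr (1 / t)"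
      have "(\<integral>\<^sup>+x. ennreal_powr (ennreal (?K x \<mu>)) (1 / t) \<partial>lborel)
          \<le> (\<integral>\<^sup>+x. ennreal (b k x \<mu>) + ennreal ?c * ennreal (b N x \<mu>) \<partial>lborel)"
      proof (intro nn_integral_mono)
        fix x
        have "?K x \<mu> powr (1 / t) \<le> bump 4 (2 ^ k * (x - of_int \<mu> / 2 ^ N)) powr (1 / t) +
            (2 powr (real N - real k) * bump 4 (2 ^ N * (x - of_int \<mu> / 2 ^ N))) powr (1 / t)"
          using False by (intro powr_add_le) auto
        also have "\<dots> = bump 4 (2 ^ k * (x - of_int \<mu> / 2 ^ N)) powr (1 / t) +
            ?c * bump 4 (2 ^ N * (x - of_int \<mu> / 2 ^ N)) powr (1 / t)"
          by (simp add: powr_mult)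
        also have "\<dots> \<le> b k x \<mu> + ?c * b N x \<mu>"
          unfolding b_def using t False by (intro add_mono mult_left_mono bump_powr_le) (auto simp: field_simps)
        finally show "ennreal_powr (ennreal (?K x \<mu>)) (1 / t) \<le> ennreal (b k x \<mu>) + ennreal ?c * ennreal (b N x \<mu>)"
          using b0 by (simp add: ennreal_powr_ennreal ennreal_plus[symmetric] ennreal_mult[symmetric] ennreal_leI del: ennreal_plus)
      qed
      also have "\<dots> = (\<integral>\<^sup>+x. ennreal (b k x \<mu>) \<partial>lborel) + ennreal ?c * (\<integral>\<^sup>+x. ennreal (b N x \<mu>) \<partial>lborel)"
        by (simp add: nn_integral_add nn_integral_cmult)
      also have "\<dots> \<le> ennreal (2 * 2 powr (- real k)) + ennreal ?c * ennreal (2 * 2 powr (- real N))"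
        by (intro add_mono mult_left_mono ib) auto
      also have "\<dots> = ennreal (2 * 2 powr (- real k) + ?c * (2 * 2 powr (- real N)))"
        by (simp add: ennreal_plus[symmetric] ennreal_mult[symmetric] del: ennreal_plus)
      also have "\<dots> \<le> ennreal ?\<beta>"
      proof (rule ennreal_leI)
        have "0 \<le> (real k - real N) * (t - 1)"
          using kN False by (intro mult_nonneg_nonneg) auto
        then have "real N - real k \<le> (real N - real k) / t"
          using False by (simp add: field_simps)
        then have "2 powr (- real k) \<le> 2 powr ((real N - real k) / t - real N)"
          by (intro powr_mono) auto
        moreover have "?c * 2 powr (- real N) = 2 powr ((real N - real k) / t - real N)"
          by (simp add: powr_powr powr_add[symmetric])
        ultimately show "2 * 2 powr (- real k) + ?c * (2 * 2 powr (- real N)) \<le> ?\<beta>" by linarith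
      qed
      finally show "(\<integral>\<^sup>+x. ennreal_powr (ennreal (?K x \<mu>)) (1 / t) \<partial>lborel) \<le> ennreal ?\<beta>" .
    qed (use t False in auto)
    also have "?\<beta> powr t = 4 powr t * 2 powr ((real N - real k) * min 1 t - real N * t)"
    proof -
      have "((real N - real k) / t - real N) * t = (real N - real k) * min 1 t - real N * t"
        using False by (simp add: min_def field_simps)
      then show ?thesis by (simp add: powr_mult powr_powr)
    qed
    also have "\<dots> \<le> 64 * 2 powr ((real N - real k) * min 1 t - real N * t)"
    proof (intro mult_right_mono)
      have "(4::real) powr t \<le> 4 powr 2" using t by (intro powr_mono) auto
      then show "(4::real) powr t \<le> 64" by simp
    qed simp
    finally show ?thesis
      by (meson ennreal_leI mult_right_mono zero_le order_trans order_refl)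
  qed
qed

section \<open>The majorant sequence of the coefficients\<close>

lemma card_int_near:
  fixes c y \<rho> :: real
  assumes "0 < c" "0 \<le> \<rho>"
  shows "finite {\<mu>::int. \<bar>c * of_int \<mu> - y\<bar> \<le> \<rho>}"
    and "real (card {\<mu>::int. \<bar>c * of_int \<mu> - y\<bar> \<le> \<rho>}) \<le> 2 * \<rho> / c + 1"
proof -
  let ?S = "{\<mu>::int. \<bar>c * of_int \<mu> - y\<bar> \<le> \<rho>}" and ?a = "(y - \<rho>) / c" and ?b = "(y + \<rho>) / c"
  have sub: "?S \<subseteq> {\<lceil>?a\<rceil>..\<lfloor>?b\<rfloor>}"
    using assms by (auto simp: ceiling_le_iff le_floor_iff field_simps)
  then show "finite ?S" by (rule finite_subset) simp
  have "card ?S \<le> card {\<lceil>?a\<rceil>..\<lfloor>?b\<rfloor>}"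
    using sub by (rule card_mono[rotated]) simp
  then have "real (card ?S) \<le> real (nat (\<lfloor>?b\<rfloor> - \<lceil>?a\<rceil> + 1))"
    by simp
  also have "\<dots> \<le> ?b - ?a + 1"
  proof -
    have "?a \<le> ?b" using assms by (simp add: divide_right_mono)
    then show ?thesis
      by (cases "0 \<le> \<lfloor>?b\<rfloor> - \<lceil>?a\<rceil> + 1") (simp_all, linarith)
  qed
  also have "\<dots> = 2 * \<rho> / c + 1"
    by (simp add: diff_divide_distrib add_divide_distrib)
  finally show "real (card ?S) \<le> 2 * \<rho> / c + 1" .
qed

text \<open>The translates \<open>\<nu>\<close> of level \<open>j\<close> that are seen at one of the grid points
  \<open>\<mu> - 1\<close>, \<open>\<mu>\<close>, \<open>\<mu> + 1\<close> of mesh \<open>2 powr (- N)\<close>. The dilation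
  \<open>2 ^ (j - 1)\<close> is that of the wavelets; truncated subtraction makes it \<open>1\<close> both for the scaling
  functions (\<open>j = 0\<close>) and for the wavelets with \<open>j = 1\<close>. Both neighbours of \<open>\<mu>\<close> are included
  because jumps at a grid point involve the two adjacent cells.\<close>

definition near :: "real \<Rightarrow> nat \<Rightarrow> int \<Rightarrow> nat \<Rightarrow> int \<Rightarrow> bool" where
  "near \<rho> N \<mu> j \<nu> \<longleftrightarrow> (\<exists>i\<in>{-1, 0, 1}. \<bar>2 ^ (j - 1) * (of_int (\<mu> + i) / 2 ^ N) - of_int \<nu>\<bar> \<le> \<rho>)"

lemma near_count:
  fixes A :: "int set"
  assumes "A \<subseteq> S (-1) \<union> S 0 \<union> S 1" "\<And>i::int. finite (S i)" "\<And>i. real (card (S i)) \<le> c"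
  shows "(\<Sum>\<^sup>+\<nu>. indicator A \<nu>) \<le> ennreal (3 * c)"
proof -
  have fin: "finite (S (-1) \<union> S 0 \<union> S 1)" using assms by auto
  then have "finite A" using assms(1) by (rule finite_subset[rotated])
  have "card A \<le> card (S (-1) \<union> S 0 \<union> S 1)"
    using fin assms(1) by (rule card_mono)
  also have "\<dots> \<le> card (S (-1)) + card (S 0) + card (S 1)"
    using card_Un_le[of "S (-1) \<union> S 0" "S 1"] card_Un_le[of "S (-1)" "S 0"] by linarith
  finally have "real (card A) \<le> 3 * c"
    using assms(3)[of "-1"] assms(3)[of 0] assms(3)[of 1] by linarith
  moreover have "(\<Sum>\<^sup>+\<nu>. indicator A \<nu>) = ennreal (real (card A))"
    using \<open>finite A\<close> by (simp add: ennreal_of_nat_eq_real_of_nat)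
  ultimately show ?thesis by (simp add: ennreal_leI)
qed

text \<open>On one row only boundedly many translates count, whatever the two scales are.\<close>

lemma near_row:
  assumes "0 \<le> \<rho>"
  shows "finite {\<nu>. near \<rho> N \<mu> j \<nu>}"
    and "(\<Sum>\<^sup>+\<nu>. indicator {\<nu>. near \<rho> N \<mu> j \<nu>} \<nu>) \<le> ennreal (3 * (2 * \<rho> + 1))"
proof -
  define S where "S i = {\<nu>::int. \<bar>1 * of_int \<nu> - 2 ^ (j - 1) * (of_int (\<mu> + i) / 2 ^ N)\<bar> \<le> \<rho>}" for i
  have sub: "{\<nu>. near \<rho> N \<mu> j \<nu>} \<subseteq> S (-1) \<union> S 0 \<union> S 1"
    by (auto simp: near_def S_def abs_minus_commute)
  have S: "finite (S i)" "real (card (S i)) \<le> 2 * \<rho> + 1" for i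
    unfolding S_def using card_int_near[of 1 \<rho>] assms by auto
  show "finite {\<nu>. near \<rho> N \<mu> j \<nu>}" using sub by (rule finite_subset) (use S in auto)
  show "(\<Sum>\<^sup>+\<nu>. indicator {\<nu>. near \<rho> N \<mu> j \<nu>} \<nu>) \<le> ennreal (3 * (2 * \<rho> + 1))"
    by (rule near_count[OF sub S])
qed

text \<open>A wavelet of level \<open>j \<le> N\<close> is seen by about \<open>2 ^ (N - j)\<close> cells, one of level
  \<open>j > N\<close> by boundedly many: then the truncated difference \<open>N - j\<close> is zero.\<close>

lemma near_column:
  assumes "0 \<le> \<rho>"
  shows "(\<Sum>\<^sup>+\<mu>. indicator {\<mu>. near \<rho> N \<mu> j \<nu>} \<mu>)
    \<le> ennreal (2 * (3 * (2 * \<rho> + 1)) * 2 ^ (N - j))"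
proof -
  define S where "S i = {\<mu>::int. \<bar>2 ^ (j - 1) / 2 ^ N * of_int \<mu> - (of_int \<nu> - 2 ^ (j - 1) / 2 ^ N * of_int i)\<bar> \<le> \<rho>}" for i
  have sub: "{\<mu>. near \<rho> N \<mu> j \<nu>} \<subseteq> S (-1) \<union> S 0 \<union> S 1"
    by (auto simp: near_def S_def algebra_simps add_divide_distrib diff_divide_distrib)
  have pow: "2 ^ N \<le> 2 * 2 ^ (N - j) * (2::real) ^ (j - 1)"
  proof -
    have "N \<le> Suc (N - j + (j - 1))" by simp
    then have "(2::real) ^ N \<le> 2 ^ Suc (N - j + (j - 1))" by (rule power_increasing) simp
    then show ?thesis by (simp add: power_add)
  qed
  have S: "finite (S i)" "real (card (S i)) \<le> (2 * (2 * \<rho> + 1)) * 2 ^ (N - j)" for i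
  proof -
    show "finite (S i)" unfolding S_def using assms by (intro card_int_near) auto
    have "real (card (S i)) \<le> 2 * \<rho> / (2 ^ (j - 1) / 2 ^ N) + 1"
      unfolding S_def using assms by (intro card_int_near) auto
    also have "\<dots> = 2 * \<rho> * (2 ^ N / 2 ^ (j - 1)) + 1" by simp
    also have "\<dots> \<le> 2 * \<rho> * (2 * 2 ^ (N - j)) + 2 * 2 ^ (N - j)"
    proof (intro add_mono mult_left_mono)
      show "2 ^ N / 2 ^ (j - 1) \<le> 2 * (2::real) ^ (N - j)"
        using pow by (simp add: divide_le_eq)
      show "1 \<le> 2 * (2::real) ^ (N - j)"
        using one_le_power[of "2::real" "N - j"] by linarith
    qed (use assms in auto)
    also have "\<dots> = (2 * (2 * \<rho> + 1)) * 2 ^ (N - j)" by (simp add: algebra_simps)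
    finally show "real (card (S i)) \<le> (2 * (2 * \<rho> + 1)) * 2 ^ (N - j)" .
  qed
  show ?thesis
    using near_count[OF sub S] by (simp only: mult.assoc mult.left_commute)
qed

definition geo_bound :: "real \<Rightarrow> real" where
  "geo_bound \<omega> = 2 / (1 - 2 powr - \<omega>)"

lemma geo_bound_pos: "0 < \<omega> \<Longrightarrow> 0 < geo_bound \<omega>"
  by (simp add: geo_bound_def powr_less_one)

lemma geometric_two_sided:
  assumes "0 < \<omega>"
  shows "(\<Sum>j. ennreal (2 powr (- \<omega> * \<bar>real j - real N\<bar>))) \<le> ennreal (geo_bound \<omega>)"
proof -
  define q where "q = 2 powr - \<omega>"
  have q: "0 < q" "q < 1" using assms by (simp_all add: q_def powr_less_one)
  have pq: "2 powr (- \<omega> * real n) = q ^ n" for n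
    by (simp add: q_def powr_powr flip: powr_realpow)
  have S: "(\<Sum>j. ennreal (q ^ j)) = ennreal (1 / (1 - q))"
    using q by (subst suminf_ennreal2) (auto simp: suminf_geometric summable_geometric)
  have head: "(\<Sum>j<N. ennreal (2 powr (- \<omega> * \<bar>real j - real N\<bar>))) \<le> (\<Sum>j. ennreal (q ^ j))"
  proof -
    have "(\<Sum>j<N. ennreal (2 powr (- \<omega> * \<bar>real j - real N\<bar>))) = (\<Sum>j<N. ennreal (q ^ Suc (N - Suc j)))"
    proof (intro sum.cong refl)
      fix j assume "j \<in> {..<N}"
      then have "\<bar>real j - real N\<bar> = real (Suc (N - Suc j))" by auto
      then show "ennreal (2 powr (- \<omega> * \<bar>real j - real N\<bar>)) = ennreal (q ^ Suc (N - Suc j))"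
        using pq by metis
    qed
    also have "\<dots> = (\<Sum>j<N. ennreal (q ^ Suc j))"
      by (rule sum.nat_diff_reindex)
    also have "\<dots> \<le> (\<Sum>j<N. ennreal (q ^ j))"
      using q by (intro sum_mono ennreal_leI) (auto simp: mult_left_le_one_le)
    also have "\<dots> \<le> (\<Sum>j. ennreal (q ^ j))"
      by (rule sum_le_suminf) auto
    finally show ?thesis .
  qed
  have "(\<Sum>j. ennreal (2 powr (- \<omega> * \<bar>real j - real N\<bar>)))
      = (\<Sum>j. ennreal (2 powr (- \<omega> * \<bar>real (j + N) - real N\<bar>))) + (\<Sum>j<N. ennreal (2 powr (- \<omega> * \<bar>real j - real N\<bar>)))"
    by (rule suminf_offset) simp
  also have "(\<Sum>j. ennreal (2 powr (- \<omega> * \<bar>real (j + N) - real N\<bar>))) = (\<Sum>j. ennreal (q ^ j))"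
    using pq by simp
  also have "(\<Sum>j. ennreal (q ^ j)) + (\<Sum>j<N. ennreal (2 powr (- \<omega> * \<bar>real j - real N\<bar>)))
      \<le> (\<Sum>j. ennreal (q ^ j)) + (\<Sum>j. ennreal (q ^ j))"
    by (rule add_left_mono[OF head])
  also have "\<dots> = ennreal (geo_bound \<omega>)"
    unfolding S geo_bound_def q_def[symmetric] using q by (simp add: ennreal_plus[symmetric] del: ennreal_plus)
  finally show ?thesis .
qed

text \<open>The sequence \<open>g\<close> of the introduction, with the sizes \<open>l (j, \<nu>)\<close> of the coefficients.\<close>

definition cell_majorant :: "real \<Rightarrow> nat \<Rightarrow> (nat \<times> int \<Rightarrow> ennreal) \<Rightarrow> int \<Rightarrow> ennreal" where
  "cell_majorant \<rho> N l \<mu> = (\<integral>\<^sup>+(j, \<nu>). ennreal (2 powr (- \<bar>real j - real N\<bar>)) * indicator {\<nu>. near \<rho> N \<mu> j \<nu>} \<nu> * l (j, \<nu>)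
     \<partial>count_space UNIV)"

lemma sum_pairs:
  fixes f :: "nat \<times> int \<Rightarrow> ennreal"
  shows
  "(\<Sum>\<^sup>+i. f i) = (\<Sum>j. \<Sum>\<^sup>+\<nu>. f (j, \<nu>))"
  by (simp add: nn_integral_fst_count_space[symmetric] nn_integral_count_space_nat)

text \<open>Weights \<open>2 powr (\<epsilon> * \<bar>j - N\<bar>)\<close> are moved from the sequence into the kernel, so that a
  bound for each single level of the sequence can be summed over the levels afterwards. With
  \<open>\<tau> = s - t\<close>, the levels \<open>j > N\<close> need \<open>\<epsilon> < 1 + \<tau>\<close>, which leaves room
  for a positive \<open>\<epsilon>\<close> if \<open>s > 1 / p - 1\<close>. The levels \<open>j \<le> N\<close> need \<open>\<epsilon> \<le> - \<tau>\<close> or, for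
  \<open>t \<ge> 1\<close>, \<open>\<epsilon> \<le> 1 - s\<close>, because a coarse wavelet meets \<open>2 ^ (N - j)\<close> cells.\<close>

lemma cell_majorant_kernel_norm:
  fixes a :: "nat \<times> int \<Rightarrow> ennreal"
  assumes \<rho>: "0 \<le> \<rho>" and t: "0 \<le> t" and \<tau>: "\<tau> < 0"
    and \<epsilon>: "0 < \<epsilon>" "\<epsilon> < 1 + \<tau>" "\<epsilon> \<le> - \<tau>" "\<epsilon> \<le> 1 - (\<tau> + t)"
  defines "X \<equiv> 3 * (2 * \<rho> + 1)"
  shows "seq_norm t (\<lambda>\<mu>. \<Sum>\<^sup>+i. (case i of (j, \<nu>) \<Rightarrow>
        ennreal (2 powr ((\<epsilon> - 1) * \<bar>real j - real N\<bar> - real j * \<tau>)) * indicator {\<nu>. near \<rho> N \<mu> j \<nu>} \<nu>) * a i)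
    \<le> ennreal (((if t \<le> 1 then (X * geo_bound (1 + \<tau> - \<epsilon>)) powr (1 - t) else 1) * (2 * X) powr t) * 2 powr (- real N * \<tau>))
        * seq_norm t a"
    (is "recip_norm t _ (\<lambda>\<mu>. \<Sum>\<^sup>+i. ?K \<mu> i * a i) \<le> _")
proof -
  have X: "0 < X" using \<rho> by (simp add: X_def)
  define \<omega> where "\<omega> = 1 + \<tau> - \<epsilon>"
  have \<omega>: "0 < \<omega>" using \<epsilon> by (simp add: \<omega>_def)
  let ?e = "\<lambda>j. (\<epsilon> - 1) * \<bar>real j - real N\<bar> - real j * \<tau>"
  have e_le: "?e j \<le> - real N * \<tau> + (- \<omega> * \<bar>real j - real N\<bar>)" for j
  proof -
    have "(real j - real N) * (- \<tau>) \<le> \<bar>real j - real N\<bar> * (- \<tau>)"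
      using \<tau> by (intro mult_right_mono) auto
    then show ?thesis by (simp add: \<omega>_def algebra_simps)
  qed
  have e_less: "?e j \<le> - real N * \<tau>" if "N < j" for j
    using e_le[of j] \<omega> by (smt (verit) mult_minus_left mult_nonneg_nonneg abs_ge_zero)
  show ?thesis
  proof (cases "t \<le> 1")
    case True
    let ?\<alpha> = "(X * geo_bound \<omega>) * 2 powr (- real N * \<tau>)" and ?\<beta> = "(2 * X) * 2 powr (- real N * \<tau>)"
    have "seq_norm t (\<lambda>\<mu>. \<Sum>\<^sup>+i. ?K \<mu> i * a i)
        \<le> ennreal (?\<alpha> powr (1 - t) * ?\<beta> powr t) * seq_norm t a"
    proof (rule schur_test)
      fix \<mu> :: int
      have "(\<Sum>\<^sup>+i. ?K \<mu> i)
          = (\<Sum>j. ennreal (2 powr ?e j) * (\<Sum>\<^sup>+\<nu>. indicator {\<nu>. near \<rho> N \<mu> j \<nu>} \<nu>))"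
        by (simp add: sum_pairs nn_integral_cmult del: nn_integral_indicator)
      also have "\<dots> \<le> (\<Sum>j. ennreal (X * 2 powr (- real N * \<tau>)) * ennreal (2 powr (- \<omega> * \<bar>real j - real N\<bar>)))"
      proof (intro suminf_le summableI)
        fix j
        have "ennreal (2 powr ?e j) * (\<Sum>\<^sup>+\<nu>. indicator {\<nu>. near \<rho> N \<mu> j \<nu>} \<nu>)
            \<le> ennreal (2 powr (- real N * \<tau> + (- \<omega> * \<bar>real j - real N\<bar>))) * ennreal X"
          unfolding X_def by (intro mult_mono ennreal_leI powr_mono e_le near_row \<rho>) auto
        also have "\<dots> = ennreal (X * 2 powr (- real N * \<tau>)) * ennreal (2 powr (- \<omega> * \<bar>real j - real N\<bar>))"
          using X by (simp only: powr_add) (simp add: ennreal_mult[symmetric] ac_simps)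
        finally show "ennreal (2 powr ?e j) * (\<Sum>\<^sup>+\<nu>. indicator {\<nu>. near \<rho> N \<mu> j \<nu>} \<nu>)
            \<le> ennreal (X * 2 powr (- real N * \<tau>)) * ennreal (2 powr (- \<omega> * \<bar>real j - real N\<bar>))" .
      qed
      also have "\<dots> = ennreal (X * 2 powr (- real N * \<tau>)) * (\<Sum>j. ennreal (2 powr (- \<omega> * \<bar>real j - real N\<bar>)))"
        by (rule ennreal_suminf_cmult)
      also have "\<dots> \<le> ennreal (X * 2 powr (- real N * \<tau>)) * ennreal (geo_bound \<omega>)"
        by (intro mult_left_mono geometric_two_sided \<omega>) auto
      also have "\<dots> = ennreal ?\<alpha>"
        using X geo_bound_pos[OF \<omega>] by (simp add: ennreal_mult[symmetric] ac_simps)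
      finally show "(\<Sum>\<^sup>+i. ?K \<mu> i) \<le> ennreal ?\<alpha>" .
    next
      fix i :: "nat \<times> int"
      obtain j \<nu> where i: "i = (j, \<nu>)" by (cases i)
      have "(\<Sum>\<^sup>+\<mu>. ?K \<mu> i)
          = ennreal (2 powr ?e j) * (\<Sum>\<^sup>+\<mu>. indicator {\<mu>. near \<rho> N \<mu> j \<nu>} \<mu>)"
        by (subst nn_integral_cmult[symmetric]) (auto simp: i indicator_def intro!: nn_integral_cong)
      also have "\<dots> \<le> ennreal (2 powr ?e j) * ennreal (2 * X * 2 ^ (N - j))"
        unfolding X_def by (intro mult_left_mono near_column \<rho>) auto
      also have "\<dots> = ennreal (2 * X * 2 powr (?e j + real (N - j)))"
        using X by (simp add: ennreal_mult[symmetric] powr_add powr_realpow ac_simps)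
      also have "\<dots> \<le> ennreal ?\<beta>"
      proof (intro ennreal_leI mult_left_mono powr_mono)
        show "?e j + real (N - j) \<le> - real N * \<tau>"
        proof (cases "N < j")
          case False
          then have "?e j + real (N - j) = - real N * \<tau> + real (N - j) * (\<epsilon> + \<tau>)"
            by (simp add: of_nat_diff algebra_simps)
          moreover have "real (N - j) * (\<epsilon> + \<tau>) \<le> 0"
            using \<epsilon> by (intro mult_nonneg_nonpos) auto
          ultimately show ?thesis by linarith
        qed (use e_less[of j] in simp)
      qed (use X in auto)
      finally show "(\<Sum>\<^sup>+\<mu>. ?K \<mu> i) \<le> ennreal ?\<beta>" .
    qed (use t True X geo_bound_pos[OF \<omega>] in auto)
    also have "?\<alpha> powr (1 - t) * ?\<beta> powr t
        = (X * geo_bound \<omega>) powr (1 - t) * (2 * X) powr t * 2 powr (- real N * \<tau>)"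
    proof -
      have "(2 powr (- real N * \<tau>)) powr (1 - t) * (2 powr (- real N * \<tau>)) powr t = 2 powr (- real N * \<tau>)"
        by (simp add: powr_powr powr_add[symmetric] algebra_simps)
      then show ?thesis by (simp only: powr_mult ac_simps)
    qed
    finally show ?thesis using True by (simp add: \<omega>_def)
  next
    case False
    let ?\<beta> = "(2 * X) * 2 powr (- real N * \<tau> / t)"
    have "seq_norm t (\<lambda>\<mu>. \<Sum>\<^sup>+i. ?K \<mu> i * a i)
        \<le> ennreal (?\<beta> powr t) * seq_norm t a"
    proof (rule schur_quasi)
      fix i :: "nat \<times> int"
      obtain j \<nu> where i: "i = (j, \<nu>)" by (cases i)
      have "(\<Sum>\<^sup>+\<mu>. ennreal_powr (?K \<mu> i) (1 / t))
          = ennreal (2 powr (?e j / t)) * (\<Sum>\<^sup>+\<mu>. indicator {\<mu>. near \<rho> N \<mu> j \<nu>} \<mu>)"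
        using False
        by (subst nn_integral_cmult[symmetric])
          (auto simp: i indicator_def ennreal_powr_ennreal powr_powr intro!: nn_integral_cong)
      also have "\<dots> \<le> ennreal (2 powr (?e j / t)) * ennreal (2 * X * 2 ^ (N - j))"
        unfolding X_def by (intro mult_left_mono near_column \<rho>) auto
      also have "\<dots> = ennreal (2 * X * 2 powr (?e j / t + real (N - j)))"
        using X by (simp add: ennreal_mult[symmetric] powr_add powr_realpow ac_simps)
      also have "\<dots> \<le> ennreal ?\<beta>"
      proof (intro ennreal_leI mult_left_mono powr_mono)
        have "?e j + real (N - j) * t \<le> - real N * \<tau>"
        proof (cases "N < j")
          case False
          then have "?e j + real (N - j) * t = - real N * \<tau> + real (N - j) * (\<epsilon> - 1 + \<tau> + t)"
            by (simp add: of_nat_diff algebra_simps)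
          moreover have "real (N - j) * (\<epsilon> - 1 + \<tau> + t) \<le> 0"
            using \<epsilon> by (intro mult_nonneg_nonpos) auto
          ultimately show ?thesis by linarith
        qed (use e_less[of j] in simp)
        then have "(?e j + real (N - j) * t) / t \<le> (- real N * \<tau>) / t"
          using False by (intro divide_right_mono) auto
        then show "?e j / t + real (N - j) \<le> - real N * \<tau> / t"
          using False by (simp add: add_divide_distrib)
      qed (use X in auto)
      finally show "(\<Sum>\<^sup>+\<mu>. ennreal_powr (?K \<mu> i) (1 / t)) \<le> ennreal ?\<beta>" .
    qed (use False X in auto)
    also have "?\<beta> powr t = (2 * X) powr t * 2 powr (- real N * \<tau>)"
      using False by (simp add: powr_mult powr_powr)
    finally show ?thesis using False by simp
  qed
qed

text \<open>If every level of coefficients satisfies the bound of the wavelet characterization, then so does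
  \<open>g\<close> at level \<open>N\<close>. It remains to add the levels, with the geometric weights of the
  previous lemma.\<close>

lemma cell_majorant_norm:
  assumes \<rho>: "0 \<le> \<rho>" and t: "0 \<le> t" and s: "t - 1 < s" "s < t" "s < 1"
  shows "\<exists>C>0. \<forall>N l A. 0 \<le> A \<longrightarrow>
    (\<forall>j. seq_norm t (\<lambda>\<nu>. l (j, \<nu>)) \<le> ennreal (A * 2 powr (- real j * (s - t)))) \<longrightarrow>
    seq_norm t (cell_majorant \<rho> N l) \<le> ennreal (C * A * 2 powr (- real N * (s - t)))"
proof -
  define \<tau> where "\<tau> = s - t"
  \<comment> \<open>Half of the room that the conditions on \<open>s\<close> leave; the other half keeps the kernel summable.\<close>
  define \<epsilon> where "\<epsilon> = min (min (1 + \<tau>) (- \<tau>)) (1 - s) / 2"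
  have \<tau>: "\<tau> < 0" "s = \<tau> + t" using s by (simp_all add: \<tau>_def)
  have \<epsilon>: "0 < \<epsilon>" "\<epsilon> < 1 + \<tau>" "\<epsilon> \<le> - \<tau>" "\<epsilon> \<le> 1 - (\<tau> + t)"
    using s by (auto simp: \<epsilon>_def \<tau>_def min_def)
  define X where "X = 3 * (2 * \<rho> + 1)"
  define C1 where "C1 = (if t \<le> 1 then (X * geo_bound (1 + \<tau> - \<epsilon>)) powr (1 - t) else 1) * (2 * X) powr t"
  define C2 where "C2 = (if t = 0 then 1 else geo_bound (\<epsilon> / t) powr t)"
  have X: "0 < X" using \<rho> by (simp add: X_def)
  have C1: "0 < C1"
    using X geo_bound_pos[of "1 + \<tau> - \<epsilon>"] \<epsilon> by (auto simp: C1_def intro!: mult_pos_pos)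
  have C2: "0 < C2" using \<epsilon> t geo_bound_pos[of "\<epsilon> / t"] by (auto simp: C2_def)
  show ?thesis
  proof (intro exI[of _ "C1 * C2"] conjI allI impI)
    show "0 < C1 * C2" using C1 C2 by simp
    fix N :: nat and l :: "nat \<times> int \<Rightarrow> ennreal" and A :: real
    assume A: "0 \<le> A" and l: "\<forall>j. seq_norm t (\<lambda>\<nu>. l (j, \<nu>)) \<le> ennreal (A * 2 powr (- real j * (s - t)))"
    define a where "a = (\<lambda>(j, \<nu>). ennreal (2 powr (real j * \<tau> - \<epsilon> * \<bar>real j - real N\<bar>)) * l (j, \<nu>))"
    have a_norm: "seq_norm t a \<le> ennreal (C2 * A)"
    proof (cases "t = 0")
      case True
      have "a i \<le> ennreal A" for i
      proof -
        obtain j \<nu> where i: "i = (j, \<nu>)" by (cases i)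
        have "l (j, \<nu>) \<le> ennreal (A * 2 powr (- real j * \<tau>))"
          using l True by (auto simp: recip_norm_def \<tau>_def SUP_le_iff)
        then have "a i \<le> ennreal (2 powr (real j * \<tau> - \<epsilon> * \<bar>real j - real N\<bar>)) * ennreal (A * 2 powr (- real j * \<tau>))"
          by (simp add: a_def i mult_left_mono)
        also have "\<dots> = ennreal (A * 2 powr (- (\<epsilon> * \<bar>real j - real N\<bar>)))"
          using A by (simp add: ennreal_mult[symmetric] powr_diff powr_minus field_simps)
        also have "\<dots> \<le> ennreal (A * 2 powr 0)"
          using A \<epsilon> by (intro ennreal_leI mult_left_mono powr_mono) auto
        finally show ?thesis by simp
      qed
      then show ?thesis using True by (simp add: recip_norm_def C2_def SUP_le_iff)
    next
      case False
      then have t0: "0 < t" using t by simp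
      have lp: "(\<Sum>\<^sup>+\<nu>. ennreal_powr (l (j, \<nu>)) (1 / t)) \<le> ennreal ((A * 2 powr (- real j * \<tau>)) powr (1 / t))" for j
      proof -
        have "ennreal_powr (ennreal_powr (\<Sum>\<^sup>+\<nu>. ennreal_powr (l (j, \<nu>)) (1 / t)) t) (1 / t)
            \<le> ennreal_powr (ennreal (A * 2 powr (- real j * \<tau>))) (1 / t)"
          using l t0 by (intro ennreal_powr_mono) (auto simp: recip_norm_def \<tau>_def)
        then show ?thesis
          using ennreal_powr_inverse[of "1 / t"] t0 A by (simp add: ennreal_powr_ennreal)
      qed
      have "(\<Sum>\<^sup>+i. ennreal_powr (a i) (1 / t))
          = (\<Sum>j. ennreal ((2 powr (real j * \<tau> - \<epsilon> * \<bar>real j - real N\<bar>)) powr (1 / t)) * (\<Sum>\<^sup>+\<nu>. ennreal_powr (l (j, \<nu>)) (1 / t)))"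
        using t0 by (simp add: sum_pairs a_def ennreal_powr_mult ennreal_powr_ennreal nn_integral_cmult)
      also have "\<dots> \<le> (\<Sum>j. ennreal (A powr (1 / t)) * ennreal (2 powr (- (\<epsilon> / t) * \<bar>real j - real N\<bar>)))"
      proof (intro suminf_le summableI)
        fix j
        have "ennreal ((2 powr (real j * \<tau> - \<epsilon> * \<bar>real j - real N\<bar>)) powr (1 / t)) * (\<Sum>\<^sup>+\<nu>. ennreal_powr (l (j, \<nu>)) (1 / t))
            \<le> ennreal ((2 powr (real j * \<tau> - \<epsilon> * \<bar>real j - real N\<bar>)) powr (1 / t)) * ennreal ((A * 2 powr (- real j * \<tau>)) powr (1 / t))"
          by (intro mult_left_mono lp) auto
        also have "\<dots> = ennreal (A powr (1 / t)) * ennreal (2 powr (- (\<epsilon> / t) * \<bar>real j - real N\<bar>))"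
          using A by (simp add: ennreal_mult[symmetric] powr_mult powr_powr powr_add[symmetric] diff_divide_distrib mult.left_commute)
        finally show "ennreal ((2 powr (real j * \<tau> - \<epsilon> * \<bar>real j - real N\<bar>)) powr (1 / t)) * (\<Sum>\<^sup>+\<nu>. ennreal_powr (l (j, \<nu>)) (1 / t))
            \<le> ennreal (A powr (1 / t)) * ennreal (2 powr (- (\<epsilon> / t) * \<bar>real j - real N\<bar>))" .
      qed
      also have "\<dots> = ennreal (A powr (1 / t)) * (\<Sum>j. ennreal (2 powr (- (\<epsilon> / t) * \<bar>real j - real N\<bar>)))"
        by (rule ennreal_suminf_cmult)
      also have "\<dots> \<le> ennreal (A powr (1 / t)) * ennreal (geo_bound (\<epsilon> / t))"
        using \<epsilon> t0 by (intro mult_left_mono geometric_two_sided) auto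
      also have "\<dots> = ennreal (A powr (1 / t) * geo_bound (\<epsilon> / t))"
        using geo_bound_pos[of "\<epsilon> / t"] \<epsilon> t0 by (simp add: ennreal_mult)
      finally have "seq_norm t a \<le> ennreal_powr (ennreal (A powr (1 / t) * geo_bound (\<epsilon> / t))) t"
        using t0 by (auto simp: recip_norm_def intro: ennreal_powr_mono)
      also have "\<dots> = ennreal (C2 * A)"
        using t0 A geo_bound_pos[of "\<epsilon> / t"] \<epsilon> by (simp add: ennreal_powr_ennreal powr_mult powr_powr C2_def mult.commute)
      finally show ?thesis .
    qed
    let ?K = "\<lambda>\<mu> (j, \<nu>). ennreal (2 powr ((\<epsilon> - 1) * \<bar>real j - real N\<bar> - real j * \<tau>)) * indicator {\<nu>. near \<rho> N \<mu> j \<nu>} \<nu>"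
    have "cell_majorant \<rho> N l = (\<lambda>\<mu>. \<Sum>\<^sup>+i. ?K \<mu> i * a i)"
    proof
      fix \<mu>
      show "cell_majorant \<rho> N l \<mu> = (\<Sum>\<^sup>+i. ?K \<mu> i * a i)"
        unfolding cell_majorant_def
      proof (intro nn_integral_cong)
        fix i :: "nat \<times> int"
        obtain j \<nu> where i: "i = (j, \<nu>)" by (cases i)
        have "ennreal (2 powr (- \<bar>real j - real N\<bar>))
            = ennreal (2 powr ((\<epsilon> - 1) * \<bar>real j - real N\<bar> - real j * \<tau>)) * ennreal (2 powr (real j * \<tau> - \<epsilon> * \<bar>real j - real N\<bar>))"
          by (simp add: ennreal_mult[symmetric] powr_add[symmetric] algebra_simps)
        then show "(case i of (j, \<nu>) \<Rightarrow> ennreal (2 powr (- \<bar>real j - real N\<bar>)) * indicator {\<nu>. near \<rho> N \<mu> j \<nu>} \<nu> * l (j, \<nu>))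
            = ?K \<mu> i * a i"
          unfolding i a_def prod.case by (simp only: ac_simps)
      qed
    qed
    then have "seq_norm t (cell_majorant \<rho> N l)
        \<le> ennreal (C1 * 2 powr (- real N * \<tau>)) * seq_norm t a"
      using cell_majorant_kernel_norm[OF \<rho> t \<tau>(1) \<epsilon>, of N a] by (simp only: C1_def X_def)
    also have "\<dots> \<le> ennreal (C1 * 2 powr (- real N * \<tau>)) * ennreal (C2 * A)"
      by (intro mult_left_mono a_norm) auto
    also have "\<dots> = ennreal (C1 * C2 * A * 2 powr (- real N * \<tau>))"
      using C1 C2 A by (simp add: ennreal_mult[symmetric] ac_simps)
    finally show "seq_norm t (cell_majorant \<rho> N l) \<le> ennreal (C1 * C2 * A * 2 powr (- real N * (s - t)))"
      by (simp add: \<tau>_def)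
  qed
qed

section \<open>The smooth resolution kernel\<close>

lemma norm_increment_le:
  fixes P :: "real \<Rightarrow> complex"
  assumes "\<And>y. y \<in> closed_segment a b \<Longrightarrow> (P has_vector_derivative p y) (at y)"
    and "\<And>y. y \<in> closed_segment a b \<Longrightarrow> norm (p y) \<le> B"
  shows "norm (P b - P a) \<le> B * \<bar>b - a\<bar>"
proof -
  have "norm (P b - P a) \<le> B * norm (b - a)"
  proof (rule differentiable_bound[where f' = "\<lambda>y h. h *\<^sub>R p y"])
    fix y assume "y \<in> closed_segment a b"
    then show "(P has_derivative (\<lambda>h. h *\<^sub>R p y)) (at y within closed_segment a b)"
      using assms(1) by (auto simp: has_vector_derivative_def intro: has_derivative_at_withinI)
    show "onorm (\<lambda>h. h *\<^sub>R p y) \<le> B"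
      using assms(2)[OF \<open>y \<in> _\<close>] by (intro onorm_le) (simp add: mult.commute[of B] mult_left_mono)
  qed auto
  then show ?thesis by simp
qed

lemma continuous_antiderivative:
  fixes f :: "real \<Rightarrow> complex"
  assumes "continuous_on UNIV f"
  obtains P where "\<And>x. (P has_vector_derivative f x) (at x)"
proof
  fix x :: real
  have "((\<lambda>u. LBINT y=ereal 0..ereal u. f y) has_vector_derivative f x) (at x within {- \<bar>x\<bar> - 1..\<bar>x\<bar> + 1})"
    by (rule interval_integral_FTC2) (auto intro: continuous_on_subset[OF assms])
  moreover have "at x within {- \<bar>x\<bar> - 1..\<bar>x\<bar> + 1} = at x"
    by (rule at_within_interior) (auto simp: interior_atLeastAtMost_real)
  ultimately show "((\<lambda>u. LBINT y=ereal 0..ereal u. f y) has_vector_derivative f x) (at x)" by simp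
qed

text \<open>A smooth function together with all its derivatives, supported in a fixed interval. Carrying the
  derivatives along makes products with the variable explicit.\<close>

definition derivative_tower :: "(nat \<Rightarrow> real \<Rightarrow> complex) \<Rightarrow> bool" where
  "derivative_tower G \<longleftrightarrow> (\<forall>n x. (G n has_vector_derivative G (Suc n) x) (at x)) \<and>
     (\<forall>n x. 2 \<le> \<bar>x\<bar> \<longrightarrow> G n x = 0)"

lemma generator_tower:
  assumes "resolution_generator \<phi>0"
  shows "derivative_tower (\<lambda>n. iter_deriv n \<phi>0)"
  unfolding derivative_tower_def
proof (intro conjI allI impI)
  have sm: "C_k k \<phi>0" for k
    using assms by (simp add: resolution_generator_def schwartz_def)
  show d: "(iter_deriv n \<phi>0 has_vector_derivative iter_deriv (Suc n) \<phi>0 x) (at x)" for n x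
    using sm[of "Suc n"] by (auto simp: C_k_def vector_derivative_works)
  have "\<forall>x. 3 / 2 < \<bar>x\<bar> \<longrightarrow> iter_deriv n \<phi>0 x = 0" for n
  proof (induction n)
    case 0
    then show ?case using assms by (auto simp: resolution_generator_def)
  next
    case (Suc n)
    show ?case
    proof (intro allI impI)
      fix x :: real assume x: "3 / 2 < \<bar>x\<bar>"
      have "open {x::real. 3 / 2 < \<bar>x\<bar>}"
        by (intro open_Collect_less continuous_intros)
      then have "(iter_deriv n \<phi>0 has_vector_derivative 0) (at x)"
        using Suc x by (intro has_vector_derivative_transform_within_open[OF has_vector_derivative_const[of 0], where S = "{x. 3 / 2 < \<bar>x\<bar>}"]) auto
      then show "iter_deriv (Suc n) \<phi>0 x = 0"
        using d vector_derivative_unique_at by blast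
    qed
  qed
  then show "2 \<le> \<bar>x\<bar> \<Longrightarrow> iter_deriv n \<phi>0 x = 0" for n x by auto
qed

lemma tower_times_id:
  assumes "derivative_tower G"
  shows "derivative_tower (\<lambda>n x. of_real x * G n x + of_nat n * G (n - 1) x)"
  unfolding derivative_tower_def
proof (intro conjI allI impI)
  fix n x
  have d: "(G m has_vector_derivative G (Suc m) x) (at x)" for m
    using assms by (simp add: derivative_tower_def)
  show "((\<lambda>x. of_real x * G n x + of_nat n * G (n - 1) x) has_vector_derivative
      of_real x * G (Suc n) x + of_nat (Suc n) * G (Suc n - 1) x) (at x)"
  proof (cases n)
    case 0
    show ?thesis unfolding 0
      by (auto intro!: derivative_eq_intros d)
  next
    case (Suc m)
    show ?thesis unfolding Suc
      by (auto intro!: derivative_eq_intros d simp: algebra_simps)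
  qed
qed (use assms in \<open>auto simp: derivative_tower_def\<close>)

lemma tower_continuous: "derivative_tower G \<Longrightarrow> continuous_on S (G n)"
  unfolding derivative_tower_def
  by (auto intro!: continuous_at_imp_continuous_on has_vector_derivative_continuous)

lemma tower_fourier_eq:
  assumes "derivative_tower G"
  shows "(LINT \<xi>|lborel. G n \<xi> * cis (x * \<xi>)) = (LBINT \<xi>:{-2..2}. G n \<xi> * cis (x * \<xi>))"
  unfolding set_lebesgue_integral_def
  using assms by (intro Bochner_Integration.integral_cong) (auto simp: indicator_def derivative_tower_def)

lemma tower_fourier_bound:
  assumes "derivative_tower G"
  obtains M where "\<And>x. norm (LINT \<xi>|lborel. G n \<xi> * cis (x * \<xi>)) \<le> M"
proof
  fix x
  have "norm (LINT \<xi>|lborel. G n \<xi> * cis (x * \<xi>)) \<le> (LBINT \<xi>:{-2..2}. norm (G n \<xi>))"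
    unfolding tower_fourier_eq[OF assms]
    by (rule order_trans[OF set_integral_norm_bound])
      (auto simp: norm_mult intro!: borel_integrable_atLeastAtMost' continuous_intros tower_continuous[OF assms])
  then show "norm (LINT \<xi>|lborel. G n \<xi> * cis (x * \<xi>)) \<le> (LBINT \<xi>:{-2..2}. norm (G n \<xi>))" .
qed

text \<open>Integration by parts: differentiation becomes multiplication by the frequency variable.\<close>

lemma tower_fourier_step:
  assumes G: "derivative_tower G"
  shows "(LINT \<xi>|lborel. G (Suc n) \<xi> * cis (x * \<xi>)) = - (\<i> * of_real x * (LINT \<xi>|lborel. G n \<xi> * cis (x * \<xi>)))"
proof -
  have d: "(G m has_vector_derivative G (Suc m) y) (at y)" for m y
    using G by (simp add: derivative_tower_def)
  have i: "set_integrable lborel {-2..2} (\<lambda>\<xi>. G m \<xi> * cis (x * \<xi>))" for m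
    by (intro borel_integrable_atLeastAtMost' continuous_intros tower_continuous[OF G])
  have "(LBINT \<xi>:{-2..2}. G (Suc n) \<xi> * cis (x * \<xi>) + \<i> * of_real x * (G n \<xi> * cis (x * \<xi>)))
      = G n 2 * cis (x * 2) - G n (-2) * cis (x * (-2))"
    unfolding set_lebesgue_integral_def
  proof (rule integral_FTC_atLeastAtMost)
    fix \<xi> :: real
    have "((\<lambda>\<xi>. G n \<xi> * cis (x * \<xi>)) has_vector_derivative (G n \<xi> * (x *\<^sub>R (\<i> * cis (x * \<xi>))) + G (Suc n) \<xi> * cis (x * \<xi>))) (at \<xi>)"
      by (intro has_vector_derivative_mult d) (auto simp: has_vector_derivative_def intro!: derivative_eq_intros)
    then show "((\<lambda>\<xi>. G n \<xi> * cis (x * \<xi>)) has_vector_derivative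
        G (Suc n) \<xi> * cis (x * \<xi>) + \<i> * of_real x * (G n \<xi> * cis (x * \<xi>))) (at \<xi> within {-2..2})"
      by (auto simp: scaleR_conv_of_real ac_simps intro: has_vector_derivative_at_within)
  qed (auto intro!: continuous_intros tower_continuous[OF G])
  also have "\<dots> = 0" using G by (simp add: derivative_tower_def)
  finally show ?thesis
    unfolding tower_fourier_eq[OF G] using i
    by (subst (asm) set_integral_add) (auto simp: add_eq_0_iff2)
qed

text \<open>Integrating by parts \<open>n\<close> times shows that \<open>\<bar>x\<bar> ^ n\<close> times the transform is bounded.\<close>

lemma tower_fourier_decay:
  assumes G: "derivative_tower G"
  obtains C where "0 < C" "\<And>x. norm (LINT \<xi>|lborel. G 0 \<xi> * cis (x * \<xi>)) \<le> C * bump n x"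
proof -
  let ?J = "\<lambda>m x. norm (LINT \<xi>|lborel. G m \<xi> * cis (x * \<xi>))"
  have J: "?J m x = \<bar>x\<bar> ^ m * ?J 0 x" for m x
    by (induction m) (simp_all add: tower_fourier_step[OF G] norm_mult)
  obtain M0 where M0: "\<And>x. ?J 0 x \<le> M0" using tower_fourier_bound[OF G, where n = 0] by blast
  obtain M where M: "\<And>x. ?J n x \<le> M" using tower_fourier_bound[OF G, where n = n] by blast
  have nn: "0 \<le> M0" "0 \<le> M"
    using order_trans[OF norm_ge_zero M0] order_trans[OF norm_ge_zero M] by auto
  show thesis
  proof
    show "0 < 2 ^ n * (M0 + M) + 1" using nn by (intro add_nonneg_pos) auto
    fix x :: real
    have "(1 + \<bar>x\<bar>) ^ n \<le> (2 * max 1 \<bar>x\<bar>) ^ n" by (intro power_mono) auto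
    also have "\<dots> \<le> 2 ^ n * (1 + \<bar>x\<bar> ^ n)"
      by (auto simp: power_mult_distrib max_def)
    finally have "(1 + \<bar>x\<bar>) ^ n * ?J 0 x \<le> 2 ^ n * (1 + \<bar>x\<bar> ^ n) * ?J 0 x"
      by (intro mult_right_mono) auto
    also have "\<dots> = 2 ^ n * (?J 0 x + ?J n x)"
      using J[of n x] by (simp add: algebra_simps)
    also have "\<dots> \<le> 2 ^ n * (M0 + M)"
      by (intro mult_left_mono add_mono M0 M) auto
    finally have *: "(1 + \<bar>x\<bar>) ^ n * ?J 0 x \<le> 2 ^ n * (M0 + M) + 1" by simp
    have "0 < (1 + \<bar>x\<bar>) ^ n" by (intro zero_less_power) auto
    with * show "?J 0 x \<le> (2 ^ n * (M0 + M) + 1) * bump n x"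
      by (simp add: bump_def pos_le_divide_eq mult.commute)
  qed
qed

lemma tower_fourier_deriv:
  assumes G: "derivative_tower G"
  shows "((\<lambda>x. LINT \<xi>|lborel. G 0 \<xi> * cis (x * \<xi>)) has_vector_derivative
    \<i> * (LINT \<xi>|lborel. (of_real \<xi> * G 0 \<xi>) * cis (x * \<xi>))) (at x)"
proof -
  let ?xG = "\<lambda>n x. of_real x * G n x + of_nat n * G (n - 1) x"
  have xG: "derivative_tower ?xG" by (rule tower_times_id[OF G])
  have "((\<lambda>x. integral (cbox (-2) 2) (\<lambda>\<xi>. G 0 \<xi> * cis (x * \<xi>))) has_vector_derivative
      integral (cbox (-2) 2) (\<lambda>\<xi>. \<i> * ((of_real \<xi> * G 0 \<xi>) * cis (x * \<xi>)))) (at x within UNIV)"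
  proof (rule leibniz_rule_vector_derivative)
    fix x \<xi> :: real
    show "((\<lambda>x. G 0 \<xi> * cis (x * \<xi>)) has_vector_derivative \<i> * ((of_real \<xi> * G 0 \<xi>) * cis (x * \<xi>))) (at x within UNIV)"
      by (auto simp: has_vector_derivative_def scaleR_conv_of_real intro!: derivative_eq_intros)
    show "(\<lambda>\<xi>. G 0 \<xi> * cis (x * \<xi>)) integrable_on cbox (-2) 2"
      by (intro integrable_continuous continuous_intros tower_continuous[OF G])
  next
    have "continuous_on UNIV (\<lambda>p. G 0 (snd p))"
      by (rule continuous_on_compose2[OF tower_continuous[OF G, of UNIV]]) (auto intro: continuous_intros)
    then have "continuous_on (UNIV \<times> cbox (-2) 2) (\<lambda>p::real \<times> real. G 0 (snd p))"
      by (rule continuous_on_subset) auto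
    then show "continuous_on (UNIV \<times> cbox (-2) 2) (\<lambda>(x, \<xi>). \<i> * ((of_real \<xi> * G 0 \<xi>) * cis (x * \<xi>)))"
      unfolding case_prod_beta by (intro continuous_intros) auto
  qed auto
  moreover have "integral (cbox (-2) 2) (\<lambda>\<xi>. H 0 \<xi> * cis (x * \<xi>)) = (LINT \<xi>|lborel. H 0 \<xi> * cis (x * \<xi>))"
    if "derivative_tower H" for H x
    unfolding tower_fourier_eq[OF that]
    by (subst set_borel_integral_eq_integral(2))
      (auto intro!: borel_integrable_atLeastAtMost' continuous_intros tower_continuous[OF that])
  from this[OF G] this[OF xG]
  have "integral (cbox (-2) 2) (\<lambda>\<xi>. G 0 \<xi> * cis (x * \<xi>)) = (LINT \<xi>|lborel. G 0 \<xi> * cis (x * \<xi>))"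
    "integral (cbox (-2) 2) (\<lambda>\<xi>. (of_real \<xi> * G 0 \<xi>) * cis (x * \<xi>)) = (LINT \<xi>|lborel. (of_real \<xi> * G 0 \<xi>) * cis (x * \<xi>))" for x
    by simp_all
  ultimately show ?thesis by simp
qed

text \<open>Decay of order seven: one order is lost when the kernel is integrated to \<open>\<Theta>\<close>, and of the
  remaining six, four are kept in the bump of the cell and two are spent on an integral over the cell.\<close>

lemma generator_kernel:
  assumes "resolution_generator \<phi>0"
  obtains \<Phi>' C where "0 < C" "continuous_on UNIV \<Phi>'"
    "\<And>x. (inv_fourier \<phi>0 has_vector_derivative \<Phi>' x) (at x)"
    "\<And>x. norm (inv_fourier \<phi>0 x) \<le> C * bump 7 x" "\<And>x. norm (\<Phi>' x) \<le> C * bump 7 x"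
proof -
  define G where "G n = iter_deriv n \<phi>0" for n
  define xG where "xG n x = of_real x * G n x + of_nat n * G (n - 1) x" for n x
  have G: "derivative_tower G" unfolding G_def by (rule generator_tower[OF assms])
  have xG: "derivative_tower xG"
    using tower_times_id[OF G] unfolding xG_def[abs_def] .
  let ?J = "\<lambda>G x. LINT \<xi>|lborel. G 0 \<xi> * cis (x * \<xi>)"
  obtain C1 where C1: "0 < C1" "\<And>x. norm (?J G x) \<le> C1 * bump 7 x"
    using tower_fourier_decay[OF G, where n = 7] by blast
  obtain C2 where C2: "0 < C2" "\<And>x. norm (?J xG x) \<le> C2 * bump 7 x"
    using tower_fourier_decay[OF xG, where n = 7] by blast
  have J: "inv_fourier \<phi>0 x = ?J G x / of_real (2 * pi)" for x
    by (simp add: inv_fourier_def G_def)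
  have scale: "norm (z / of_real (2 * pi)) \<le> (C1 + C2) * b" if "norm z \<le> C * b" "0 < C" "C \<le> C1 + C2" "0 < b" for z :: complex and C b
  proof -
    have "norm z * 1 \<le> norm z * (2 * pi)"
      using pi_gt3 by (intro mult_left_mono) auto
    then have "norm (z / of_real (2 * pi)) \<le> norm z"
      using pi_gt3 by (simp add: norm_divide norm_mult divide_le_eq)
    also have "\<dots> \<le> (C1 + C2) * b"
      using that by (smt (verit) mult_right_mono)
    finally show ?thesis .
  qed
  show thesis
  proof
    show "0 < C1 + C2" using C1 C2 by simp
    show "continuous_on UNIV (\<lambda>x. \<i> * ?J xG x / of_real (2 * pi))"
      by (intro continuous_intros continuous_at_imp_continuous_on ballI
          has_vector_derivative_continuous[OF tower_fourier_deriv[OF xG]]) auto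
    fix x
    have "(?J G has_vector_derivative \<i> * ?J xG x) (at x)"
      using tower_fourier_deriv[OF G, of x] by (simp add: xG_def)
    then have "((\<lambda>x. ?J G x / of_real (2 * pi)) has_vector_derivative \<i> * ?J xG x / of_real (2 * pi)) (at x)"
      by (rule has_vector_derivative_divide)
    then show "(inv_fourier \<phi>0 has_vector_derivative \<i> * ?J xG x / of_real (2 * pi)) (at x)"
      unfolding J[abs_def] .
    show "norm (inv_fourier \<phi>0 x) \<le> (C1 + C2) * bump 7 x"
      unfolding J by (rule scale[OF C1(2) C1(1)]) (use C2 in auto)
    show "norm (\<i> * ?J xG x / of_real (2 * pi)) \<le> (C1 + C2) * bump 7 x"
      by (rule scale[OF _ C2(1)]) (use C1 C2 in \<open>auto simp: norm_mult\<close>)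
  qed
qed

lemma inv_fourier_resolution:
  assumes "resolution_generator \<phi>0"
  shows "inv_fourier (resolution \<phi>0 (Suc k)) x
    = of_real (2 ^ Suc k) * inv_fourier \<phi>0 (2 ^ Suc k * x) - of_real (2 ^ k) * inv_fourier \<phi>0 (2 ^ k * x)"
proof -
  define G where "G n = iter_deriv n \<phi>0" for n
  have G: "derivative_tower G" unfolding G_def by (rule generator_tower[OF assms])
  have int0: "integrable lborel (\<lambda>\<xi>. \<phi>0 \<xi> * cis (y * \<xi>))" for y
  proof -
    have "integrable lborel (\<lambda>\<xi>. indicator {-2..2} \<xi> *\<^sub>R (G 0 \<xi> * cis (y * \<xi>)))"
      by (intro borel_integrable_compact continuous_intros tower_continuous[OF G]) auto
    also have "(\<lambda>\<xi>. indicator {-2..2} \<xi> *\<^sub>R (G 0 \<xi> * cis (y * \<xi>))) = (\<lambda>\<xi>. \<phi>0 \<xi> * cis (y * \<xi>))"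
    proof
      fix \<xi>
      have "\<phi>0 \<xi> = 0" if "2 \<le> \<bar>\<xi>\<bar>"
        using G that unfolding derivative_tower_def by (metis G_def funpow_0)
      then show "indicator {-2..2} \<xi> *\<^sub>R (G 0 \<xi> * cis (y * \<xi>)) = \<phi>0 \<xi> * cis (y * \<xi>)"
        by (auto simp: indicator_def G_def)
    qed
    finally show ?thesis .
  qed
  have dil: "integrable lborel (\<lambda>\<xi>. \<phi>0 (\<xi> / a) * cis (x * \<xi>))"
    "(LINT \<xi>|lborel. \<phi>0 (\<xi> / a) * cis (x * \<xi>)) = of_real a * (LINT \<xi>|lborel. \<phi>0 \<xi> * cis (a * x * \<xi>))"
    if "0 < a" for a
  proof -
    have *: "(\<lambda>\<xi>. \<phi>0 ((0 + a * \<xi>) / a) * cis (x * (0 + a * \<xi>))) = (\<lambda>\<xi>. \<phi>0 \<xi> * cis (a * x * \<xi>))"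
      using that by (auto simp: fun_eq_iff ac_simps)
    show "integrable lborel (\<lambda>\<xi>. \<phi>0 (\<xi> / a) * cis (x * \<xi>))"
      using lborel_integrable_real_affine_iff[of a "\<lambda>\<xi>. \<phi>0 (\<xi> / a) * cis (x * \<xi>)" 0] that int0[of "a * x"]
      unfolding * by simp
    show "(LINT \<xi>|lborel. \<phi>0 (\<xi> / a) * cis (x * \<xi>)) = of_real a * (LINT \<xi>|lborel. \<phi>0 \<xi> * cis (a * x * \<xi>))"
      using lborel_integral_real_affine[of a "\<lambda>\<xi>. \<phi>0 (\<xi> / a) * cis (x * \<xi>)" 0] that
      unfolding * by (simp add: scaleR_conv_of_real)
  qed
  have "(LINT \<xi>|lborel. resolution \<phi>0 (Suc k) \<xi> * cis (x * \<xi>))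
      = (LINT \<xi>|lborel. \<phi>0 (\<xi> / 2 ^ Suc k) * cis (x * \<xi>)) - (LINT \<xi>|lborel. \<phi>0 (\<xi> / 2 ^ k) * cis (x * \<xi>))"
    unfolding resolution_def
    using Bochner_Integration.integral_diff[OF dil(1)[of "2 ^ Suc k"] dil(1)[of "2 ^ k"]]
    by (simp add: left_diff_distrib)
  then show ?thesis
    by (simp add: inv_fourier_def dil(2)[of "2 ^ Suc k"] dil(2)[of "2 ^ k"] diff_divide_distrib del: power_Suc)
qed

section \<open>Littlewood-Paley kernels and their primitives\<close>

lemma bump_double: "bump n u \<le> 2 ^ n * bump n (2 * u)"
proof -
  have "(1 + \<bar>2 * u\<bar>) ^ n \<le> (2 * (1 + \<bar>u\<bar>)) ^ n"
    by (intro power_mono) auto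
  then have "(1 + \<bar>2 * u\<bar>) ^ n \<le> 2 ^ n * (1 + \<bar>u\<bar>) ^ n"
    by (simp only: power_mult_distrib)
  moreover have "0 < (1 + \<bar>u\<bar>) ^ n" "0 < (1 + \<bar>2 * u\<bar>) ^ n"
    by (auto intro!: zero_less_power)
  ultimately show ?thesis
    by (simp add: bump_def divide_simps mult.commute del: abs_mult)
qed

text \<open>For \<open>k > 0\<close> the kernel is \<open>2\<^sup>k * \<Phi> (2\<^sup>k * x)\<close> minus the same expression with
  \<open>k - 1\<close>, where \<open>\<Phi>\<close> is the inverse transform of the generator. Thus
  \<open>\<Theta> x\<close>, the integral of \<open>\<Phi>\<close> from \<open>2 ^ (k - 1) * x\<close> to \<open>2 ^ k * x\<close>, is
  a primitive, and it decays because the interval of integration stays away from the origin. This makes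
  the vanishing moment of the kernel explicit without Fourier inversion.\<close>

lemma littlewood_paley_kernels:
  assumes gen: "resolution_generator \<phi>0"
  obtains C \<Phi>' \<Theta> where "0 < C"
    "\<And>k. continuous_on UNIV (\<Phi>' k)"
    "\<And>k x. (inv_fourier (resolution \<phi>0 k) has_vector_derivative \<Phi>' k x) (at x)"
    "\<And>k x. norm (inv_fourier (resolution \<phi>0 k) x) \<le> C * 2 ^ k * bump 6 (2 ^ k * x)"
    "\<And>k x. norm (\<Phi>' k x) \<le> C * 4 ^ k * bump 6 (2 ^ k * x)"
    "\<And>k x. 0 < k \<Longrightarrow> (\<Theta> k has_vector_derivative inv_fourier (resolution \<phi>0 k) x) (at x)"
    "\<And>k x. 0 < k \<Longrightarrow> norm (\<Theta> k x) \<le> C * bump 6 (2 ^ k * x)"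
proof -
  obtain \<Phi>' C where C: "0 < C" and cont: "continuous_on UNIV \<Phi>'"
    and deriv: "\<And>x. (inv_fourier \<phi>0 has_vector_derivative \<Phi>' x) (at x)"
    and bnd: "\<And>x. norm (inv_fourier \<phi>0 x) \<le> C * bump 7 x" "\<And>x. norm (\<Phi>' x) \<le> C * bump 7 x"
    using generator_kernel[OF gen] by (metis (no_types, lifting))
  let ?\<Phi> = "inv_fourier \<phi>0"
  have "continuous_on UNIV ?\<Phi>"
    by (intro continuous_at_imp_continuous_on ballI has_vector_derivative_continuous[OF deriv])
  then obtain P where P: "\<And>x. (P has_vector_derivative ?\<Phi> x) (at x)"
    using continuous_antiderivative by blast
  have dil: "((\<lambda>x. F (a * x)) has_vector_derivative a *\<^sub>R F' (a * x)) (at x)"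
    if "\<And>x. (F has_vector_derivative F' x) (at x)" for F F' :: "real \<Rightarrow> complex" and a x :: real
  proof -
    have "((\<lambda>x. a * x) has_vector_derivative a) (at x)"
      by (auto simp: has_vector_derivative_def mult.commute intro!: derivative_eq_intros)
    from vector_diff_chain_at[OF this that] show ?thesis
      by (simp add: o_def)
  qed
  have half: "bump 7 (2 ^ k * x) \<le> 128 * bump 6 (2 ^ Suc k * x)" for k x
    using bump_double[of 7 "2 ^ k * x"] bump_exponent_antimono[of 6 7 "2 ^ Suc k * x"] by (simp add: mult.assoc)
  have full: "bump 7 u \<le> bump 6 u" for u by (rule bump_exponent_antimono) simp
  define \<Psi> where "\<Psi> k x = (case k of 0 \<Rightarrow> \<Phi>' x | Suc k \<Rightarrow>
     (2 ^ Suc k * 2 ^ Suc k) *\<^sub>R \<Phi>' (2 ^ Suc k * x) - (2 ^ k * 2 ^ k) *\<^sub>R \<Phi>' (2 ^ k * x))" for k x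
  define \<Theta> where "\<Theta> k x = P (2 ^ k * x) - P (2 ^ (k - 1) * x)" for k x
  have res0: "inv_fourier (resolution \<phi>0 0) = ?\<Phi>"
    by (simp add: inv_fourier_def resolution_def fun_eq_iff)
  have resS: "inv_fourier (resolution \<phi>0 (Suc k)) = (\<lambda>x. 2 ^ Suc k *\<^sub>R ?\<Phi> (2 ^ Suc k * x) - 2 ^ k *\<^sub>R ?\<Phi> (2 ^ k * x))" for k
    by (simp add: inv_fourier_resolution[OF gen] scaleR_conv_of_real fun_eq_iff del: power_Suc)
  have tri: "norm (a *\<^sub>R z - b *\<^sub>R w) \<le> C * 200 * a * bump 6 (2 ^ Suc k * x)"
    if "norm z \<le> C * bump 7 (2 ^ Suc k * x)" "norm w \<le> C * bump 7 (2 ^ k * x)" "0 \<le> b" "2 * b \<le> a"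
    for a b z k x and w :: complex
  proof -
    have "norm (a *\<^sub>R z - b *\<^sub>R w) \<le> a * norm z + b * norm w"
      using norm_triangle_ineq4[of "a *\<^sub>R z" "b *\<^sub>R w"] that by simp
    also have "\<dots> \<le> a * (C * bump 6 (2 ^ Suc k * x)) + a / 2 * (C * (128 * bump 6 (2 ^ Suc k * x)))"
    proof (intro add_mono mult_mono)
      show "norm z \<le> C * bump 6 (2 ^ Suc k * x)"
        using that(1) mult_left_mono[OF full, of C "2 ^ Suc k * x"] C by linarith
      show "norm w \<le> C * (128 * bump 6 (2 ^ Suc k * x))"
        using that(2) mult_left_mono[OF half, of C k x] C by linarith
    qed (use that C in auto)
    also have "\<dots> = C * 65 * a * bump 6 (2 ^ Suc k * x)" by (simp add: algebra_simps)
    also have "\<dots> \<le> C * 200 * a * bump 6 (2 ^ Suc k * x)"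
      using that C by (intro mult_right_mono mult_mono) auto
    finally show ?thesis .
  qed
  show thesis
  proof
    show "0 < C * 200" using C by simp
    fix k :: nat
    show "continuous_on UNIV (\<Psi> k)"
      unfolding \<Psi>_def
      by (cases k) (simp_all add: cont, intro continuous_intros continuous_on_compose2[OF cont], auto)
    fix x :: real
    show "(inv_fourier (resolution \<phi>0 k) has_vector_derivative \<Psi> k x) (at x)"
    proof (cases k)
      case 0
      then show ?thesis using deriv by (simp add: res0 \<Psi>_def)
    next
      case (Suc k)
      show ?thesis unfolding Suc resS \<Psi>_def nat.case scaleR_scaleR[symmetric]
        by (intro has_vector_derivative_diff bounded_linear.has_vector_derivative[OF bounded_linear_scaleR_right] dil deriv)
    qed
    have big: "C * bump 7 x \<le> C * 200 * bump 6 x"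
      using C mult_left_mono[OF full, of C x] bump_pos[of 6 x] by (smt (verit) mult_less_cancel_right_disj mult.commute mult.assoc mult_pos_pos)
    show "norm (inv_fourier (resolution \<phi>0 k) x) \<le> C * 200 * 2 ^ k * bump 6 (2 ^ k * x)"
    proof (cases k)
      case 0
      then show ?thesis using bnd(1)[of x] big by (simp add: res0)
    next
      case (Suc k)
      show ?thesis unfolding Suc resS by (rule tri) (auto intro: bnd)
    qed
    show "norm (\<Psi> k x) \<le> C * 200 * 4 ^ k * bump 6 (2 ^ k * x)"
    proof (cases k)
      case 0
      then show ?thesis using bnd(2)[of x] big by (simp add: \<Psi>_def)
    next
      case (Suc m)
      have "(2 ^ Suc m * 2 ^ Suc m) = (4::real) ^ Suc m"
        by (simp flip: power_mult_distrib)
      moreover have "norm (\<Psi> k x) \<le> C * 200 * (2 ^ Suc m * 2 ^ Suc m) * bump 6 (2 ^ Suc m * x)"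
        unfolding Suc \<Psi>_def nat.case by (rule tri) (auto intro: bnd)
      ultimately show ?thesis unfolding Suc by simp
    qed
  next
    fix k :: nat and x :: real assume "0 < k"
    then obtain m where k: "k = Suc m" by (cases k) auto
    show "(\<Theta> k has_vector_derivative inv_fourier (resolution \<phi>0 k) x) (at x)"
      unfolding \<Theta>_def[abs_def] k resS diff_Suc_1
      by (intro has_vector_derivative_diff dil P)
    let ?u = "2 ^ m * x"
    have "norm (P (2 * ?u) - P ?u) \<le> C * bump 7 ?u * \<bar>2 * ?u - ?u\<bar>"
    proof (rule norm_increment_le)
      fix y assume y: "y \<in> closed_segment ?u (2 * ?u)"
      have "\<bar>?u\<bar> \<le> \<bar>y\<bar>"
        using y by (auto simp: closed_segment_eq_real_ivl split: if_splits)
      then have "bump 7 y \<le> bump 7 ?u" by (rule bump_antimono)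
      then show "norm (?\<Phi> y) \<le> C * bump 7 ?u"
        using bnd(1)[of y] C by (smt (verit) mult_left_mono)
    qed (rule P)
    also have "2 * ?u - ?u = ?u" by linarith
    also have "C * bump 7 ?u * \<bar>?u\<bar> = C * (\<bar>?u\<bar> * bump 7 ?u)" by (simp only: ac_simps)
    also have "\<dots> \<le> C * bump 6 ?u"
    proof (intro mult_left_mono)
      have "\<bar>?u\<bar> * bump 7 ?u \<le> (1 + \<bar>?u\<bar>) * bump 7 ?u" by (intro mult_right_mono) auto
      also have "\<dots> = bump 6 ?u"
        by (simp add: bump_def eval_nat_numeral add_nonneg_eq_0_iff)
      finally show "\<bar>?u\<bar> * bump 7 ?u \<le> bump 6 ?u" .
    qed (use C in simp)
    also have "\<dots> \<le> C * (64 * bump 6 (2 * ?u))"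
      using bump_double[of 6 ?u] C by (intro mult_left_mono) auto
    also have "\<dots> \<le> C * 200 * bump 6 (2 * ?u)"
      using C by simp
    finally show "norm (\<Theta> k x) \<le> C * 200 * bump 6 (2 ^ k * x)"
      by (simp add: \<Theta>_def k mult.assoc)
  qed
qed

text \<open>An integral over the line is split into the dyadic cells. The end point contributions \<open>e\<close> of
  neighbouring cells cancel in every finite union of cells, and those at the two ends of the union vanish
  in the limit.\<close>

lemma telescoping_integral_bound:
  fixes F :: "real \<Rightarrow> complex" and e :: "int \<Rightarrow> complex" and N :: nat
  assumes F: "integrable lborel F"
    and step: "\<And>\<mu>. norm ((LBINT y:dyadic_interval N \<mu>. F y) - (e (\<mu> + 1) - e \<mu>)) \<le> B \<mu>"
    and lim: "(\<lambda>n. e (int n * 2 ^ N)) \<longlonglongrightarrow> 0" "(\<lambda>n. e (- int n * 2 ^ N)) \<longlonglongrightarrow> 0"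
  shows "ennreal (norm (LINT y|lborel. F y)) \<le> (\<Sum>\<^sup>+\<mu>. ennreal (B \<mu>))"
proof (cases "\<Sum>\<^sup>+\<mu>. ennreal (B \<mu>)")
  case (real T)
  have B0: "0 \<le> B \<mu>" for \<mu> using order_trans[OF norm_ge_zero step] .
  have si: "set_integrable lborel A F" if "A \<in> sets borel" for A
    unfolding set_integrable_def using F that by (intro integrable_mult_indicator) auto
  have tel: "norm ((LBINT y:{of_int \<mu> / 2 ^ N ..< of_int (\<mu> + int m) / 2 ^ N}. F y) - (e (\<mu> + int m) - e \<mu>))
      \<le> (\<Sum>i<m. B (\<mu> + int i))" for \<mu> m
  proof (induction m)
    case (Suc m)
    let ?A = "{of_int \<mu> / 2 ^ N ..< of_int (\<mu> + int m) / 2 ^ N :: real}" and ?I = "dyadic_interval N (\<mu> + int m)"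
    have "{of_int \<mu> / 2 ^ N ..< of_int (\<mu> + int (Suc m)) / 2 ^ N :: real} = ?A \<union> ?I"
      unfolding dyadic_interval_def
      by (subst ivl_disj_un_two(3)) (auto intro!: divide_right_mono simp: ac_simps)
    moreover have "?A \<inter> ?I = {}" by (auto simp: dyadic_interval_def)
    ultimately have "(LBINT y:{of_int \<mu> / 2 ^ N ..< of_int (\<mu> + int (Suc m)) / 2 ^ N}. F y)
        = (LBINT y:?A. F y) + (LBINT y:?I. F y)"
      by (simp add: set_integral_Un si dyadic_interval_def)
    then have "norm ((LBINT y:{of_int \<mu> / 2 ^ N ..< of_int (\<mu> + int (Suc m)) / 2 ^ N}. F y) - (e (\<mu> + int (Suc m)) - e \<mu>))
        = norm (((LBINT y:?A. F y) - (e (\<mu> + int m) - e \<mu>)) + ((LBINT y:?I. F y) - (e (\<mu> + int m + 1) - e (\<mu> + int m))))"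
      by (simp add: algebra_simps)
    also have "\<dots> \<le> (\<Sum>i<m. B (\<mu> + int i)) + B (\<mu> + int m)"
      by (rule order_trans[OF norm_triangle_ineq add_mono[OF Suc.IH step]])
    finally show ?case by simp
  qed (simp add: set_lebesgue_integral_def)
  have sumT: "(\<Sum>i<m. B (\<mu> + int i)) \<le> T" for \<mu> m
  proof -
    have "ennreal (\<Sum>i<m. B (\<mu> + int i)) = (\<Sum>i<m. ennreal (B (\<mu> + int i)))"
      by (rule sum_ennreal[symmetric]) (rule B0)
    also have "\<dots> = (\<Sum>j\<in>(\<lambda>i. \<mu> + int i) ` {..<m}. ennreal (B j))"
      by (subst sum.reindex) (auto simp: inj_on_def)
    also have "\<dots> = (\<Sum>\<^sup>+j. ennreal (B j) * indicator ((\<lambda>i. \<mu> + int i) ` {..<m}) j)"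
      by (subst nn_integral_count_space'[of "(\<lambda>i. \<mu> + int i) ` {..<m}"]) auto
    also have "\<dots> \<le> (\<Sum>\<^sup>+j. ennreal (B j))"
      by (intro nn_integral_mono) (auto simp: indicator_def)
    finally show ?thesis using real by simp
  qed
  let ?A = "\<lambda>n::nat. {- real n ..< real n}"
  have conv: "(\<lambda>n. LBINT y:?A n. F y) \<longlonglongrightarrow> (LINT y|lborel. F y)"
    unfolding set_lebesgue_integral_def
  proof (rule integral_dominated_convergence[where w = "\<lambda>y. norm (F y)"])
    show "AE y in lborel. (\<lambda>n. indicator (?A n) y *\<^sub>R F y) \<longlonglongrightarrow> F y"
    proof (rule AE_I2)
      fix y :: real
      obtain n0 :: nat where n0: "\<bar>y\<bar> < real n0" using reals_Archimedean2 by blast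
      have "\<forall>\<^sub>F n in sequentially. indicator (?A n) y *\<^sub>R F y = F y"
        using eventually_ge_at_top[of n0] by eventually_elim (use n0 in \<open>auto simp: indicator_def\<close>)
      then show "(\<lambda>n. indicator (?A n) y *\<^sub>R F y) \<longlonglongrightarrow> F y" by (rule tendsto_eventually)
    qed
  qed (use F in \<open>auto intro!: AE_I2 integrable_norm simp: indicator_def dest: borel_measurable_integrable\<close>)
  have "norm (LBINT y:?A n. F y) \<le> T + (norm (e (int n * 2 ^ N)) + norm (e (- int n * 2 ^ N)))" for n
  proof -
    let ?m = "2 * n * 2 ^ N"
    have *: "- int n * 2 ^ N + int ?m = int n * 2 ^ N" by simp
    have "norm ((LBINT y:{of_int (- int n * 2 ^ N) / 2 ^ N ..< of_int (- int n * 2 ^ N + int ?m) / 2 ^ N}. F y)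
        - (e (- int n * 2 ^ N + int ?m) - e (- int n * 2 ^ N))) \<le> T"
      by (rule order_trans[OF tel sumT])
    then have "norm ((LBINT y:?A n. F y) - (e (int n * 2 ^ N) - e (- int n * 2 ^ N))) \<le> T"
      unfolding * by simp
    moreover have "norm (LBINT y:?A n. F y) \<le> norm ((LBINT y:?A n. F y) - (e (int n * 2 ^ N) - e (- int n * 2 ^ N)))
        + (norm (e (int n * 2 ^ N)) + norm (e (- int n * 2 ^ N)))"
      by (smt (verit) norm_triangle_ineq2 norm_triangle_ineq4)
    ultimately show ?thesis by linarith
  qed
  moreover have "(\<lambda>n. T + (norm (e (int n * 2 ^ N)) + norm (e (- int n * 2 ^ N)))) \<longlonglongrightarrow> T + (norm (0::complex) + norm (0::complex))"
    by (intro tendsto_intros lim)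
  ultimately have "norm (LINT y|lborel. F y) \<le> T + (norm (0::complex) + norm (0::complex))"
    using tendsto_norm[OF conv] by (intro LIMSEQ_le[of _ _ _ "T + (norm (0::complex) + norm (0::complex))"]) auto
  then show ?thesis using real by (simp add: ennreal_leI)
qed simp

section \<open>Functions that are smooth on dyadic cells\<close>

text \<open>The primitive is bounded by one, so the increments of functions with a derivative below a bump are
  controlled without evaluating an integral.\<close>

lemma bump_antiderivative: "((\<lambda>u. u / (1 + \<bar>u\<bar>)) has_real_derivative bump 2 u) (at u)"
proof (cases "u = 0")
  case True
  have lim: "((\<lambda>h::real. 1 / (1 + \<bar>h\<bar>)) \<longlongrightarrow> 1 / (1 + \<bar>0\<bar>)) (at 0)"
    by (intro tendsto_intros) auto
  have "\<forall>\<^sub>F h in at 0. 1 / (1 + \<bar>h\<bar>) = (h / (1 + \<bar>h\<bar>) - 0 / (1 + \<bar>0\<bar>)) / (h - 0 :: real)"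
    using eventually_neq_at_within[of 0 0] by (auto simp: eventually_at_filter)
  from Lim_transform_eventually[OF lim this] show ?thesis
    unfolding True has_field_derivative_iff by (simp add: bump_def)
next
  case False
  have "(abs has_real_derivative sgn u) (at u)"
  proof (cases "0 < u")
    case True
    show ?thesis
      by (rule has_field_derivative_transform_within_open[of "\<lambda>u. u" _ _ "{0<..}"])
        (use True in \<open>auto intro!: derivative_eq_intros\<close>)
  next
    case neg: False
    show ?thesis
      by (rule has_field_derivative_transform_within_open[of "\<lambda>u. - u" _ _ "{..<0}"])
        (use False neg in \<open>auto intro!: derivative_eq_intros\<close>)
  qed
  then have "((\<lambda>u. u / (1 + \<bar>u\<bar>)) has_real_derivative (1 * (1 + \<bar>u\<bar>) - u * sgn u) / ((1 + \<bar>u\<bar>) * (1 + \<bar>u\<bar>))) (at u)"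
    by (intro DERIV_divide) (auto intro!: derivative_eq_intros)
  moreover have "(1 * (1 + \<bar>u\<bar>) - u * sgn u) / ((1 + \<bar>u\<bar>) * (1 + \<bar>u\<bar>)) = bump 2 u"
    by (simp add: bump_def power2_eq_square abs_sgn mult.commute)
  ultimately show ?thesis by simp
qed

lemma norm_increment_le_bump:
  fixes V :: "real \<Rightarrow> complex"
  assumes ab: "a < b" and V: "\<And>y. (V has_vector_derivative v y) (at y)"
    and M: "0 \<le> M" and r: "0 < r"
    and v: "\<And>y. y \<in> {a..b} \<Longrightarrow> norm (v y) \<le> M * bump 2 (r * (x - y))"
  shows "norm (V b - V a) \<le> M * (2 / r)"
proof -
  let ?F = "\<lambda>u::real. u / (1 + \<bar>u\<bar>)"
  let ?\<phi> = "\<lambda>y. M / r * ?F (r * (y - x))"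
  have \<phi>: "(?\<phi> has_vector_derivative M * bump 2 (r * (x - y))) (at y)" for y
  proof -
    have "((\<lambda>y. ?F (r * (y - x))) has_real_derivative bump 2 (r * (y - x)) * r) (at y)"
      by (rule DERIV_chain2[OF bump_antiderivative]) (auto intro!: derivative_eq_intros)
    then have "(?\<phi> has_real_derivative M / r * (bump 2 (r * (y - x)) * r)) (at y)"
      by (rule DERIV_cmult)
    then show ?thesis
      using r by (simp add: has_real_derivative_iff_has_vector_derivative bump_reflect[of 2 r x])
  qed
  have "norm (V b - V a) \<le> ?\<phi> b - ?\<phi> a"
    using V \<phi> v ab
    by (intro differentiable_bound_general[where f' = v and \<phi>' = "\<lambda>y. M * bump 2 (r * (x - y))"])
      (auto intro!: continuous_at_imp_continuous_on has_vector_derivative_continuous)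
  also have "\<dots> = M / r * (?F (r * (b - x)) - ?F (r * (a - x)))"
    by (simp only: right_diff_distrib)
  also have "\<dots> \<le> M / r * 2"
  proof (intro mult_left_mono)
    have "\<bar>?F u\<bar> \<le> 1" for u by (simp add: divide_le_eq)
    from this[of "r * (b - x)"] this[of "r * (a - x)"]
    show "?F (r * (b - x)) - ?F (r * (a - x)) \<le> 2" by linarith
  qed (use M r in auto)
  finally show ?thesis by simp
qed

lemma sum_int_shift:
  fixes f :: "int \<Rightarrow> ennreal"
  shows "(\<Sum>\<^sup>+\<mu>. f (\<mu> + 1)) = (\<Sum>\<^sup>+\<mu>. f \<mu>)"
proof (rule nn_integral_bij_count_space)
  show "bij_betw (\<lambda>\<mu>::int. \<mu> + 1) UNIV UNIV"
    by (rule bij_betw_byWitness[where f' = "\<lambda>\<mu>. \<mu> - 1"]) auto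
qed

lemma dyadic_interval_FTC:
  fixes g :: "real \<Rightarrow> complex"
  assumes W: "\<And>y. (W has_vector_derivative g y) (at y)" and g: "continuous_on UNIV g"
  shows "(LBINT y:dyadic_interval N \<mu>. g y) = W (of_int (\<mu> + 1) / 2 ^ N) - W (of_int \<mu> / 2 ^ N)"
proof -
  let ?a = "of_int \<mu> / 2 ^ N :: real" and ?b = "of_int (\<mu> + 1) / 2 ^ N :: real"
  have ab: "?a \<le> ?b" by (simp add: divide_right_mono)
  have "(LBINT y:dyadic_interval N \<mu>. g y) = (LBINT y:{?a..<?b}. g y)"
    by (simp add: dyadic_interval_def)
  also have "\<dots> = (LBINT y=?a..?b. g y)"
    using ab by (simp only: interval_integral_Ico)
  also have "\<dots> = (LBINT y:{?a..?b}. g y)"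
    using ab by (rule interval_integral_Icc)
  also have "\<dots> = W ?b - W ?a"
    unfolding set_lebesgue_integral_def using ab
    by (intro integral_FTC_atLeastAtMost has_vector_derivative_at_within[OF W] continuous_on_subset[OF g]) auto
  finally show ?thesis .
qed

lemma bump_at_infinity:
  "(\<lambda>n. bump 1 (x - real n)) \<longlonglongrightarrow> 0" "(\<lambda>n. bump 1 (x + real n)) \<longlonglongrightarrow> 0"
  unfolding bump_def power_one_right by real_asymp+

lemma bump_integrable:
  assumes "0 < a"
  shows "integrable lborel (\<lambda>y. bump 2 (a * (x - y)))"
proof (rule integrableI_bounded)
  have "(\<integral>\<^sup>+y. ennreal (norm (bump 2 (a * (x - y)))) \<partial>lborel) = (\<integral>\<^sup>+y. ennreal (bump 2 (a * (y - x))) \<partial>lborel)"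
    by (simp add: bump_reflect[of 2 a x])
  also have "\<dots> \<le> ennreal (2 / a)" by (rule nn_integral_bump_scaled[OF assms])
  also have "\<dots> < \<infinity>" by simp
  finally show "(\<integral>\<^sup>+y. ennreal (norm (bump 2 (a * (x - y)))) \<partial>lborel) < \<infinity>" .
qed measurable

text \<open>The abstract situation behind the remainder: \<open>c \<mu>\<close> is the value of the averages on the
  cell \<open>\<mu>\<close>, \<open>P\<close> the partial sum with primitive \<open>Q\<close>, and \<open>d \<mu>\<close> the primitive of the tail
  of the expansion at the grid point \<open>\<mu>\<close>. By \<open>mean\<close>, the integral of \<open>c \<mu> - P\<close> over the
  cell is \<open>d (\<mu> + 1) - d \<mu>\<close>. The bounds reach over the neighbouring cell so that \<open>h \<mu>\<close>
  also controls the values to the left of the grid point \<open>\<mu>\<close>.\<close>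

locale dyadic_remainder =
  fixes N :: nat and c d :: "int \<Rightarrow> complex" and P P' Q :: "real \<Rightarrow> complex"
    and h :: "int \<Rightarrow> real" and H :: real
  assumes P: "\<And>x. (P has_vector_derivative P' x) (at x)"
    and P'_cont: "continuous_on UNIV P'"
    and Q: "\<And>x. (Q has_vector_derivative P x) (at x)"
    and mean: "\<And>\<mu>. c \<mu> / 2 ^ N = Q (of_int (\<mu> + 1) / 2 ^ N) - Q (of_int \<mu> / 2 ^ N) + d (\<mu> + 1) - d \<mu>"
    and d_bound: "\<And>\<mu> i. i \<in> {-1, 0, 1} \<Longrightarrow> norm (d (\<mu> + i)) \<le> h \<mu> / 2 ^ N"
    and P'_bound: "\<And>\<mu> y. of_int (\<mu> - 1) / 2 ^ N \<le> y \<Longrightarrow> y \<le> of_int (\<mu> + 1) / 2 ^ N \<Longrightarrow> norm (P' y) \<le> 2 ^ N * h \<mu>"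
    and h_le: "\<And>\<mu>. h \<mu> \<le> H"
begin

abbreviation grid :: "int \<Rightarrow> real" where "grid \<mu> \<equiv> of_int \<mu> / 2 ^ N"

definition G :: "real \<Rightarrow> complex" where "G x = c \<lfloor>2 ^ N * x\<rfloor> - P x"

lemma h_nonneg: "0 \<le> h \<mu>"
proof -
  have "0 \<le> h \<mu> / 2 ^ N * 2 ^ N"
    using order_trans[OF norm_ge_zero d_bound[of 0 \<mu>]] by (intro mult_nonneg_nonneg) auto
  then show ?thesis by simp
qed

lemma H_nonneg: "0 \<le> H" using h_nonneg h_le order_trans by blast

lemma grid_less: "grid \<mu> < grid (\<mu> + 1)"
  by (simp add: divide_strict_right_mono)

lemma grid_diff: "grid (\<mu> + 1) - grid \<mu> = 1 / 2 ^ N"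
  by (simp add: diff_divide_distrib[symmetric])

text \<open>Up to the increment of \<open>d\<close>, the constant \<open>c m\<close> is the mean of \<open>P\<close> over the cell, and
  \<open>P\<close> deviates from its mean by at most the length of the cell times the bound of its derivative.\<close>

lemma cell_value_bound:
  assumes m: "m = \<mu> \<or> m = \<mu> - 1" and y: "grid m \<le> y" "y \<le> grid (m + 1)"
  shows "norm (c m - P y) \<le> 3 * h \<mu>"
proof -
  have sub: "grid (\<mu> - 1) \<le> z \<and> z \<le> grid (\<mu> + 1)" if "grid m \<le> z" "z \<le> grid (m + 1)" for z
  proof -
    have "grid (\<mu> - 1) \<le> grid m" "grid (m + 1) \<le> grid (\<mu> + 1)"
      using m by (auto intro!: divide_right_mono)
    then show ?thesis using that by linarith
  qed
  have "norm ((Q (grid (m + 1)) - grid (m + 1) *\<^sub>R P y) - (Q (grid m) - grid m *\<^sub>R P y)) \<le> h \<mu> * \<bar>grid (m + 1) - grid m\<bar>"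
  proof (rule norm_increment_le)
    fix z assume "z \<in> closed_segment (grid m) (grid (m + 1))"
    then have z: "grid m \<le> z" "z \<le> grid (m + 1)"
      using grid_less[of m] by (auto simp: closed_segment_eq_real_ivl)
    show "((\<lambda>z. Q z - z *\<^sub>R P y) has_vector_derivative P z - P y) (at z)"
      by (auto intro!: derivative_eq_intros Q)
    have "norm (P z - P y) \<le> (2 ^ N * h \<mu>) * \<bar>z - y\<bar>"
    proof (rule norm_increment_le)
      fix w assume "w \<in> closed_segment y z"
      then have "grid m \<le> w" "w \<le> grid (m + 1)"
        using y z by (auto simp: closed_segment_eq_real_ivl split: if_splits)
      then show "norm (P' w) \<le> 2 ^ N * h \<mu>" using sub P'_bound by blast
    qed (rule P)
    also have "\<dots> \<le> (2 ^ N * h \<mu>) * (1 / 2 ^ N)"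
      using y z grid_diff[of m] h_nonneg by (intro mult_left_mono) auto
    finally show "norm (P z - P y) \<le> h \<mu>" by simp
  qed
  then have A: "norm ((Q (grid (m + 1)) - Q (grid m)) - P y / 2 ^ N) \<le> h \<mu> / 2 ^ N"
    using grid_diff[of m]
    by (simp add: algebra_simps scaleR_conv_of_real) (simp add: add_divide_distrib algebra_simps)
  have "norm (d (m + 1)) \<le> h \<mu> / 2 ^ N" "norm (d m) \<le> h \<mu> / 2 ^ N"
    using m d_bound[of 1 \<mu>] d_bound[of 0 \<mu>] d_bound[of "-1" \<mu>] by auto
  moreover have E: "(c m - P y) / 2 ^ N = ((Q (grid (m + 1)) - Q (grid m)) - P y / 2 ^ N) + (d (m + 1) - d m)"
    unfolding diff_divide_distrib mean by simp
  ultimately have "norm ((c m - P y) / 2 ^ N) \<le> h \<mu> / 2 ^ N + (h \<mu> / 2 ^ N + h \<mu> / 2 ^ N)"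
    unfolding E using A norm_triangle_ineq[of "(Q (grid (m + 1)) - Q (grid m)) - P y / 2 ^ N" "d (m + 1) - d m"]
      norm_triangle_ineq4[of "d (m + 1)" "d m"] by linarith
  then have "norm (c m - P y) / 2 ^ N \<le> 3 * h \<mu> / 2 ^ N"
    by (simp add: norm_divide norm_power)
  then show ?thesis by (simp add: divide_le_cancel)
qed

lemma G_cell: "y \<in> dyadic_interval N \<mu> \<Longrightarrow> G y = c \<mu> - P y"
proof -
  assume "y \<in> dyadic_interval N \<mu>"
  then have "\<lfloor>2 ^ N * y\<rfloor> = \<mu>"
    by (auto simp: dyadic_interval_def floor_eq_iff field_simps)
  then show ?thesis by (simp add: G_def)
qed

lemma G_bound: "norm (G y) \<le> 3 * H"
proof -
  let ?m = "\<lfloor>2 ^ N * y\<rfloor>"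
  have "of_int ?m \<le> 2 ^ N * y" "2 ^ N * y < of_int ?m + 1" by linarith+
  then have "grid ?m \<le> y" "y \<le> grid (?m + 1)" by (auto simp: field_simps)
  then have "norm (c ?m - P y) \<le> 3 * h ?m" by (intro cell_value_bound) auto
  then show ?thesis using h_le[of ?m] by (simp add: G_def)
qed

lemma P_cont: "continuous_on S P"
  using P by (auto intro!: continuous_at_imp_continuous_on has_vector_derivative_continuous)

lemma G_borel [measurable]: "G \<in> borel_measurable borel"
proof -
  have "P \<in> borel_measurable borel"
    by (rule borel_measurable_continuous_onI[OF P_cont])
  then show ?thesis unfolding G_def[abs_def] by measurable
qed

lemma cell_integral:
  assumes K: "continuous_on UNIV K" and W: "\<And>y. (W has_vector_derivative (c \<mu> - P y) * K y) (at y)"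
  shows "(LBINT y:dyadic_interval N \<mu>. G y * K y) = W (grid (\<mu> + 1)) - W (grid \<mu>)"
proof -
  have "(LBINT y:dyadic_interval N \<mu>. G y * K y) = (LBINT y:dyadic_interval N \<mu>. (c \<mu> - P y) * K y)"
    by (intro set_lebesgue_integral_cong) (auto simp: G_cell dyadic_interval_def)
  also have "\<dots> = W (grid (\<mu> + 1)) - W (grid \<mu>)"
    using W by (rule dyadic_interval_FTC) (intro continuous_intros P_cont K)
  finally show ?thesis .
qed

lemma cell_antiderivative:
  assumes "continuous_on UNIV K"
  obtains W where "\<And>y. (W has_vector_derivative (c \<mu> - P y) * K y) (at y)"
proof -
  have "continuous_on UNIV (\<lambda>y. (c \<mu> - P y) * K y)"
    by (intro continuous_intros P_cont assms)
  from continuous_antiderivative[OF this] show thesis using that by blast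
qed

text \<open>Integration by parts with the primitive \<open>U\<close> of \<open>c \<mu> - P\<close> that starts with \<open>d \<mu>\<close>. At
  the right end point it equals \<open>d (\<mu> + 1)\<close>, so the boundary terms telescope over the cells.\<close>

lemma cell_estimate_smooth:
  assumes K: "\<And>y. (K has_vector_derivative K1 y) (at y)"
    and B: "\<And>y. grid \<mu> \<le> y \<Longrightarrow> y \<le> grid (\<mu> + 1) \<Longrightarrow> norm (K1 y) \<le> B"
  shows "norm ((LBINT y:dyadic_interval N \<mu>. G y * K y) - (d (\<mu> + 1) * K (grid (\<mu> + 1)) - d \<mu> * K (grid \<mu>)))
    \<le> 4 * h \<mu> * B / 4 ^ N"
proof -
  have contK: "continuous_on UNIV K"
    using K by (auto intro!: continuous_at_imp_continuous_on has_vector_derivative_continuous)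
  obtain W where W: "\<And>y. (W has_vector_derivative (c \<mu> - P y) * K y) (at y)"
    using cell_antiderivative[OF contK] by blast
  \<comment> \<open>The constant of integration is chosen to make the primitive continuous across the cells.\<close>
  define U where "U y = d \<mu> + (y - grid \<mu>) *\<^sub>R c \<mu> - (Q y - Q (grid \<mu>))" for y
  have U: "(U has_vector_derivative c \<mu> - P y) (at y)" for y
    unfolding U_def by (auto intro!: derivative_eq_intros Q)
  have Ua: "U (grid \<mu>) = d \<mu>" by (simp add: U_def)
  have Ub: "U (grid (\<mu> + 1)) = d (\<mu> + 1)"
    unfolding U_def grid_diff using mean[of \<mu>] by (simp add: scaleR_conv_of_real)
  have Ubnd: "norm (U y) \<le> 4 * h \<mu> / 2 ^ N" if y: "grid \<mu> \<le> y" "y \<le> grid (\<mu> + 1)" for y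
  proof -
    have "norm (U y - U (grid \<mu>)) \<le> (3 * h \<mu>) * \<bar>y - grid \<mu>\<bar>"
    proof (rule norm_increment_le[OF U])
      fix z assume "z \<in> closed_segment (grid \<mu>) y"
      then show "norm (c \<mu> - P z) \<le> 3 * h \<mu>"
        using y by (intro cell_value_bound) (auto simp: closed_segment_eq_real_ivl)
    qed
    also have "\<dots> \<le> (3 * h \<mu>) * (1 / 2 ^ N)"
      using y grid_diff[of \<mu>] h_nonneg by (intro mult_left_mono) auto
    finally have "norm (U y - d \<mu>) \<le> 3 * h \<mu> / 2 ^ N" by (simp add: Ua)
    then show ?thesis
      using d_bound[of 0 \<mu>] norm_triangle_ineq2[of "U y" "d \<mu>"] by simp
  qed
  have "norm ((W (grid (\<mu> + 1)) - U (grid (\<mu> + 1)) * K (grid (\<mu> + 1))) - (W (grid \<mu>) - U (grid \<mu>) * K (grid \<mu>)))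
      \<le> (4 * h \<mu> / 2 ^ N * B) * \<bar>grid (\<mu> + 1) - grid \<mu>\<bar>"
  proof (rule norm_increment_le)
    fix y assume "y \<in> closed_segment (grid \<mu>) (grid (\<mu> + 1))"
    then have y: "grid \<mu> \<le> y" "y \<le> grid (\<mu> + 1)"
      using grid_less[of \<mu>] by (auto simp: closed_segment_eq_real_ivl)
    have "((\<lambda>y. W y - U y * K y) has_vector_derivative (c \<mu> - P y) * K y - (U y * K1 y + (c \<mu> - P y) * K y)) (at y)"
      by (intro has_vector_derivative_diff has_vector_derivative_mult W U K)
    then show "((\<lambda>y. W y - U y * K y) has_vector_derivative - (U y * K1 y)) (at y)" by simp
    show "norm (- (U y * K1 y)) \<le> 4 * h \<mu> / 2 ^ N * B"
      unfolding norm_minus_cancel norm_mult using y Ubnd B h_nonneg by (intro mult_mono) auto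
  qed
  also have "(4 * h \<mu> / 2 ^ N * B) * \<bar>grid (\<mu> + 1) - grid \<mu>\<bar> = 4 * h \<mu> * B / 4 ^ N"
    unfolding grid_diff by (simp flip: power_mult_distrib)
  finally show ?thesis
    unfolding cell_integral[OF contK W] Ua Ub by (simp add: algebra_simps)
qed

text \<open>Integration by parts with a primitive \<open>T\<close> of the kernel. Here the boundary terms remain: they are
  the jumps of the averages, seen by \<open>T\<close> at the grid points.\<close>

lemma cell_estimate_rough:
  assumes T: "\<And>y. (T has_vector_derivative K y) (at y)" and K: "continuous_on UNIV K"
    and r: "0 < r" and M: "0 \<le> M" and T_bound: "\<And>y. grid \<mu> \<le> y \<Longrightarrow> y \<le> grid (\<mu> + 1) \<Longrightarrow> norm (T y) \<le> M * bump 2 (r * (x - y))"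
  shows "norm (LBINT y:dyadic_interval N \<mu>. G y * K y)
    \<le> 3 * h (\<mu> + 1) * norm (T (grid (\<mu> + 1))) + 3 * h \<mu> * norm (T (grid \<mu>)) + 2 ^ N * h \<mu> * M * (2 / r)"
proof -
  obtain W where W: "\<And>y. (W has_vector_derivative (c \<mu> - P y) * K y) (at y)"
    using cell_antiderivative[OF K] by blast
  let ?g = "\<lambda>y. c \<mu> - P y"
  have "norm ((W (grid (\<mu> + 1)) - ?g (grid (\<mu> + 1)) * T (grid (\<mu> + 1))) - (W (grid \<mu>) - ?g (grid \<mu>) * T (grid \<mu>)))
      \<le> 2 ^ N * h \<mu> * M * (2 / r)"
  proof (rule norm_increment_le_bump[where V = "\<lambda>y. W y - ?g y * T y", OF grid_less])
    fix y
    have "((\<lambda>y. W y - ?g y * T y) has_vector_derivative (c \<mu> - P y) * K y - (?g y * K y + (0 - P' y) * T y)) (at y)"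
      by (intro has_vector_derivative_diff has_vector_derivative_mult W T P has_vector_derivative_const)
    then show "((\<lambda>y. W y - ?g y * T y) has_vector_derivative P' y * T y) (at y)" by simp
    assume y: "y \<in> {grid \<mu>..grid (\<mu> + 1)}"
    have "grid (\<mu> - 1) \<le> grid \<mu>" by (auto intro!: divide_right_mono)
    then have "norm (P' y) \<le> 2 ^ N * h \<mu>" using y by (intro P'_bound) auto
    moreover have "norm (T y) \<le> M * bump 2 (r * (x - y))" using y T_bound by auto
    ultimately have "norm (P' y) * norm (T y) \<le> (2 ^ N * h \<mu>) * (M * bump 2 (r * (x - y)))"
      using h_nonneg by (intro mult_mono) auto
    then show "norm (P' y * T y) \<le> 2 ^ N * h \<mu> * M * bump 2 (r * (x - y))"
      by (simp add: norm_mult mult.assoc)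
  qed (use M r h_nonneg in auto)
  moreover have "norm (?g (grid (\<mu> + 1)) * T (grid (\<mu> + 1))) \<le> 3 * h (\<mu> + 1) * norm (T (grid (\<mu> + 1)))"
    unfolding norm_mult using grid_less[of \<mu>] by (intro mult_right_mono cell_value_bound) auto
  moreover have "norm (?g (grid \<mu>) * T (grid \<mu>)) \<le> 3 * h \<mu> * norm (T (grid \<mu>))"
    unfolding norm_mult using grid_less[of \<mu>] by (intro mult_right_mono cell_value_bound) auto
  moreover have "W (grid (\<mu> + 1)) - W (grid \<mu>)
      = ((W (grid (\<mu> + 1)) - ?g (grid (\<mu> + 1)) * T (grid (\<mu> + 1))) - (W (grid \<mu>) - ?g (grid \<mu>) * T (grid \<mu>)))
        + (?g (grid (\<mu> + 1)) * T (grid (\<mu> + 1)) - ?g (grid \<mu>) * T (grid \<mu>))"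
    by simp
  ultimately show ?thesis
    unfolding cell_integral[OF K W]
    by (smt (verit) norm_triangle_ineq norm_triangle_ineq4)
qed

lemma product_integrable:
  assumes K: "continuous_on UNIV K" and r: "0 < r" and K_bound: "\<And>y. norm (K y) \<le> M * bump 2 (r * (x - y))"
  shows "integrable lborel (\<lambda>y. G y * K y)"
proof (rule Bochner_Integration.integrable_bound)
  show "integrable lborel (\<lambda>y. (3 * H * M) * bump 2 (r * (x - y)))"
    by (intro integrable_mult_right bump_integrable r)
  have "K \<in> borel_measurable borel" by (rule borel_measurable_continuous_onI[OF K])
  then show "(\<lambda>y. G y * K y) \<in> borel_measurable lborel" by measurable
  have M: "0 \<le> M"
    using order_trans[OF norm_ge_zero K_bound[of x]] bump_pos[of 2 0] by (simp add: zero_le_mult_iff)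
  have "norm (G y * K y) \<le> norm ((3 * H * M) * bump 2 (r * (x - y)))" for y
  proof -
    have "norm (G y) * norm (K y) \<le> (3 * H) * (M * bump 2 (r * (x - y)))"
      using G_bound K_bound H_nonneg by (intro mult_mono) auto
    then show ?thesis using M H_nonneg by (simp add: norm_mult abs_mult mult.assoc)
  qed
  then show "AE y in lborel. norm (G y * K y) \<le> norm ((3 * H * M) * bump 2 (r * (x - y)))" by simp
qed

lemma boundary_terms_vanish:
  assumes K_bound: "\<And>y. norm (K y) \<le> M * bump 1 (x - y)"
    and n: "\<And>n. grid (\<mu> n) = z * real n" "z = 1 \<or> z = -1"
  shows "(\<lambda>n. d (\<mu> n) * K (grid (\<mu> n))) \<longlonglongrightarrow> 0"
proof (rule Lim_null_comparison)
  have "norm (d (\<mu> n) * K (grid (\<mu> n))) \<le> H / 2 ^ N * (M * bump 1 (x - z * real n))" for n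
  proof -
    have "norm (d (\<mu> n)) \<le> H / 2 ^ N"
      using order_trans[OF d_bound[of 0 "\<mu> n"] divide_right_mono[OF h_le]] by simp
    then show ?thesis
      using K_bound[of "z * real n"] H_nonneg unfolding norm_mult n(1) by (intro mult_mono) auto
  qed
  then show "\<forall>\<^sub>F n in sequentially. norm (d (\<mu> n) * K (grid (\<mu> n))) \<le> H / 2 ^ N * (M * bump 1 (x - z * real n))"
    by simp
  have "(\<lambda>n. bump 1 (x - z * real n)) \<longlonglongrightarrow> 0" using n(2) bump_at_infinity by auto
  then have "(\<lambda>n. H / 2 ^ N * (M * bump 1 (x - z * real n))) \<longlonglongrightarrow> H / 2 ^ N * (M * 0)"
    by (intro tendsto_intros)
  then show "(\<lambda>n. H / 2 ^ N * (M * bump 1 (x - z * real n))) \<longlonglongrightarrow> 0" by simp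
qed

text \<open>A kernel of a scale coarser than the cells has a bump as majorant that is almost constant on a cell, so
  the bound of its derivative may be evaluated at the grid point.\<close>

lemma integral_against_smooth_kernel:
  assumes K: "\<And>y. (K has_vector_derivative K1 y) (at y)" and k: "k \<le> N"
    and K_bound: "\<And>y. norm (K y) \<le> M0 * bump 6 (2 ^ k * (x - y))"
    and K1_bound: "\<And>y. norm (K1 y) \<le> M * bump 6 (2 ^ k * (x - y))"
  shows "ennreal (norm (LINT y|lborel. G y * K y))
    \<le> ennreal (64 * M / 4 ^ N) * (\<Sum>\<^sup>+\<mu>. ennreal (bump 4 (2 ^ k * (x - of_int \<mu> / 2 ^ N))) * ennreal (h \<mu>))"
proof -
  have nn: "0 \<le> M0" "0 \<le> M"
    using order_trans[OF norm_ge_zero K_bound[of x]] order_trans[OF norm_ge_zero K1_bound[of x]] bump_pos[of 6 0]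
    by (simp_all add: zero_le_mult_iff)
  have contK: "continuous_on UNIV K"
    using K by (auto intro!: continuous_at_imp_continuous_on has_vector_derivative_continuous)
  have b61: "bump 6 (2 ^ k * u) \<le> bump 1 u" for u
  proof -
    have "bump 6 (2 ^ k * u) \<le> bump 1 (2 ^ k * u)" by (rule bump_exponent_antimono) simp
    also have "\<dots> \<le> bump 1 u"
      by (rule bump_antimono) (simp add: abs_mult mult_le_cancel_right1)
    finally show ?thesis .
  qed
  have Kb1: "norm (K y) \<le> M0 * bump 1 (x - y)" for y
    by (rule order_trans[OF K_bound]) (intro mult_left_mono b61 nn)
  have Kb2: "norm (K y) \<le> M0 * bump 2 (2 ^ k * (x - y))" for y
    by (rule order_trans[OF K_bound]) (intro mult_left_mono bump_exponent_antimono nn, simp)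
  let ?b = "\<lambda>\<mu>. bump 4 (2 ^ k * (x - of_int \<mu> / 2 ^ N))"
  have "ennreal (norm (LINT y|lborel. G y * K y))
      \<le> (\<Sum>\<^sup>+\<mu>. ennreal (4 * h \<mu> * (M * (2 ^ 4 * ?b \<mu>)) / 4 ^ N))"
  proof (rule telescoping_integral_bound[where N = N and e = "\<lambda>\<mu>. d \<mu> * K (grid \<mu>)"])
    show "integrable lborel (\<lambda>y. G y * K y)"
      by (rule product_integrable[OF contK _ Kb2]) simp
    fix \<mu>
    show "norm ((LBINT y:dyadic_interval N \<mu>. G y * K y) - (d (\<mu> + 1) * K (grid (\<mu> + 1)) - d \<mu> * K (grid \<mu>)))
        \<le> 4 * h \<mu> * (M * (2 ^ 4 * ?b \<mu>)) / 4 ^ N"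
    proof (rule cell_estimate_smooth[OF K])
      fix y assume y: "grid \<mu> \<le> y" "y \<le> grid (\<mu> + 1)"
      have "\<bar>2 ^ k * (x - grid \<mu>) - 2 ^ k * (x - y)\<bar> = 2 ^ k * (y - grid \<mu>)"
        using y by (simp flip: right_diff_distrib)
      also have "\<dots> \<le> 2 ^ k * (1 / 2 ^ N)"
        using y grid_diff[of \<mu>] by (intro mult_left_mono) auto
      also have "\<dots> \<le> 1" using k by (simp add: power_increasing)
      finally have "bump 4 (2 ^ k * (x - y)) \<le> 2 ^ 4 * ?b \<mu>" by (rule bump_shift)
      moreover have "norm (K1 y) \<le> M * bump 4 (2 ^ k * (x - y))"
        by (rule order_trans[OF K1_bound]) (intro mult_left_mono bump_exponent_antimono nn, simp)
      ultimately show "norm (K1 y) \<le> M * (2 ^ 4 * ?b \<mu>)"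
        using nn by (meson mult_left_mono order_trans)
    qed
  next
    show "(\<lambda>n. d (int n * 2 ^ N) * K (grid (int n * 2 ^ N))) \<longlonglongrightarrow> 0"
      by (rule boundary_terms_vanish[OF Kb1, where z = 1]) auto
    show "(\<lambda>n. d (- int n * 2 ^ N) * K (grid (- int n * 2 ^ N))) \<longlonglongrightarrow> 0"
      by (rule boundary_terms_vanish[OF Kb1, where z = "-1"]) auto
  qed
  also have "\<dots> = (\<Sum>\<^sup>+\<mu>. ennreal (64 * M / 4 ^ N) * (ennreal (?b \<mu>) * ennreal (h \<mu>)))"
    using nn h_nonneg by (intro nn_integral_cong) (simp add: ennreal_mult[symmetric] mult.commute mult.left_commute)
  also have "\<dots> = ennreal (64 * M / 4 ^ N) * (\<Sum>\<^sup>+\<mu>. ennreal (?b \<mu>) * ennreal (h \<mu>))"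
    by (rule nn_integral_cmult) simp
  finally show ?thesis .
qed

text \<open>At finer scales the six orders of decay are split: four of them are weakened to the width of the
  cell and taken out of the integral, and two make the integral over the cell of size
  \<open>2 powr (- k)\<close>.\<close>

lemma integral_against_rough_kernel:
  assumes T: "\<And>y. (T has_vector_derivative K y) (at y)" and K: "continuous_on UNIV K" and k: "N \<le> k"
    and K_bound: "\<And>y. norm (K y) \<le> M0 * bump 6 (2 ^ k * (x - y))"
    and T_bound: "\<And>y. norm (T y) \<le> M * bump 6 (2 ^ k * (x - y))"
  shows "ennreal (norm (LINT y|lborel. G y * K y))
    \<le> ennreal (32 * M) * (\<Sum>\<^sup>+\<mu>. ennreal (bump 4 (2 ^ k * (x - of_int \<mu> / 2 ^ N)) +
        2 powr (real N - real k) * bump 4 (2 ^ N * (x - of_int \<mu> / 2 ^ N))) * ennreal (h \<mu>))"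
proof -
  have nn: "0 \<le> M0" "0 \<le> M"
    using order_trans[OF norm_ge_zero K_bound[of x]] order_trans[OF norm_ge_zero T_bound[of x]] bump_pos[of 6 0]
    by (simp_all add: zero_le_mult_iff)
  have Kb2: "norm (K y) \<le> M0 * bump 2 (2 ^ k * (x - y))" for y
    by (rule order_trans[OF K_bound]) (intro mult_left_mono bump_exponent_antimono nn, simp)
  define b where "b \<mu> = bump 4 (2 ^ k * (x - grid \<mu>))" for \<mu>
  define b' where "b' \<mu> = bump 4 (2 ^ N * (x - grid \<mu>))" for \<mu>
  have b0: "0 \<le> b \<mu>" "0 \<le> b' \<mu>" for \<mu> by (simp_all add: b_def b'_def)
  have Tb: "norm (T (grid \<mu>)) \<le> M * b \<mu>" for \<mu>
    unfolding b_def by (rule order_trans[OF T_bound]) (intro mult_left_mono bump_exponent_antimono nn, simp)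
  define q where "q = 2 ^ N * (2 / 2 ^ k :: real)"
  have q: "0 \<le> q" "q = 2 * 2 powr (real N - real k)"
    by (simp_all add: q_def powr_diff powr_realpow)
  have "ennreal (norm (LINT y|lborel. G y * K y))
      \<le> (\<Sum>\<^sup>+\<mu>. ennreal (3 * h (\<mu> + 1) * (M * b (\<mu> + 1)) + (3 * h \<mu> * (M * b \<mu>) + 16 * M * q * h \<mu> * b' \<mu>)))"
  proof (rule telescoping_integral_bound[where N = N and e = "\<lambda>\<mu>. 0"])
    show "integrable lborel (\<lambda>y. G y * K y)"
      by (rule product_integrable[OF K _ Kb2]) simp
    fix \<mu>
    have "norm (LBINT y:dyadic_interval N \<mu>. G y * K y)
        \<le> 3 * h (\<mu> + 1) * norm (T (grid (\<mu> + 1))) + 3 * h \<mu> * norm (T (grid \<mu>)) + 2 ^ N * h \<mu> * (M * (16 * b' \<mu>)) * (2 / 2 ^ k)"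
    proof (rule cell_estimate_rough[OF T K])
      fix y assume y: "grid \<mu> \<le> y" "y \<le> grid (\<mu> + 1)"
      have "\<bar>2 ^ N * (x - grid \<mu>) - 2 ^ N * (x - y)\<bar> = 2 ^ N * (y - grid \<mu>)"
        using y by (simp flip: right_diff_distrib)
      also have "\<dots> \<le> 2 ^ N * (1 / 2 ^ N)"
        using y grid_diff[of \<mu>] by (intro mult_left_mono) auto
      finally have sh: "bump 4 (2 ^ N * (x - y)) \<le> 2 ^ 4 * b' \<mu>"
        unfolding b'_def by (intro bump_shift) simp
      have "bump 6 (2 ^ k * (x - y)) = bump 4 (2 ^ k * (x - y)) * bump 2 (2 ^ k * (x - y))"
        using bump_add[of 4 2] by simp
      also have "\<dots> \<le> bump 4 (2 ^ N * (x - y)) * bump 2 (2 ^ k * (x - y))"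
        using k by (intro mult_right_mono bump_antimono) (auto simp: abs_mult intro!: mult_right_mono power_increasing)
      also have "\<dots> \<le> 16 * b' \<mu> * bump 2 (2 ^ k * (x - y))"
        using sh by (intro mult_right_mono) auto
      finally have "M * bump 6 (2 ^ k * (x - y)) \<le> M * (16 * b' \<mu> * bump 2 (2 ^ k * (x - y)))"
        by (intro mult_left_mono nn)
      then show "norm (T y) \<le> M * (16 * b' \<mu>) * bump 2 (2 ^ k * (x - y))"
        using T_bound[of y] by (simp add: mult.assoc)
    qed (use nn b0 in auto)
    also have "\<dots> \<le> 3 * h (\<mu> + 1) * (M * b (\<mu> + 1)) + (3 * h \<mu> * (M * b \<mu>) + 16 * M * q * h \<mu> * b' \<mu>)"
    proof -
      have "3 * h (\<mu> + 1) * norm (T (grid (\<mu> + 1))) \<le> 3 * h (\<mu> + 1) * (M * b (\<mu> + 1))"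
        "3 * h \<mu> * norm (T (grid \<mu>)) \<le> 3 * h \<mu> * (M * b \<mu>)"
        using h_nonneg by (intro mult_left_mono Tb; simp)+
      moreover have "2 ^ N * h \<mu> * (M * (16 * b' \<mu>)) * (2 / 2 ^ k) = 16 * M * q * h \<mu> * b' \<mu>"
        unfolding q_def by (simp only: ac_simps)
      ultimately show ?thesis by linarith
    qed
    finally show "norm ((LBINT y:dyadic_interval N \<mu>. G y * K y) - (0 - 0))
        \<le> 3 * h (\<mu> + 1) * (M * b (\<mu> + 1)) + (3 * h \<mu> * (M * b \<mu>) + 16 * M * q * h \<mu> * b' \<mu>)" by simp
  qed simp_all
  also have "\<dots> = (\<Sum>\<^sup>+\<mu>. ennreal (3 * h (\<mu> + 1) * (M * b (\<mu> + 1))))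
      + (\<Sum>\<^sup>+\<mu>. ennreal (3 * h \<mu> * (M * b \<mu>) + 16 * M * q * h \<mu> * b' \<mu>))"
    using nn h_nonneg b0 q(1) by (simp add: nn_integral_add)
  also have "(\<Sum>\<^sup>+\<mu>. ennreal (3 * h (\<mu> + 1) * (M * b (\<mu> + 1)))) = (\<Sum>\<^sup>+\<mu>. ennreal (3 * h \<mu> * (M * b \<mu>)))"
    by (rule sum_int_shift[of "\<lambda>\<mu>. ennreal (3 * h \<mu> * (M * b \<mu>))"])
  also have "\<dots> + (\<Sum>\<^sup>+\<mu>. ennreal (3 * h \<mu> * (M * b \<mu>) + 16 * M * q * h \<mu> * b' \<mu>))
      = (\<Sum>\<^sup>+\<mu>. ennreal (3 * h \<mu> * (M * b \<mu>)) + ennreal (3 * h \<mu> * (M * b \<mu>) + 16 * M * q * h \<mu> * b' \<mu>))"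
    by (rule nn_integral_add[symmetric]) auto
  also have "\<dots> \<le> (\<Sum>\<^sup>+\<mu>. ennreal (32 * M) * (ennreal (b \<mu> + 2 powr (real N - real k) * b' \<mu>) * ennreal (h \<mu>)))"
  proof (intro nn_integral_mono)
    fix \<mu>
    have p0: "0 \<le> M * b \<mu> * h \<mu>" using nn b0 h_nonneg by simp
    have "3 * h \<mu> * (M * b \<mu>) + (3 * h \<mu> * (M * b \<mu>) + 16 * M * q * h \<mu> * b' \<mu>)
        = 6 * (M * b \<mu> * h \<mu>) + 32 * M * (2 powr (real N - real k) * b' \<mu> * h \<mu>)"
      by (simp add: q(2))
    also have "\<dots> \<le> 32 * M * ((b \<mu> + 2 powr (real N - real k) * b' \<mu>) * h \<mu>)"
      using p0 by (simp add: algebra_simps)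
    finally show "ennreal (3 * h \<mu> * (M * b \<mu>)) + ennreal (3 * h \<mu> * (M * b \<mu>) + 16 * M * q * h \<mu> * b' \<mu>)
        \<le> ennreal (32 * M) * (ennreal (b \<mu> + 2 powr (real N - real k) * b' \<mu>) * ennreal (h \<mu>))"
      using nn h_nonneg b0 q(1)
      by (simp add: ennreal_mult[symmetric] ennreal_plus[symmetric] ennreal_leI del: ennreal_plus)
  qed
  also have "\<dots> = ennreal (32 * M) * (\<Sum>\<^sup>+\<mu>. ennreal (b \<mu> + 2 powr (real N - real k) * b' \<mu>) * ennreal (h \<mu>))"
    by (rule nn_integral_cmult) simp
  finally show ?thesis unfolding b_def b'_def .
qed

lemma LP_block_borel:
  assumes "continuous_on UNIV (inv_fourier (resolution \<phi>0 k))"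
  shows "LP_block \<phi>0 k (distr_of G) \<in> borel_measurable borel"
proof -
  have [measurable]: "inv_fourier (resolution \<phi>0 k) \<in> borel_measurable borel"
    by (rule borel_measurable_continuous_onI[OF assms])
  show ?thesis
    unfolding LP_block_def distr_of_def by measurable
qed

end

section \<open>Sums of translates and the wavelet profiles\<close>

definition translate_sum :: "(int \<Rightarrow> complex) \<Rightarrow> (real \<Rightarrow> complex) \<Rightarrow> real \<Rightarrow> real \<Rightarrow> complex" where
  "translate_sum l \<theta> b y = (\<Sum>\<^sub>\<infinity>\<nu>. l \<nu> * \<theta> (b * y - of_int \<nu>))"

lemma finite_window:
  fixes z R :: real
  shows "finite {\<nu>::int. \<bar>z - of_int \<nu>\<bar> \<le> R}"
proof (cases "0 \<le> R")
  case True
  have "{\<nu>::int. \<bar>z - of_int \<nu>\<bar> \<le> R} = {\<nu>. \<bar>1 * of_int \<nu> - z\<bar> \<le> R}"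
    by (simp add: abs_minus_commute)
  then show ?thesis using card_int_near(1)[of 1 R z] True by simp
next
  case False
  then have "{\<nu>::int. \<bar>z - of_int \<nu>\<bar> \<le> R} = {}" by auto
  then show ?thesis by simp
qed

lemma translate_sum_finite:
  assumes "finite W" "\<And>\<nu>. \<bar>b * y - of_int \<nu>\<bar> \<le> R \<Longrightarrow> \<nu> \<in> W" "supported_in R \<theta>"
  shows "translate_sum l \<theta> b y = (\<Sum>\<nu>\<in>W. l \<nu> * \<theta> (b * y - of_int \<nu>))"
proof -
  have "translate_sum l \<theta> b y = (\<Sum>\<^sub>\<infinity>\<nu>\<in>W. l \<nu> * \<theta> (b * y - of_int \<nu>))"
    unfolding translate_sum_def
  proof (rule infsum_cong_neutral)
    fix \<nu> assume "\<nu> \<in> UNIV - W"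
    then have "R < \<bar>b * y - of_int \<nu>\<bar>" using assms(2) not_le by blast
    then show "l \<nu> * \<theta> (b * y - of_int \<nu>) = 0" using assms(3) by (simp add: supported_in_def)
  qed auto
  then show ?thesis using assms(1) by simp
qed

lemma translate_sum_bound:
  assumes "finite W" "\<And>\<nu>. \<bar>b * y - of_int \<nu>\<bar> \<le> R \<Longrightarrow> \<nu> \<in> W" "supported_in R \<theta>" "\<And>u. norm (\<theta> u) \<le> M"
  shows "norm (translate_sum l \<theta> b y) \<le> M * (\<Sum>\<nu>\<in>W. norm (l \<nu>))"
proof -
  have "translate_sum l \<theta> b y = (\<Sum>\<nu>\<in>W. l \<nu> * \<theta> (b * y - of_int \<nu>))"
    by (rule translate_sum_finite[OF assms(1) _ assms(3)]) (rule assms(2))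
  then have "norm (translate_sum l \<theta> b y) \<le> (\<Sum>\<nu>\<in>W. norm (l \<nu> * \<theta> (b * y - of_int \<nu>)))"
    using norm_sum by metis
  also have "\<dots> \<le> (\<Sum>\<nu>\<in>W. M * norm (l \<nu>))"
    by (intro sum_mono) (simp add: norm_mult mult.commute[of M] mult_left_mono assms(4))
  finally show ?thesis by (simp add: sum_distrib_left)
qed

text \<open>The finite index set is the same for all points near \<open>y\<close>, so that continuity and derivatives
  pass from the profile to the sum.\<close>

lemma translate_sum_local:
  assumes b: "0 < b" and z: "z \<in> ball y (1 / b)" and supp: "supported_in R \<theta>"
  shows "translate_sum l \<theta> b z = (\<Sum>\<nu> | \<bar>b * y - of_int \<nu>\<bar> \<le> R + 1. l \<nu> * \<theta> (b * z - of_int \<nu>))"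
proof -
  have "b * \<bar>y - z\<bar> \<le> b * (1 / b)"
    using z b by (intro mult_left_mono) (auto simp: dist_real_def)
  then have "\<bar>b * y - b * z\<bar> \<le> 1"
    using b by (simp add: abs_mult flip: right_diff_distrib)
  then show ?thesis
    by (intro translate_sum_finite[OF finite_window _ supp]) auto
qed

lemma translate_sum_deriv:
  assumes b: "0 < b" and supp: "supported_in R \<theta>" "supported_in R \<theta>'"
    and \<theta>: "\<And>u. (\<theta> has_vector_derivative \<theta>' u) (at u)"
  shows "(translate_sum l \<theta> b has_vector_derivative b *\<^sub>R translate_sum l \<theta>' b y) (at y)"
proof -
  let ?W = "{\<nu>::int. \<bar>b * y - of_int \<nu>\<bar> \<le> R + 1}"
  note eq = translate_sum_local[OF b]
  have y: "y \<in> ball y (1 / b)" using b by simp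
  have summand: "((\<lambda>z. l \<nu> * \<theta> (b * z - of_int \<nu>)) has_vector_derivative l \<nu> * (b *\<^sub>R \<theta>' (b * y - of_int \<nu>))) (at y)" for \<nu>
  proof -
    have "((\<lambda>z. b * z - of_int \<nu>) has_vector_derivative b) (at y)"
      by (auto simp: has_vector_derivative_def mult.commute intro!: derivative_eq_intros)
    from vector_diff_chain_at[OF this \<theta>]
    have "((\<lambda>z. \<theta> (b * z - of_int \<nu>)) has_vector_derivative b *\<^sub>R \<theta>' (b * y - of_int \<nu>)) (at y)"
      by (simp add: o_def)
    then show ?thesis by (rule bounded_linear.has_vector_derivative[OF bounded_linear_mult_right])
  qed
  have "((\<lambda>z. \<Sum>\<nu>\<in>?W. l \<nu> * \<theta> (b * z - of_int \<nu>)) has_vector_derivative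
      (\<Sum>\<nu>\<in>?W. l \<nu> * (b *\<^sub>R \<theta>' (b * y - of_int \<nu>)))) (at y)"
    by (rule has_vector_derivative_sum) (rule summand)
  also have "(\<Sum>\<nu>\<in>?W. l \<nu> * (b *\<^sub>R \<theta>' (b * y - of_int \<nu>))) = b *\<^sub>R translate_sum l \<theta>' b y"
    by (simp add: eq[OF y supp(2)] scaleR_sum_right)
  finally show ?thesis
    by (rule has_vector_derivative_transform_within_open[OF _ open_ball y])
      (simp add: eq[OF _ supp(1)])
qed

lemma translate_sum_cont:
  assumes b: "0 < b" and supp: "supported_in R \<theta>" and cont: "continuous_on UNIV \<theta>"
  shows "continuous_on UNIV (translate_sum l \<theta> b)"
proof (rule continuous_at_imp_continuous_on, rule ballI)
  fix y :: real
  let ?W = "{\<nu>::int. \<bar>b * y - of_int \<nu>\<bar> \<le> R + 1}"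
  note eq = translate_sum_local[OF b]
  have "continuous_on (ball y (1 / b)) (\<lambda>z. \<Sum>\<nu>\<in>?W. l \<nu> * \<theta> (b * z - of_int \<nu>))"
    by (intro continuous_intros continuous_on_compose2[OF cont]) auto
  then have "continuous_on (ball y (1 / b)) (translate_sum l \<theta> b)"
    by (rule continuous_on_eq) (simp add: eq[OF _ supp])
  then show "isCont (translate_sum l \<theta> b) y"
    using b by (simp add: continuous_on_eq_continuous_at)
qed

text \<open>The factor \<open>1 / sqrt 2\<close> is the normalization of the wavelets of level \<open>j \<ge> 1\<close>; with it,
  all blocks are sums of translates of a profile dilated by \<open>2 ^ (j - 1)\<close>.\<close>

definition profile :: "(real \<Rightarrow> real) \<Rightarrow> (real \<Rightarrow> real) \<Rightarrow> nat \<Rightarrow> real \<Rightarrow> complex" where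
  "profile \<psi>0 \<psi> j u = of_real (if j = 0 then \<psi>0 u else 1 / sqrt 2 * \<psi> u)"

lemma wavelet_block_eq:
  "wavelet_block \<psi>0 \<psi> j f = translate_sum (\<lambda>\<nu>. wavelet_coeff \<psi>0 \<psi> j \<nu> f) (profile \<psi>0 \<psi> j) (2 ^ (j - 1))"
  by (cases "j = 0") (simp_all add: fun_eq_iff wavelet_block_def translate_sum_def profile_def wavelet_def)

lemma C1_function:
  fixes g :: "real \<Rightarrow> real"
  assumes "C_k K g" "1 \<le> K" "supported_in R g"
  obtains g' M where "\<And>u. (g has_real_derivative g' u) (at u)" "continuous_on UNIV g'" "supported_in R g'"
    "0 \<le> M" "\<And>u. \<bar>g u\<bar> \<le> M" "\<And>u. \<bar>g' u\<bar> \<le> M"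
proof -
  define g' where "g' = iter_deriv 1 g"
  have "iter_deriv 0 g differentiable (at u)" for u
    using assms(1,2) unfolding C_k_def by (metis less_eq_Suc_le One_nat_def)
  then have d: "(g has_real_derivative g' u) (at u)" for u
    using vector_derivative_works[of g "at u"] by (simp add: g'_def has_real_derivative_iff_has_vector_derivative)
  have cont: "continuous_on UNIV g'"
  proof (cases "K = 1")
    case True
    then show ?thesis using assms(1) by (simp add: C_k_def g'_def)
  next
    case False
    then have "iter_deriv 1 g differentiable (at u)" for u
      using assms(1,2) unfolding C_k_def by (metis nat_less_le)
    then show ?thesis
      unfolding g'_def by (intro continuous_at_imp_continuous_on ballI differentiable_imp_continuous_within) auto
  qed
  have supp: "supported_in R g'"
    unfolding supported_in_def
  proof (intro allI impI)
    fix u :: real assume u: "R < \<bar>u\<bar>"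
    have "open {x::real. R < \<bar>x\<bar>}" by (intro open_Collect_less continuous_intros)
    then have "(g has_real_derivative 0) (at u)"
      using u assms(3)
      by (intro has_field_derivative_transform_within_open[OF DERIV_const[of 0], where S = "{x. R < \<bar>x\<bar>}"])
        (auto simp: supported_in_def)
    then show "g' u = 0" using d DERIV_unique by blast
  qed
  have bd: "\<exists>B. \<forall>u. \<bar>k u\<bar> \<le> B" if "continuous_on UNIV k" "supported_in R k" for k :: "real \<Rightarrow> real"
  proof -
    have "compact (k ` {-R..R})"
      by (intro compact_continuous_image continuous_on_subset[OF that(1)]) auto
    then obtain B where B: "\<forall>v\<in>k ` {-R..R}. norm v \<le> B"
      using compact_imp_bounded bounded_iff by metis
    have "\<bar>k u\<bar> \<le> max B 0" for u
      using B that(2) by (cases "\<bar>u\<bar> \<le> R") (auto simp: supported_in_def abs_le_iff le_max_iff_disj)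
    then show ?thesis by blast
  qed
  have "continuous_on UNIV g"
    using d by (intro continuous_at_imp_continuous_on ballI) (auto intro: DERIV_isCont)
  from bd[OF this assms(3)] bd[OF cont supp]
  obtain B1 B2 where B: "\<And>u. \<bar>g u\<bar> \<le> B1" "\<And>u. \<bar>g' u\<bar> \<le> B2" by blast
  show thesis
  proof (rule that[OF d cont supp])
    show "0 \<le> max 0 (max B1 B2)" by simp
    show "\<bar>g u\<bar> \<le> max 0 (max B1 B2)" "\<bar>g' u\<bar> \<le> max 0 (max B1 B2)" for u
      using B[of u] by auto
  qed
qed

text \<open>The vanishing integral makes the primitive return to zero on the right of the support.\<close>

lemma compact_primitive:
  fixes g :: "real \<Rightarrow> real"
  assumes cont: "continuous_on UNIV g" and supp: "supported_in R g" and M: "\<And>u. \<bar>g u\<bar> \<le> M" and R: "0 \<le> R"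
    and mean0: "(LINT x|lborel. g x) = 0"
  obtains G :: "real \<Rightarrow> complex" where "\<And>u. (G has_vector_derivative of_real (g u)) (at u)" "supported_in R G"
    "\<And>u. norm (G u) \<le> 2 * M * R"
proof -
  have "continuous_on UNIV (\<lambda>u. complex_of_real (g u))" by (intro continuous_intros cont)
  then obtain G0 where G0: "\<And>u. (G0 has_vector_derivative complex_of_real (g u)) (at u)"
    using continuous_antiderivative by blast
  define G where "G u = G0 u - G0 (- R)" for u
  have G: "(G has_vector_derivative of_real (g u)) (at u)" for u
    unfolding G_def by (auto intro!: derivative_eq_intros G0)
  have z: "g u = 0" if "R < \<bar>u\<bar>" for u using supp that by (simp add: supported_in_def)
  \<comment> \<open>The support condition says nothing at the points \<open>R\<close> and \<open>- R\<close> themselves; continuity does.\<close>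
  have gR: "g R = 0 \<and> g (- R) = 0"
  proof -
    have "(g \<longlongrightarrow> g R) (at_right R)" "(g \<longlongrightarrow> g (- R)) (at_left (- R))"
      using cont by (auto simp: continuous_on_def intro: tendsto_within_subset)
    moreover have "(g \<longlongrightarrow> 0) (at_right R)" "(g \<longlongrightarrow> 0) (at_left (- R))"
      using R by (auto intro!: tendsto_eventually simp: eventually_at_filter z)
    ultimately show ?thesis by (metis tendsto_unique trivial_limit_at_right_real trivial_limit_at_left_real)
  qed
  have const: "G v = G u" if "\<And>w. w \<in> closed_segment u v \<Longrightarrow> g w = 0" for u v
    using norm_increment_le[OF G, of u v 0] that by simp
  have total: "G R = G (- R)"
  proof -
    have "(LBINT x:{-R..R}. complex_of_real (g x)) = G R - G (- R)"
      unfolding set_lebesgue_integral_def using R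
      by (intro integral_FTC_atLeastAtMost has_vector_derivative_at_within[OF G])
        (auto intro!: continuous_intros continuous_on_subset[OF cont])
    moreover have "(LBINT x:{-R..R}. complex_of_real (g x)) = (LINT x|lborel. complex_of_real (g x))"
      unfolding set_lebesgue_integral_def by (intro Bochner_Integration.integral_cong) (auto simp: indicator_def z)
    ultimately show ?thesis using mean0 by simp
  qed
  have G0R: "G (- R) = 0" by (simp add: G_def)
  have supG: "supported_in R G"
    unfolding supported_in_def
  proof (intro allI impI)
    fix u :: real assume u: "R < \<bar>u\<bar>"
    show "G u = 0"
    proof (cases "0 \<le> u")
      case True
      have "g w = 0" if "w \<in> closed_segment R u" for w
        using that u True R gR z[of w] by (cases "w = R") (auto simp: closed_segment_eq_real_ivl split: if_splits)
      then have "G u = G R" by (rule const)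
      then show ?thesis using total G0R by simp
    next
      case False
      have "g w = 0" if "w \<in> closed_segment (- R) u" for w
        using that u False R gR z[of w] by (cases "w = - R") (auto simp: closed_segment_eq_real_ivl split: if_splits)
      then have "G u = G (- R)" by (rule const)
      then show ?thesis using G0R by simp
    qed
  qed
  have M0: "0 \<le> M" using order_trans[OF abs_ge_zero M] .
  have "norm (G u) \<le> 2 * M * R" for u
  proof (cases "\<bar>u\<bar> \<le> R")
    case True
    have "norm (G u - G (- R)) \<le> M * \<bar>u - (- R)\<bar>"
      using M by (intro norm_increment_le[OF G]) simp
    also have "\<dots> \<le> M * (2 * R)" using True M0 by (intro mult_left_mono) auto
    finally show ?thesis using G0R by simp
  next
    case False
    then show ?thesis using supG M0 R by (simp add: supported_in_def)
  qed
  then show thesis using that G supG by blast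
qed

text \<open>The wavelet system enters through the smoothness of its profiles, which bounds the derivatives of
  coarse blocks, and through the vanishing integral of the wavelet, which provides the compactly
  supported primitive \<open>\<Psi>\<close> for the fine ones.\<close>

lemma profile_bounds:
  assumes "daubechies_system K L \<psi>0 \<psi>" "1 \<le> K" "1 \<le> L"
  obtains R M :: real and \<theta>' :: "nat \<Rightarrow> real \<Rightarrow> complex" and \<Psi> :: "real \<Rightarrow> complex"
  where "0 \<le> R" "0 < M"
    "\<And>j. supported_in R (profile \<psi>0 \<psi> j)" "\<And>j. supported_in R (\<theta>' j)" "supported_in R \<Psi>"
    "\<And>j u. (profile \<psi>0 \<psi> j has_vector_derivative \<theta>' j u) (at u)" "\<And>j. continuous_on UNIV (\<theta>' j)"
    "\<And>j u. 0 < j \<Longrightarrow> (\<Psi> has_vector_derivative profile \<psi>0 \<psi> j u) (at u)"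
    "\<And>j u. norm (\<theta>' j u) \<le> M" "\<And>u. norm (\<Psi> u) \<le> M"
proof -
  obtain R0 R1 where R01: "supported_in R0 \<psi>0" "supported_in R1 \<psi>"
    using assms(1) unfolding daubechies_system_def by blast
  define R where "R = max 0 (max R0 R1)"
  have R: "0 \<le> R" "supported_in R \<psi>0" "supported_in R \<psi>"
    using R01 by (auto simp: R_def supported_in_def)
  have Ck: "C_k K \<psi>0" "C_k K \<psi>" and moments: "\<forall>n<L. (LINT x|lborel. x ^ n * \<psi> x) = 0"
    using assms(1) unfolding daubechies_system_def by blast+
  have mean0: "(LINT x|lborel. \<psi> x) = 0"
    using moments[rule_format, of 0] assms(3) by simp
  obtain g0 M0 where g0: "\<And>u. (\<psi>0 has_real_derivative g0 u) (at u)" "continuous_on UNIV g0" "supported_in R g0"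
    "0 \<le> M0" "\<And>u. \<bar>\<psi>0 u\<bar> \<le> M0" "\<And>u. \<bar>g0 u\<bar> \<le> M0"
    using C1_function[OF Ck(1) assms(2) R(2)] by metis
  obtain g1 M1 where g1: "\<And>u. (\<psi> has_real_derivative g1 u) (at u)" "continuous_on UNIV g1" "supported_in R g1"
    "0 \<le> M1" "\<And>u. \<bar>\<psi> u\<bar> \<le> M1" "\<And>u. \<bar>g1 u\<bar> \<le> M1"
    using C1_function[OF Ck(2) assms(2) R(3)] by metis
  have contpsi: "continuous_on UNIV \<psi>"
    using g1(1) by (intro continuous_at_imp_continuous_on ballI) (auto intro: DERIV_isCont)
  obtain \<Psi>0 :: "real \<Rightarrow> complex" where P0: "\<And>u. (\<Psi>0 has_vector_derivative of_real (\<psi> u)) (at u)" "supported_in R \<Psi>0"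
    "\<And>u. norm (\<Psi>0 u) \<le> 2 * M1 * R"
    using compact_primitive[OF contpsi R(3) g1(5) R(1) mean0] by metis
  define \<theta>' where "\<theta>' j u = complex_of_real (if j = 0 then g0 u else 1 / sqrt 2 * g1 u)" for j :: nat and u
  define \<Psi> where "\<Psi> u = complex_of_real (1 / sqrt 2) * \<Psi>0 u" for u
  have s2: "1 / sqrt 2 * x \<le> x" if "0 \<le> x" for x :: real
    using mult_right_mono[of "1 / sqrt 2" 1 x] that by (simp add: divide_le_eq)
  have up: "(f has_real_derivative f') (at u) \<Longrightarrow> ((\<lambda>u. complex_of_real (f u)) has_vector_derivative complex_of_real f') (at u)"
    for f :: "real \<Rightarrow> real" and f' u
    by (simp add: has_vector_derivative_of_real has_real_derivative_iff_has_vector_derivative)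
  show thesis
  proof (rule that[of R "M0 + M1 + 2 * M1 * R + 1" \<theta>' \<Psi>])
    show "0 \<le> R" "0 < M0 + M1 + 2 * M1 * R + 1" using R g0(4) g1(4) by (auto intro!: add_nonneg_pos add_nonneg_nonneg)
    show "supported_in R (profile \<psi>0 \<psi> j)" "supported_in R (\<theta>' j)" "supported_in R \<Psi>" for j
      using R g0(3) g1(3) P0(2) by (auto simp: supported_in_def profile_def \<theta>'_def \<Psi>_def)
    show "(profile \<psi>0 \<psi> j has_vector_derivative \<theta>' j u) (at u)" for j u
      unfolding profile_def[abs_def] \<theta>'_def
      by (cases "j = 0") (simp_all only: if_True if_False, auto intro!: up g0 g1 DERIV_cdivide simp del: of_real_mult of_real_divide)
    show "continuous_on UNIV (\<theta>' j)" for j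
      unfolding \<theta>'_def using g0(2) g1(2) by (cases "j = 0") (auto intro!: continuous_intros)
    show "(\<Psi> has_vector_derivative profile \<psi>0 \<psi> j u) (at u)" if "0 < j" for j u
      using has_vector_derivative_mult_right[OF P0(1), of "complex_of_real (1 / sqrt 2)" u] that
      by (simp add: \<Psi>_def[abs_def] profile_def)
    show "norm (\<theta>' j u) \<le> M0 + M1 + 2 * M1 * R + 1" for j u
    proof -
      have "norm (\<theta>' j u) \<le> max \<bar>g0 u\<bar> (1 / sqrt 2 * \<bar>g1 u\<bar>)"
        by (simp add: \<theta>'_def abs_mult norm_divide)
      also have "\<dots> \<le> M0 + M1" using g0(4) g0(6)[of u] g1(4) g1(6)[of u] s2[of "\<bar>g1 u\<bar>"] by auto
      also have "\<dots> \<le> M0 + M1 + 2 * M1 * R + 1" using g1(4) R(1) by simp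
      finally show ?thesis .
    qed
    show "norm (\<Psi> u) \<le> M0 + M1 + 2 * M1 * R + 1" for u
    proof -
      have "norm (\<Psi> u) \<le> norm (\<Psi>0 u)" using s2[of "norm (\<Psi>0 u)"] by (simp add: \<Psi>_def norm_mult norm_divide)
      then show ?thesis using P0(3)[of u] g0(4) g1(4) by linarith
    qed
  qed
qed

section \<open>The remainder of the wavelet expansion\<close>

definition coeff_size :: "(real \<Rightarrow> real) \<Rightarrow> (real \<Rightarrow> real) \<Rightarrow> distribution \<Rightarrow> nat \<times> int \<Rightarrow> ennreal" where
  "coeff_size \<psi>0 \<psi> f = (\<lambda>(j, \<nu>). ennreal (norm (wavelet_coeff \<psi>0 \<psi> j \<nu> f)))"

lemma cell_majorant_series:
  fixes l :: "nat \<Rightarrow> int \<Rightarrow> real"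
  assumes \<rho>: "0 \<le> \<rho>" and l: "\<And>j \<nu>. 0 \<le> l j \<nu>" and fin: "cell_majorant \<rho> N (\<lambda>(j, \<nu>). ennreal (l j \<nu>)) \<mu> < \<infinity>"
  shows "(\<lambda>j. 2 powr (- \<bar>real j - real N\<bar>) * (\<Sum>\<nu> | near \<rho> N \<mu> j \<nu>. l j \<nu>))
    sums enn2real (cell_majorant \<rho> N (\<lambda>(j, \<nu>). ennreal (l j \<nu>)) \<mu>)"
proof -
  let ?x = "\<lambda>j. 2 powr (- \<bar>real j - real N\<bar>) * (\<Sum>\<nu> | near \<rho> N \<mu> j \<nu>. l j \<nu>)"
  have x0: "0 \<le> ?x j" for j by (intro mult_nonneg_nonneg sum_nonneg l) auto
  have inner: "(\<Sum>\<^sup>+\<nu>. ennreal w * indicator {\<nu>. near \<rho> N \<mu> j \<nu>} \<nu> * ennreal (l j \<nu>))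
      = ennreal (w * (\<Sum>\<nu> | near \<rho> N \<mu> j \<nu>. l j \<nu>))" if "0 \<le> w" for w j
  proof -
    have "(\<Sum>\<^sup>+\<nu>. ennreal w * indicator {\<nu>. near \<rho> N \<mu> j \<nu>} \<nu> * ennreal (l j \<nu>))
        = (\<Sum>\<nu> | near \<rho> N \<mu> j \<nu>. ennreal w * indicator {\<nu>. near \<rho> N \<mu> j \<nu>} \<nu> * ennreal (l j \<nu>))"
      by (rule nn_integral_count_space') (auto simp: near_row[OF \<rho>])
    also have "\<dots> = (\<Sum>\<nu> | near \<rho> N \<mu> j \<nu>. ennreal (w * l j \<nu>))"
      using that l by (intro sum.cong) (auto simp: ennreal_mult)
    also have "\<dots> = ennreal (w * (\<Sum>\<nu> | near \<rho> N \<mu> j \<nu>. l j \<nu>))"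
      using that l by (subst sum_ennreal) (auto simp: sum_distrib_left)
    finally show ?thesis .
  qed
  have eq: "cell_majorant \<rho> N (\<lambda>(j, \<nu>). ennreal (l j \<nu>)) \<mu> = (\<Sum>j. ennreal (?x j))"
    unfolding cell_majorant_def by (simp add: sum_pairs inner)
  then have ne: "(\<Sum>j. ennreal (?x j)) \<noteq> top" using fin by auto
  have "summable ?x" by (rule summable_suminf_not_top[OF x0 ne])
  moreover have "enn2real (cell_majorant \<rho> N (\<lambda>(j, \<nu>). ennreal (l j \<nu>)) \<mu>) = (\<Sum>j. ?x j)"
    unfolding eq suminf_ennreal[OF x0 ne] using x0 by (simp add: suminf_nonneg[OF \<open>summable ?x\<close>])
  ultimately show ?thesis by (simp add: summable_sums)
qed

text \<open>The primitive \<open>D j\<close> of a block of level \<open>j > N\<close> is again a sum of translates, of the compactly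
  supported \<open>\<Psi>\<close>; so at a grid point it involves only nearby coefficients, with a factor of size
  \<open>2 powr (- j)\<close>. The sum of these over the tail is \<open>d\<close>. The blocks of level
  \<open>j \<le> N\<close> make up \<open>P\<close>, and their derivatives are of size \<open>2 ^ j\<close>.\<close>

lemma wavelet_remainder:
  fixes f :: distribution and N :: nat
  assumes R: "0 \<le> R" and M: "0 < M"
    and supp: "\<And>j. supported_in R (profile \<psi>0 \<psi> j)" "\<And>j. supported_in R (\<theta>' j)" "supported_in R \<Psi>"
    and \<theta>': "\<And>j u. (profile \<psi>0 \<psi> j has_vector_derivative \<theta>' j u) (at u)" "\<And>j. continuous_on UNIV (\<theta>' j)"
    and \<Psi>: "\<And>j u. 0 < j \<Longrightarrow> (\<Psi> has_vector_derivative profile \<psi>0 \<psi> j u) (at u)"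
    and bound: "\<And>j u. norm (\<theta>' j u) \<le> M" "\<And>u. norm (\<Psi> u) \<le> M"
    and S: "0 \<le> S" "\<And>\<mu>. cell_majorant (R + 1) N (coeff_size \<psi>0 \<psi> f) \<mu> \<le> ennreal S"
  obtains d P' Q where "dyadic_remainder N (\<lambda>\<mu>. 2 ^ N * distr_integral \<psi>0 \<psi> (dyadic_interval N \<mu>) f) d
    (partial_sum_op \<psi>0 \<psi> N f) P' Q (\<lambda>\<mu>. 2 * M * enn2real (cell_majorant (R + 1) N (coeff_size \<psi>0 \<psi> f) \<mu>)) (2 * M * S)"
proof -
  define l where "l j = (\<lambda>\<nu>. wavelet_coeff \<psi>0 \<psi> j \<nu> f)" for j
  define b :: "nat \<Rightarrow> real" where "b j = 2 ^ (j - 1)" for j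
  have b0: "0 < b j" for j by (simp add: b_def)
  define w where "w j = 2 powr (- \<bar>real j - real N\<bar>)" for j
  define a where "a j \<mu> = (\<Sum>\<nu> | near (R + 1) N \<mu> j \<nu>. norm (l j \<nu>))" for j \<mu>
  define g where "g \<mu> = enn2real (cell_majorant (R + 1) N (coeff_size \<psi>0 \<psi> f) \<mu>)" for \<mu>
  have a0: "0 \<le> a j \<mu>" for j \<mu> unfolding a_def by (rule sum_nonneg) simp
  have w0: "0 \<le> w j" for j by (simp add: w_def)
  have gs: "(\<lambda>j. w j * a j \<mu>) sums g \<mu>" for \<mu>
  proof -
    have "coeff_size \<psi>0 \<psi> f = (\<lambda>(j, \<nu>). ennreal (norm (l j \<nu>)))"
      by (simp add: coeff_size_def l_def)
    then show ?thesis
      unfolding w_def a_def g_def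
      using cell_majorant_series[of "R + 1" "\<lambda>j \<nu>. norm (l j \<nu>)" N \<mu>] R le_less_trans[OF S(2)[of \<mu>]] by simp
  qed
  have finW: "finite {\<nu>. near (R + 1) N \<mu> j \<nu>}" for \<mu> j using R by (intro near_row) simp
  have w_low: "2 ^ j = 2 ^ N * w j" if "j \<le> N" for j
    using that by (simp add: w_def powr_minus powr_realpow[symmetric] powr_diff of_nat_diff abs_if)
  have w_high: "1 / 2 ^ j = w j / 2 ^ N" if "N < j" for j
    using that by (simp add: w_def powr_minus powr_realpow[symmetric] powr_diff field_simps)

  define T where "T j = translate_sum (l j) (profile \<psi>0 \<psi> j) (b j)" for j
  define T' where "T' j y = b j *\<^sub>R translate_sum (l j) (\<theta>' j) (b j) y" for j y
  define D where "D j y = (1 / b j) *\<^sub>R translate_sum (l j) \<Psi> (b j) y" for j y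
  have T: "(T j has_vector_derivative T' j y) (at y)" for j y
    unfolding T_def T'_def by (rule translate_sum_deriv[OF b0 supp(1,2) \<theta>'(1)])
  have T_cont: "continuous_on UNIV (T j)" for j
    using T by (auto intro!: continuous_at_imp_continuous_on has_vector_derivative_continuous)
  have T'_cont: "continuous_on UNIV (T' j)" for j
    unfolding T'_def by (intro continuous_intros translate_sum_cont[OF b0 supp(2) \<theta>'(2)])
  have D: "(D j has_vector_derivative T j y) (at y)" if "0 < j" for j y
  proof -
    have "(D j has_vector_derivative (1 / b j) *\<^sub>R (b j *\<^sub>R T j y)) (at y)"
      unfolding D_def[abs_def] T_def
      by (intro bounded_linear.has_vector_derivative[OF bounded_linear_scaleR_right]
          translate_sum_deriv[OF b0 supp(3,1) \<Psi>[OF that]])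
    then show ?thesis using b0[of j] by simp
  qed
  have block: "wavelet_block \<psi>0 \<psi> j f = T j" for j
    by (simp add: wavelet_block_eq T_def l_def b_def)
  have T'_bound: "norm (T' j y) \<le> 2 ^ N * (M * (w j * a j \<mu>))"
    if j: "j \<le> N" and y: "of_int (\<mu> - 1) / 2 ^ N \<le> y" "y \<le> of_int (\<mu> + 1) / 2 ^ N" for j \<mu> y
  proof -
    have "near (R + 1) N \<mu> j \<nu>" if "\<bar>b j * y - of_int \<nu>\<bar> \<le> R" for \<nu>
    proof -
      have "\<bar>y - of_int \<mu> / 2 ^ N\<bar> \<le> 1 / 2 ^ N"
        using y by (auto simp: abs_le_iff diff_divide_distrib add_divide_distrib)
      then have "b j * \<bar>y - of_int \<mu> / 2 ^ N\<bar> \<le> b j * (1 / 2 ^ N)"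
        using b0[of j] by (intro mult_left_mono) auto
      also have "\<dots> \<le> 1" using j by (simp add: b_def power_increasing)
      finally have "\<bar>b j * y - b j * (of_int \<mu> / 2 ^ N)\<bar> \<le> 1"
        using b0[of j] by (simp only: right_diff_distrib[symmetric] abs_mult)
      then have "\<bar>b j * (of_int (\<mu> + 0) / 2 ^ N) - of_int \<nu>\<bar> \<le> R + 1" using that by simp
      then show ?thesis unfolding near_def b_def by blast
    qed
    then have "norm (translate_sum (l j) (\<theta>' j) (b j) y) \<le> M * a j \<mu>"
      unfolding a_def by (intro translate_sum_bound[OF finW _ supp(2) bound(1)]) auto
    then have "norm (T' j y) \<le> b j * (M * a j \<mu>)"
      using b0[of j] by (simp add: T'_def)
    also have "\<dots> \<le> 2 ^ j * (M * a j \<mu>)"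
      using M a0 unfolding b_def by (intro mult_right_mono power_increasing) auto
    also have "\<dots> = 2 ^ N * (M * (w j * a j \<mu>))" unfolding w_low[OF j] by (simp only: ac_simps)
    finally show ?thesis .
  qed
  have D_bound: "norm (D j (of_int (\<mu> + i) / 2 ^ N)) \<le> 2 * M / 2 ^ N * (w j * a j \<mu>)"
    if j: "N < j" and i: "i \<in> {-1, 0, 1}" for j \<mu> i
  proof -
    let ?y = "of_int (\<mu> + i) / 2 ^ N"
    have "near (R + 1) N \<mu> j \<nu>" if "\<bar>b j * ?y - of_int \<nu>\<bar> \<le> R" for \<nu>
      unfolding near_def using that i by (intro bexI[of _ i]) (auto simp: b_def)
    then have "norm (translate_sum (l j) \<Psi> (b j) ?y) \<le> M * a j \<mu>"
      unfolding a_def by (intro translate_sum_bound[OF finW _ supp(3) bound(2)]) auto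
    then have "norm (D j ?y) \<le> 1 / b j * (M * a j \<mu>)"
      using b0[of j] by (simp add: D_def divide_right_mono)
    also have "1 / b j = 2 * (1 / 2 ^ j)" using j by (cases j) (auto simp: b_def)
    also have "2 * (1 / 2 ^ j) * (M * a j \<mu>) = 2 * M / 2 ^ N * (w j * a j \<mu>)"
      unfolding w_high[OF j] by simp
    finally show ?thesis .
  qed
  define tail where "tail \<mu> j = (if N < j then D j (of_int \<mu> / 2 ^ N) else 0)" for \<mu> j
  define d where "d \<mu> = (\<Sum>j. tail \<mu> j)" for \<mu>
  have tail_bound: "norm (tail (\<mu> + i) j) \<le> 2 * M / 2 ^ N * (w j * a j \<mu>)" if "i \<in> {-1, 0, 1}" for \<mu> i j
    using D_bound[OF _ that] M w0 a0 by (simp add: tail_def)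
  have majorant: "(\<lambda>j. 2 * M / 2 ^ N * (w j * a j \<mu>)) sums (2 * M / 2 ^ N * g \<mu>)" for \<mu>
    by (rule sums_mult[OF gs])
  have tail_norm_summable: "summable (\<lambda>j. norm (tail (\<mu> + i) j))" if "i \<in> {-1, 0, 1}" for \<mu> i
    by (rule summable_comparison_test'[OF sums_summable[OF majorant[of \<mu>]], where N = 0])
      (use tail_bound[OF that] in simp)
  have tail_sums: "tail \<mu> sums d \<mu>" for \<mu>
    using summable_norm_cancel[OF tail_norm_summable[of 0 \<mu>]] by (simp add: d_def summable_sums)
  have "\<exists>q. \<forall>j y. (q j has_vector_derivative T j y) (at y)"
  proof (rule choice, rule allI)
    fix j show "\<exists>q. \<forall>y. (q has_vector_derivative T j y) (at y)"
      using continuous_antiderivative[OF T_cont[of j]] by metis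
  qed
  then obtain q where q: "\<And>j y. (q j has_vector_derivative T j y) (at y)" by blast

  show thesis
  proof (rule that[of d "\<lambda>y. \<Sum>j\<le>N. T' j y" "\<lambda>y. \<Sum>j\<le>N. q j y"], unfold_locales)
    fix x
    show "(partial_sum_op \<psi>0 \<psi> N f has_vector_derivative (\<Sum>j\<le>N. T' j x)) (at x)"
      unfolding partial_sum_op_def[abs_def] block by (rule has_vector_derivative_sum) (rule T)
    show "((\<lambda>y. \<Sum>j\<le>N. q j y) has_vector_derivative partial_sum_op \<psi>0 \<psi> N f x) (at x)"
      unfolding partial_sum_op_def block by (rule has_vector_derivative_sum) (rule q)
  next
    show "continuous_on UNIV (\<lambda>y. \<Sum>j\<le>N. T' j y)" by (intro continuous_on_sum T'_cont)
  next
    fix \<mu> :: int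
    let ?A = "of_int \<mu> / 2 ^ N :: real" and ?B = "of_int (\<mu> + 1) / 2 ^ N :: real"
    let ?X = "\<lambda>j. LBINT t:dyadic_interval N \<mu>. wavelet_block \<psi>0 \<psi> j f t"
    have X_low: "?X j = q j ?B - q j ?A" for j
      unfolding block by (rule dyadic_interval_FTC[OF q T_cont])
    have X_high: "?X j = D j ?B - D j ?A" if "N < j" for j
      unfolding block by (rule dyadic_interval_FTC[OF D T_cont]) (use that in simp)
    have "(\<lambda>j. (if j \<in> {..N} then ?X j else 0) + (tail (\<mu> + 1) j - tail \<mu> j)) sums ((\<Sum>j\<in>{..N}. ?X j) + (d (\<mu> + 1) - d \<mu>))"
      by (intro sums_add sums_diff tail_sums sums_If_finite_set) simp
    also have "(\<lambda>j. (if j \<in> {..N} then ?X j else 0) + (tail (\<mu> + 1) j - tail \<mu> j)) = ?X"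
      using X_high by (auto simp: fun_eq_iff tail_def)
    finally have "distr_integral \<psi>0 \<psi> (dyadic_interval N \<mu>) f = (\<Sum>j\<le>N. ?X j) + (d (\<mu> + 1) - d \<mu>)"
      unfolding distr_integral_def by (simp add: sums_iff)
    then show "2 ^ N * distr_integral \<psi>0 \<psi> (dyadic_interval N \<mu>) f / 2 ^ N
        = (\<Sum>j\<le>N. q j ?B) - (\<Sum>j\<le>N. q j ?A) + d (\<mu> + 1) - d \<mu>"
      by (simp only: X_low sum_subtractf) simp
  next
    fix \<mu> i :: int assume i: "i \<in> {-1, 0, 1}"
    have "norm (d (\<mu> + i)) \<le> (\<Sum>j. norm (tail (\<mu> + i) j))"
      unfolding d_def by (rule summable_norm[OF tail_norm_summable[OF i]])
    also have "\<dots> \<le> 2 * M / 2 ^ N * g \<mu>"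
      using suminf_le[OF tail_bound[OF i] tail_norm_summable[OF i] sums_summable[OF majorant]]
      unfolding sums_unique[OF majorant, symmetric] .
    finally show "norm (d (\<mu> + i)) \<le> 2 * M * enn2real (cell_majorant (R + 1) N (coeff_size \<psi>0 \<psi> f) \<mu>) / 2 ^ N"
      by (simp add: g_def)
  next
    fix \<mu> :: int and y :: real
    assume y: "of_int (\<mu> - 1) / 2 ^ N \<le> y" "y \<le> of_int (\<mu> + 1) / 2 ^ N"
    have "norm (\<Sum>j\<le>N. T' j y) \<le> (\<Sum>j\<le>N. 2 ^ N * (M * (w j * a j \<mu>)))"
      by (intro sum_norm_le T'_bound y) simp
    also have "\<dots> = 2 ^ N * (M * (\<Sum>j\<le>N. w j * a j \<mu>))"
      by (simp add: sum_distrib_left)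
    also have "\<dots> \<le> 2 ^ N * (M * g \<mu>)"
      using sums_summable[OF gs] sums_unique[OF gs] M w0 a0
      by (intro mult_left_mono) (auto intro!: sum_le_suminf)
    also have "\<dots> \<le> 2 ^ N * (2 * M * g \<mu>)"
      using M by (intro mult_left_mono) (auto simp: g_def)
    finally show "norm (\<Sum>j\<le>N. T' j y) \<le> 2 ^ N * (2 * M * enn2real (cell_majorant (R + 1) N (coeff_size \<psi>0 \<psi> f) \<mu>))"
      by (simp add: g_def)
  next
    fix \<mu>
    have "enn2real (cell_majorant (R + 1) N (coeff_size \<psi>0 \<psi> f) \<mu>) \<le> S"
      using S by (simp add: enn2real_leI)
    then show "2 * M * enn2real (cell_majorant (R + 1) N (coeff_size \<psi>0 \<psi> f) \<mu>) \<le> 2 * M * S"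
      using M by (intro mult_left_mono) auto
  qed
qed

section \<open>Norms on both sides of the estimate\<close>

definition recip :: "ereal \<Rightarrow> real" where
  "recip p = (if p = \<infinity> then 0 else 1 / real_of_ereal p)"

lemma Lp_norm_le_recip_norm:
  assumes p: "0 < p" and g: "g \<in> borel_measurable borel"
  shows "Lp_norm p g \<le> recip_norm (recip p) lborel (\<lambda>x. ennreal (norm (g x)))"
proof (cases "p = \<infinity>")
  case True
  have "esssup lborel (\<lambda>x. ennreal (norm (g x))) \<le> (SUP x. ennreal (norm (g x)))"
    using g by (intro esssup_I AE_I2 SUP_upper) (auto intro: measurable_compose)
  then show ?thesis using True by (simp add: Lp_norm_def recip_norm_def recip_def)
next
  case False
  then obtain q where q: "p = ereal q" "0 < q" using p by (cases p) auto
  then show ?thesis by (simp add: Lp_norm_def recip_norm_def recip_def ennreal_powr_ennreal)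
qed

lemma point_le_recip_norm:
  assumes "0 \<le> t"
  shows "a i \<le> seq_norm t a"
proof (cases "t = 0")
  case True
  then show ?thesis by (simp add: recip_norm_def SUP_upper)
next
  case False
  then have t: "0 < t" using assms by simp
  have "ennreal_powr (a i) (1 / t) \<le> (\<Sum>\<^sup>+i. ennreal_powr (a i) (1 / t))"
    by (rule nn_integral_ge_point) simp
  then have "ennreal_powr (ennreal_powr (a i) (1 / t)) t \<le> seq_norm t a"
    using t by (auto simp: recip_norm_def intro: ennreal_powr_mono)
  then show ?thesis using t by (simp add: ennreal_powr_inverse)
qed

text \<open>Away from the end points, the step function in the wavelet norm is constant on the dyadic intervals
  of level \<open>j\<close>, which have measure \<open>2 powr (- j)\<close>; this turns its \<open>L\<^sub>p\<close> norm into
  an \<open>l\<^sub>p\<close> norm.\<close>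

lemma coeff_norm_le:
  assumes p: "0 < p" and A: "0 \<le> A" and w: "wavelet_norm \<psi>0 \<psi> s p \<infinity> f \<le> ennreal A"
  shows "seq_norm (recip p) (\<lambda>\<nu>. coeff_size \<psi>0 \<psi> f (j, \<nu>)) \<le> ennreal (A * 2 powr (- real j * (s - recip p)))"
proof -
  define l where "l \<nu> = wavelet_coeff \<psi>0 \<psi> j \<nu> f" for \<nu>
  define I where "I \<nu> = {of_int \<nu> / 2 ^ j <..< (of_int \<nu> + 1) / 2 ^ j :: real}" for \<nu> :: int
  define g where "g x = of_real (2 powr (real j * s)) *
    (\<Sum>\<^sub>\<infinity>\<nu>::int. l \<nu> * indicator {of_int \<nu> / 2 ^ j .. (of_int \<nu> + 1) / 2 ^ j :: real} x)" for x
  have emI: "emeasure lborel (I \<nu>) = ennreal (1 / 2 ^ j)" for \<nu>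
  proof -
    have "of_int \<nu> / 2 ^ j \<le> (of_int \<nu> + 1) / (2::real) ^ j" by (simp add: divide_right_mono)
    then show ?thesis by (simp add: I_def diff_divide_distrib[symmetric])
  qed
  have g_I: "g x = of_real (2 powr (real j * s)) * l \<nu>" if x: "x \<in> I \<nu>" for x \<nu>
  proof -
    have "(\<Sum>\<^sub>\<infinity>\<nu>::int. l \<nu> * indicator {of_int \<nu> / 2 ^ j .. (of_int \<nu> + 1) / 2 ^ j :: real} x)
        = (\<Sum>\<^sub>\<infinity>\<nu>\<in>{\<nu>}. l \<nu> * indicator {of_int \<nu> / 2 ^ j .. (of_int \<nu> + 1) / 2 ^ j :: real} x)"
    proof (rule infsum_cong_neutral)
      fix \<kappa> assume "\<kappa> \<in> UNIV - {\<nu>}"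
      then have "\<kappa> + 1 \<le> \<nu> \<or> \<nu> + 1 \<le> \<kappa>" by auto
      then have "of_int \<kappa> + 1 \<le> (of_int \<nu> :: real) \<or> of_int \<nu> + 1 \<le> (of_int \<kappa> :: real)"
        by (metis of_int_1 of_int_add of_int_le_iff)
      then have "x \<notin> {of_int \<kappa> / 2 ^ j .. (of_int \<kappa> + 1) / 2 ^ j}"
        using x by (auto simp: I_def field_simps)
      then show "l \<kappa> * indicator {of_int \<kappa> / 2 ^ j .. (of_int \<kappa> + 1) / 2 ^ j :: real} x = 0" by simp
    qed auto
    also have "\<dots> = l \<nu>" using x by (simp add: I_def)
    finally show ?thesis by (simp add: g_def)
  qed
  have norm_g: "norm (g x) = 2 powr (real j * s) * norm (l \<nu>)" if "x \<in> I \<nu>" for x \<nu>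
    using g_I[OF that] by (simp add: norm_mult)
  have "Lp_norm p g \<le> (SUP j. Lp_norm p (\<lambda>x. of_real (2 powr (real j * s)) *
       (\<Sum>\<^sub>\<infinity>\<nu>::int. wavelet_coeff \<psi>0 \<psi> j \<nu> f * indicator {of_int \<nu> / 2 ^ j .. (of_int \<nu> + 1) / 2 ^ j} x)))"
    unfolding g_def l_def by (rule SUP_upper) simp
  also have "\<dots> \<le> ennreal A"
    using w by (simp add: wavelet_norm_def lq_norm_def)
  finally have Lp: "Lp_norm p g \<le> ennreal A" .
  have cs: "coeff_size \<psi>0 \<psi> f (j, \<nu>) = ennreal (norm (l \<nu>))" for \<nu>
    by (simp add: coeff_size_def l_def)
  show ?thesis
  proof (cases "p = \<infinity>")
    case True
    have ae: "AE x in lborel. ennreal (norm (g x)) \<le> ennreal A"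
      using esssup_AE[of "\<lambda>x. ennreal (norm (g x))" lborel] Lp True
      by (auto simp: Lp_norm_def elim!: eventually_mono order_trans)
    have "ennreal (norm (l \<nu>)) \<le> ennreal (A * 2 powr (- real j * s))" for \<nu>
    proof -
      have "\<exists>x\<in>I \<nu>. norm (g x) \<le> A"
      proof (rule ccontr)
        assume "\<not> (\<exists>x\<in>I \<nu>. norm (g x) \<le> A)"
        then have "AE x in lborel. x \<notin> I \<nu>"
          using ae A by (auto elim!: eventually_mono)
        then have "emeasure lborel (I \<nu>) = 0"
          by (subst (asm) AE_iff_measurable[where N = "I \<nu>"]) (auto simp: I_def)
        then show False using emI by simp
      qed
      then have "2 powr (real j * s) * norm (l \<nu>) \<le> A" using norm_g by auto
      then have "norm (l \<nu>) \<le> A * 2 powr (- real j * s)"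
        by (simp add: powr_minus field_simps)
      then show ?thesis by (rule ennreal_leI)
    qed
    then show ?thesis
      using True by (auto simp: recip_norm_def recip_def cs intro!: SUP_least)
  next
    case False
    then obtain q where q: "p = ereal q" "0 < q" using p by (cases p) auto
    define t where "t = recip p"
    have t: "t = 1 / q" "0 < t" using q by (simp_all add: t_def recip_def)
    let ?w = "(2 powr (real j * s)) powr q * (1 / 2 ^ j)"
    have "ennreal ?w * (\<Sum>\<^sup>+\<nu>. ennreal (norm (l \<nu>) powr q))
        = (\<Sum>\<^sup>+\<nu>. (\<integral>\<^sup>+x. ennreal ((2 powr (real j * s) * norm (l \<nu>)) powr q) * indicator (I \<nu>) x \<partial>lborel))"
    proof (subst nn_integral_cmult[symmetric], simp, intro nn_integral_cong)
      fix \<nu>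
      have "I \<nu> \<in> sets lborel" by (simp add: I_def)
      then have "(\<integral>\<^sup>+x. ennreal ((2 powr (real j * s) * norm (l \<nu>)) powr q) * indicator (I \<nu>) x \<partial>lborel)
          = ennreal ((2 powr (real j * s) * norm (l \<nu>)) powr q) * ennreal (1 / 2 ^ j)"
        by (simp add: nn_integral_cmult_indicator emI)
      then show "ennreal ?w * ennreal (norm (l \<nu>) powr q)
          = (\<integral>\<^sup>+x. ennreal ((2 powr (real j * s) * norm (l \<nu>)) powr q) * indicator (I \<nu>) x \<partial>lborel)"
        by (simp add: ennreal_mult[symmetric] powr_mult)
    qed
    also have "\<dots> = (\<integral>\<^sup>+x. (\<Sum>\<^sup>+\<nu>. ennreal ((2 powr (real j * s) * norm (l \<nu>)) powr q) * indicator (I \<nu>) x) \<partial>lborel)"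
      by (rule nn_integral_count_space_nn_integral[symmetric]) (auto simp: I_def)
    also have "\<dots> \<le> (\<integral>\<^sup>+x. ennreal (norm (g x) powr q) \<partial>lborel)"
    proof (intro nn_integral_mono)
      fix x :: real
      let ?n = "\<lfloor>2 ^ j * x\<rfloor>"
      have only: "\<nu> = ?n" if "x \<in> I \<nu>" for \<nu>
        using that by (intro floor_unique[symmetric]) (auto simp: I_def field_simps)
      have "(\<Sum>\<^sup>+\<nu>. ennreal ((2 powr (real j * s) * norm (l \<nu>)) powr q) * indicator (I \<nu>) x)
          = (\<Sum>\<nu>\<in>{?n}. ennreal ((2 powr (real j * s) * norm (l \<nu>)) powr q) * indicator (I \<nu>) x)"
        by (rule nn_integral_count_space') (auto simp: indicator_def dest: only)
      also have "\<dots> \<le> ennreal (norm (g x) powr q)"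
        using norm_g[of x ?n] by (cases "x \<in> I ?n") auto
      finally show "(\<Sum>\<^sup>+\<nu>. ennreal ((2 powr (real j * s) * norm (l \<nu>)) powr q) * indicator (I \<nu>) x)
          \<le> ennreal (norm (g x) powr q)" .
    qed
    finally have *: "ennreal ?w * (\<Sum>\<^sup>+\<nu>. ennreal (norm (l \<nu>) powr q)) \<le> (\<integral>\<^sup>+x. ennreal (norm (g x) powr q) \<partial>lborel)" .
    have "ennreal_powr (ennreal ?w * (\<Sum>\<^sup>+\<nu>. ennreal (norm (l \<nu>) powr q))) t \<le> ennreal A"
      using ennreal_powr_mono[OF *, of t] Lp t q by (simp add: Lp_norm_def)
    then have "ennreal (?w powr t) * seq_norm t (\<lambda>\<nu>. ennreal (norm (l \<nu>))) \<le> ennreal A"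
      using t q by (simp add: recip_norm_def ennreal_powr_mult ennreal_powr_ennreal)
    also have "?w powr t = 2 powr (real j * (s - t))"
    proof -
      have "(1 / 2 ^ j) powr t = 2 powr (- real j * t)"
        by (simp add: powr_divide powr_powr powr_minus_divide flip: powr_realpow)
      moreover have "((2 powr (real j * s)) powr q) powr t = 2 powr (real j * s)"
        using q t by (simp add: powr_powr)
      moreover have "?w powr t = ((2 powr (real j * s)) powr q) powr t * (1 / 2 ^ j) powr t"
        by (rule powr_mult)
      ultimately have "?w powr t = 2 powr (real j * s) * 2 powr (- real j * t)"
        by (simp only:)
      then show ?thesis
        by (simp add: powr_add[symmetric] algebra_simps)
    qed
    finally have "ennreal (2 powr (- real j * (s - t))) * (ennreal (2 powr (real j * (s - t))) * seq_norm t (\<lambda>\<nu>. ennreal (norm (l \<nu>))))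
        \<le> ennreal (2 powr (- real j * (s - t))) * ennreal A"
      by (intro mult_left_mono) auto
    also have "ennreal (2 powr (- real j * (s - t))) * (ennreal (2 powr (real j * (s - t))) * seq_norm t (\<lambda>\<nu>. ennreal (norm (l \<nu>))))
        = seq_norm t (\<lambda>\<nu>. ennreal (norm (l \<nu>)))"
      by (simp add: mult.assoc[symmetric] ennreal_mult[symmetric] powr_add[symmetric])
    finally show ?thesis
      using A unfolding cs t_def by (simp add: ennreal_mult[symmetric] mult.commute)
  qed
qed

text \<open>Geometric decay away from \<open>N\<close> is summable to every power, uniformly in \<open>N\<close>.\<close>

lemma lq_norm_geometric:
  assumes \<delta>: "0 < \<delta>" and r: "0 < r" and B: "0 \<le> B"
    and a: "\<And>k. a k \<le> ennreal (B * 2 powr (- \<delta> * \<bar>real k - real N\<bar>))"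
  shows "lq_norm r a \<le> ennreal (B * (if r = \<infinity> then 1 else geo_bound (\<delta> * real_of_ereal r) powr (1 / real_of_ereal r)))"
proof (cases "r = \<infinity>")
  case True
  have "a k \<le> ennreal B" for k
  proof -
    have "B * 2 powr (- \<delta> * \<bar>real k - real N\<bar>) \<le> B * 2 powr 0"
      using B \<delta> by (intro mult_left_mono powr_mono) auto
    then show ?thesis by (intro order_trans[OF a] ennreal_leI) simp
  qed
  then show ?thesis using True by (auto simp: lq_norm_def intro: SUP_least)
next
  case False
  then obtain q where q: "r = ereal q" "0 < q" using r by (cases r) auto
  have "(\<Sum>k. ennreal_powr (a k) q) \<le> (\<Sum>k. ennreal (B powr q) * ennreal (2 powr (- (\<delta> * q) * \<bar>real k - real N\<bar>)))"
  proof (intro suminf_le summableI)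
    fix k
    have "ennreal_powr (a k) q \<le> ennreal_powr (ennreal (B * 2 powr (- \<delta> * \<bar>real k - real N\<bar>))) q"
      using q by (intro ennreal_powr_mono a) auto
    also have "\<dots> = ennreal (B powr q) * ennreal (2 powr (- (\<delta> * q) * \<bar>real k - real N\<bar>))"
      using B by (simp add: ennreal_powr_ennreal ennreal_mult[symmetric] powr_mult powr_powr ac_simps)
    finally show "ennreal_powr (a k) q \<le> ennreal (B powr q) * ennreal (2 powr (- (\<delta> * q) * \<bar>real k - real N\<bar>))" .
  qed
  also have "\<dots> = ennreal (B powr q) * (\<Sum>k. ennreal (2 powr (- (\<delta> * q) * \<bar>real k - real N\<bar>)))"
    by (rule ennreal_suminf_cmult)
  also have "\<dots> \<le> ennreal (B powr q) * ennreal (geo_bound (\<delta> * q))"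
    using \<delta> q by (intro mult_left_mono geometric_two_sided) auto
  also have "\<dots> = ennreal (B powr q * geo_bound (\<delta> * q))"
    using geo_bound_pos[of "\<delta> * q"] \<delta> q by (simp add: ennreal_mult)
  finally have "ennreal_powr (\<Sum>k. ennreal_powr (a k) q) (1 / q) \<le> ennreal_powr (ennreal (B powr q * geo_bound (\<delta> * q))) (1 / q)"
    using q by (intro ennreal_powr_mono) auto
  also have "\<dots> = ennreal (B * geo_bound (\<delta> * q) powr (1 / q))"
    using geo_bound_pos[of "\<delta> * q"] \<delta> q B by (simp add: ennreal_powr_ennreal powr_mult powr_powr)
  finally show ?thesis using q by (simp add: lq_norm_def)
qed

lemma le_schwartz_seminorm:
  assumes "schwartz \<phi>"
  shows "norm (x ^ m *\<^sub>R iter_deriv n \<phi> x) \<le> schwartz_seminorm m n \<phi>"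
proof -
  have "bounded (range (\<lambda>x. x ^ m *\<^sub>R iter_deriv n \<phi> x))"
    using assms by (simp add: schwartz_def)
  then obtain B where "\<forall>x. norm (x ^ m *\<^sub>R iter_deriv n \<phi> x) \<le> B"
    by (auto simp: bounded_iff)
  then have "bdd_above (range (\<lambda>x. norm (x ^ m *\<^sub>R iter_deriv n \<phi> x)))"
    by (intro bdd_aboveI[of _ B]) auto
  then show ?thesis
    unfolding schwartz_seminorm_def by (rule cSUP_upper2[rotated, OF UNIV_I order_refl])
qed

lemma seminorm_nonneg: "schwartz \<phi> \<Longrightarrow> 0 \<le> schwartz_seminorm m n \<phi>"
  using le_schwartz_seminorm norm_ge_zero order_trans by blast

lemma schwartz_decay:
  assumes "schwartz \<phi>"
  shows "norm (\<phi> x) \<le> 2 * (schwartz_seminorm 0 0 \<phi> + schwartz_seminorm 2 0 \<phi>) * bump 2 x"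
proof -
  have 1: "norm (\<phi> x) \<le> schwartz_seminorm 0 0 \<phi>" "x\<^sup>2 * norm (\<phi> x) \<le> schwartz_seminorm 2 0 \<phi>"
    using le_schwartz_seminorm[OF assms, of x 0 0] le_schwartz_seminorm[OF assms, of x 2 0] by simp_all
  have "(1 + \<bar>x\<bar>)\<^sup>2 \<le> 2 * (1 + x\<^sup>2)"
    using zero_le_power2[of "1 - \<bar>x\<bar>"] by (simp add: power2_eq_square algebra_simps)
  then have "(1 + \<bar>x\<bar>)\<^sup>2 * norm (\<phi> x) \<le> 2 * (1 + x\<^sup>2) * norm (\<phi> x)"
    by (intro mult_right_mono) auto
  also have "\<dots> \<le> 2 * (schwartz_seminorm 0 0 \<phi> + schwartz_seminorm 2 0 \<phi>)"
    using 1 by (simp add: algebra_simps)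
  finally have *: "(1 + \<bar>x\<bar>)\<^sup>2 * norm (\<phi> x) \<le> 2 * (schwartz_seminorm 0 0 \<phi> + schwartz_seminorm 2 0 \<phi>)" .
  have "0 < (1 + \<bar>x\<bar>)\<^sup>2" by (intro zero_less_power) auto
  with * show ?thesis
    by (simp add: bump_def pos_le_divide_eq mult.commute)
qed

lemma tempered_bounded_function:
  assumes G: "G \<in> borel_measurable borel" and B: "\<And>x. norm (G x) \<le> B"
  shows "tempered (distr_of G)"
proof -
  have B0: "0 \<le> B" using order_trans[OF norm_ge_zero B] .
  have cont: "\<phi> \<in> borel_measurable borel" if "schwartz \<phi>" for \<phi>
  proof -
    have "C_k 0 \<phi>" using that unfolding schwartz_def by blast
    then have "continuous_on UNIV \<phi>" by (simp add: C_k_def)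
    then show ?thesis by (rule borel_measurable_continuous_onI)
  qed
  let ?S = "\<lambda>\<phi>. schwartz_seminorm 0 0 \<phi> + schwartz_seminorm 2 0 \<phi>"
  have pt: "norm (G x * \<phi> x) \<le> B * (2 * ?S \<phi> * bump 2 (1 * (0 - x)))" if "schwartz \<phi>" for \<phi> x
    unfolding norm_mult using B schwartz_decay[OF that, of x] B0
    by (intro mult_mono) (auto simp: bump_def)
  have bi: "integrable lborel (\<lambda>x. B * (2 * ?S \<phi> * bump 2 (1 * (0 - x))))" for \<phi>
    by (intro integrable_mult_right bump_integrable) simp
  have int: "integrable lborel (\<lambda>x. G x * \<phi> x)" if "schwartz \<phi>" for \<phi>
  proof (rule Bochner_Integration.integrable_bound[OF bi])
    show "(\<lambda>x. G x * \<phi> x) \<in> borel_measurable lborel" using G cont[OF that] by measurable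
    show "AE x in lborel. norm (G x * \<phi> x) \<le> norm (B * (2 * ?S \<phi> * bump 2 (1 * (0 - x))))"
      using pt[OF that] by (auto intro!: AE_I2 order_trans[OF _ abs_ge_self])
  qed
  have bump1: "(LINT x|lborel. bump 2 (1 * (0 - x))) \<le> 2"
  proof -
    have "ennreal (LINT x|lborel. bump 2 (1 * (0 - x))) = (\<integral>\<^sup>+x. ennreal (bump 2 (1 * (0 - x))) \<partial>lborel)"
      by (rule nn_integral_eq_integral[symmetric, OF bump_integrable]) auto
    also have "\<dots> = (\<integral>\<^sup>+x. ennreal (bump 2 (1 * (x - 0))) \<partial>lborel)"
      by (simp only: bump_reflect[of 2 1 0])
    also have "\<dots> \<le> ennreal (2 / 1)" by (rule nn_integral_bump_scaled) simp
    finally show ?thesis by (subst (asm) ennreal_le_iff) auto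
  qed
  show ?thesis
    unfolding tempered_def
  proof (intro conjI allI impI exI)
    fix a b :: complex and \<phi> \<theta> assume "schwartz \<phi>" "schwartz \<theta>"
    from int[OF this(1)] int[OF this(2)]
    show "distr_of G (\<lambda>x. a * \<phi> x + b * \<theta> x) = a * distr_of G \<phi> + b * distr_of G \<theta>"
      by (simp add: distr_of_def distrib_left mult.left_commute[of "G _"])
  next
    fix \<phi> assume \<phi>: "schwartz \<phi>"
    have "norm (distr_of G \<phi>) \<le> (LINT x|lborel. B * (2 * ?S \<phi> * bump 2 (1 * (0 - x))))"
      unfolding distr_of_def
      by (rule Bochner_Integration.integral_norm_bound_integral[OF int[OF \<phi>] bi]) (rule pt[OF \<phi>])
    also have "\<dots> = B * (2 * ?S \<phi>) * (LINT x|lborel. bump 2 (1 * (0 - x)))" by simp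
    also have "\<dots> \<le> B * (2 * ?S \<phi>) * 2"
      using B0 seminorm_nonneg[OF \<phi>] by (intro mult_left_mono bump1 mult_nonneg_nonneg) auto
    also have "\<dots> \<le> 4 * B * (\<Sum>m\<le>2. \<Sum>n\<le>2. schwartz_seminorm m n \<phi>)"
    proof -
      have "?S \<phi> \<le> (\<Sum>m\<le>2. \<Sum>n\<le>2. schwartz_seminorm m n \<phi>)"
        using seminorm_nonneg[OF \<phi>] by (simp add: eval_nat_numeral add_nonneg_nonneg add_increasing add_increasing2)
      from mult_left_mono[OF this, of "4 * B"] B0 show ?thesis by (simp add: algebra_simps)
    qed
    finally show "norm (distr_of G \<phi>) \<le> 4 * B * (\<Sum>m\<le>2. \<Sum>n\<le>2. schwartz_seminorm m n \<phi>)" .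
  qed
qed

section \<open>The estimate in Besov spaces\<close>

context dyadic_remainder
begin

text \<open>For \<open>k \<le> N\<close> integration by parts gains the exponent \<open>2 * (N - k)\<close>, from which the
  synthesis takes \<open>(N - k) * max 1 t\<close>; the smoothness weight adds \<open>(N - k) * s\<close>. For
  \<open>k > N\<close> the synthesis gains \<open>(k - N) * min 1 t\<close> and the weight takes
  \<open>(k - N) * s\<close>.\<close>

lemma besov_level_bound:
  fixes p :: ereal and \<Phi>' \<Theta> :: "nat \<Rightarrow> real \<Rightarrow> complex"
  assumes C: "0 < C"
    and \<Phi>'_cont: "\<And>k. continuous_on UNIV (\<Phi>' k)"
    and \<Phi>': "\<And>k x. (inv_fourier (resolution \<phi>0 k) has_vector_derivative \<Phi>' k x) (at x)"
    and \<Phi>_bound: "\<And>k x. norm (inv_fourier (resolution \<phi>0 k) x) \<le> C * 2 ^ k * bump 6 (2 ^ k * x)"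
    and \<Phi>'_bound: "\<And>k x. norm (\<Phi>' k x) \<le> C * 4 ^ k * bump 6 (2 ^ k * x)"
    and \<Theta>: "\<And>k x. 0 < k \<Longrightarrow> (\<Theta> k has_vector_derivative inv_fourier (resolution \<phi>0 k) x) (at x)"
    and \<Theta>_bound: "\<And>k x. 0 < k \<Longrightarrow> norm (\<Theta> k x) \<le> C * bump 6 (2 ^ k * x)"
    and p: "0 < p" and t: "t = recip p" "0 \<le> t" "t \<le> 2"
    and \<delta>: "\<delta> \<le> 2 + s - max 1 t" "\<delta> \<le> min 1 t - s"
    and A: "0 \<le> A" and h: "seq_norm t (\<lambda>\<mu>. ennreal (h \<mu>)) \<le> ennreal (A * 2 powr (- real N * (s - t)))"
  shows "ennreal (2 powr (real k * s)) * Lp_norm p (LP_block \<phi>0 k (distr_of G))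
    \<le> ennreal (2048 * C * A * 2 powr (- \<delta> * \<bar>real k - real N\<bar>))"
proof -
  let ?\<Phi> = "inv_fourier (resolution \<phi>0 k)"
  have \<Phi>_cont: "continuous_on UNIV ?\<Phi>"
    using \<Phi>' by (auto intro!: continuous_at_imp_continuous_on has_vector_derivative_continuous)
  have reflect: "((\<lambda>y. F (x - y)) has_vector_derivative - F' (x - y)) (at y)"
    if "\<And>x. (F has_vector_derivative F' x) (at x)" for F F' :: "real \<Rightarrow> complex" and x y
  proof -
    have "((\<lambda>y. x - y) has_vector_derivative - 1) (at y)"
      by (auto intro!: derivative_eq_intros)
    from vector_diff_chain_at[OF this that] show ?thesis by (simp add: o_def)
  qed
  define n where "n = seq_norm t (\<lambda>\<mu>. ennreal (h \<mu>))"
  have cm: "seq_norm t (\<lambda>\<mu>. ennreal e * ennreal (h \<mu>)) = ennreal e * n" for e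
    unfolding n_def by (rule recip_norm_cmult) (use t in auto)
  \<comment> \<open>It suffices to estimate the convolution by a kernel sum over the grid whose norm is known.\<close>
  have reduce: "ennreal (2 powr (real k * s)) * Lp_norm p (LP_block \<phi>0 k (distr_of G))
      \<le> ennreal (2048 * C * A * 2 powr (- \<delta> * \<bar>real k - real N\<bar>))"
    if pt: "\<And>x. ennreal (norm (LP_block \<phi>0 k (distr_of G) x)) \<le> (\<Sum>\<^sup>+\<mu>. Kr x \<mu> * (ennreal e * ennreal (h \<mu>)))"
      and Kr: "\<And>a. recip_norm t lborel (\<lambda>x. \<Sum>\<^sup>+\<mu>. Kr x \<mu> * a \<mu>) \<le> ennreal e' * seq_norm t a"
      and e: "0 \<le> e" "0 \<le> e'" "2 powr (real k * s) * (e' * (e * (A * 2 powr (- real N * (s - t))))) \<le> 2048 * C * A * 2 powr (- \<delta> * \<bar>real k - real N\<bar>)"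
    for Kr :: "real \<Rightarrow> int \<Rightarrow> ennreal" and e e' :: real
  proof -
    have "Lp_norm p (LP_block \<phi>0 k (distr_of G)) \<le> recip_norm t lborel (\<lambda>x. ennreal (norm (LP_block \<phi>0 k (distr_of G) x)))"
      unfolding t(1) by (rule Lp_norm_le_recip_norm[OF p LP_block_borel[OF \<Phi>_cont]])
    also have "\<dots> \<le> recip_norm t lborel (\<lambda>x. \<Sum>\<^sup>+\<mu>. Kr x \<mu> * (ennreal e * ennreal (h \<mu>)))"
      by (rule recip_norm_mono[OF t(2) pt])
    also have "\<dots> \<le> ennreal e' * (ennreal e * n)"
      unfolding cm[symmetric] by (rule Kr)
    also have "\<dots> \<le> ennreal e' * (ennreal e * ennreal (A * 2 powr (- real N * (s - t))))"
      unfolding n_def by (intro mult_left_mono h) auto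
    finally have "ennreal (2 powr (real k * s)) * Lp_norm p (LP_block \<phi>0 k (distr_of G))
        \<le> ennreal (2 powr (real k * s)) * (ennreal e' * (ennreal e * ennreal (A * 2 powr (- real N * (s - t)))))"
      by (intro mult_left_mono) auto
    also have "\<dots> = ennreal (2 powr (real k * s) * (e' * (e * (A * 2 powr (- real N * (s - t))))))"
      using e(1,2) A by (simp add: ennreal_mult)
    also have "\<dots> \<le> ennreal (2048 * C * A * 2 powr (- \<delta> * \<bar>real k - real N\<bar>))"
      by (rule ennreal_leI[OF e(3)])
    finally show ?thesis .
  qed
  have CA: "0 \<le> C * A" using C A by simp
  show ?thesis
  proof (cases "k \<le> N")
    case True
    show ?thesis
    proof (rule reduce)
      fix x
      have "ennreal (norm (LINT y|lborel. G y * ?\<Phi> (x - y))) \<le> ennreal (64 * (C * 4 ^ k) / 4 ^ N) *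
          (\<Sum>\<^sup>+\<mu>. ennreal (bump 4 (2 ^ k * (x - of_int \<mu> / 2 ^ N))) * ennreal (h \<mu>))"
        by (rule integral_against_smooth_kernel[OF reflect[OF \<Phi>'] True \<Phi>_bound])
          (simp add: \<Phi>'_bound)
      then show "ennreal (norm (LP_block \<phi>0 k (distr_of G) x)) \<le> (\<Sum>\<^sup>+\<mu>. ennreal (bump 4 (2 ^ k * (x - of_int \<mu> / 2 ^ N))) *
          (ennreal (64 * (C * 4 ^ k) / 4 ^ N) * ennreal (h \<mu>)))"
        by (simp add: LP_block_def distr_of_def nn_integral_cmult[symmetric] mult.left_commute)
    next
      fix a
      show "recip_norm t lborel (\<lambda>x. \<Sum>\<^sup>+\<mu>. ennreal (bump 4 (2 ^ k * (x - of_int \<mu> / 2 ^ N))) * a \<mu>)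
          \<le> ennreal (16 * 2 powr ((real N - real k) * max 1 t - real N * t)) * seq_norm t a"
        by (rule bump_sum_norm_low[OF t(2,3) True])
    next
      let ?E = "(real N - real k) * max 1 t - real N * t" and ?F = "real k * s" and ?H = "- real N * (s - t)"
      have four: "4 ^ k / 4 ^ N = (2::real) powr (2 * (real k - real N))"
      proof -
        have "(4::real) ^ m = 2 powr (2 * real m)" for m
          by (simp add: powr_powr[symmetric] powr_realpow)
        then show ?thesis by (simp add: powr_diff[symmetric] right_diff_distrib)
      qed
      have "2 powr ?F * 2 powr ?E * (4 ^ k / 4 ^ N) * 2 powr ?H = 2 powr ((real k - real N) * (2 + s - max 1 t))"
        unfolding four powr_add[symmetric] by (simp add: algebra_simps)
      also have "\<dots> \<le> 2 powr (- \<delta> * \<bar>real k - real N\<bar>)"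
      proof (rule powr_mono)
        have "(real N - real k) * \<delta> \<le> (real N - real k) * (2 + s - max 1 t)"
          using True \<delta>(1) by (intro mult_left_mono) auto
        then show "(real k - real N) * (2 + s - max 1 t) \<le> - \<delta> * \<bar>real k - real N\<bar>"
          using True by (simp add: algebra_simps)
      qed simp
      finally have le: "2 powr ?F * 2 powr ?E * (4 ^ k / 4 ^ N) * 2 powr ?H \<le> 2 powr (- \<delta> * \<bar>real k - real N\<bar>)" .
      have "2 powr ?F * (16 * 2 powr ?E * (64 * (C * 4 ^ k) / 4 ^ N * (A * 2 powr ?H)))
          = 1024 * (C * A) * (2 powr ?F * 2 powr ?E * (4 ^ k / 4 ^ N) * 2 powr ?H)" by simp
      also have "\<dots> \<le> 2048 * (C * A) * 2 powr (- \<delta> * \<bar>real k - real N\<bar>)"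
        using C A by (intro mult_mono le) auto
      finally show "2 powr ?F * (16 * 2 powr ?E * (64 * (C * 4 ^ k) / 4 ^ N * (A * 2 powr ?H)))
          \<le> 2048 * C * A * 2 powr (- \<delta> * \<bar>real k - real N\<bar>)" by (simp only: mult.assoc)
    qed (use C in auto)
  next
    case False
    then have k: "N \<le> k" "0 < k" by auto
    show ?thesis
    proof (rule reduce)
      fix x
      have T: "((\<lambda>y. - \<Theta> k (x - y)) has_vector_derivative ?\<Phi> (x - y)) (at y)" for y
        using has_vector_derivative_minus[OF reflect[OF \<Theta>[OF k(2)]]] by simp
      have cont: "continuous_on UNIV (\<lambda>y. ?\<Phi> (x - y))"
        by (rule continuous_on_compose2[OF \<Phi>_cont]) (auto intro!: continuous_intros)
      have "ennreal (norm (LINT y|lborel. G y * ?\<Phi> (x - y))) \<le> ennreal (32 * C) *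
          (\<Sum>\<^sup>+\<mu>. ennreal (bump 4 (2 ^ k * (x - of_int \<mu> / 2 ^ N)) +
            2 powr (real N - real k) * bump 4 (2 ^ N * (x - of_int \<mu> / 2 ^ N))) * ennreal (h \<mu>))"
        by (rule integral_against_rough_kernel[OF T cont k(1) \<Phi>_bound]) (simp add: \<Theta>_bound k(2))
      then show "ennreal (norm (LP_block \<phi>0 k (distr_of G) x)) \<le> (\<Sum>\<^sup>+\<mu>. ennreal (bump 4 (2 ^ k * (x - of_int \<mu> / 2 ^ N)) +
            2 powr (real N - real k) * bump 4 (2 ^ N * (x - of_int \<mu> / 2 ^ N))) * (ennreal (32 * C) * ennreal (h \<mu>)))"
        by (simp add: LP_block_def distr_of_def nn_integral_cmult[symmetric] mult.left_commute)
    next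
      fix a
      show "recip_norm t lborel (\<lambda>x. \<Sum>\<^sup>+\<mu>. ennreal (bump 4 (2 ^ k * (x - of_int \<mu> / 2 ^ N)) +
            2 powr (real N - real k) * bump 4 (2 ^ N * (x - of_int \<mu> / 2 ^ N))) * a \<mu>)
          \<le> ennreal (64 * 2 powr ((real N - real k) * min 1 t - real N * t)) * seq_norm t a"
        by (rule bump_sum_norm_high[OF t(2,3) k(1)])
    next
      let ?E = "(real N - real k) * min 1 t - real N * t" and ?F = "real k * s" and ?H = "- real N * (s - t)"
      have "2 powr ?F * 2 powr ?E * 2 powr ?H = 2 powr (- ((real k - real N) * (min 1 t - s)))"
        unfolding powr_add[symmetric] by (simp add: algebra_simps)
      also have "\<dots> \<le> 2 powr (- \<delta> * \<bar>real k - real N\<bar>)"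
      proof (rule powr_mono)
        have "(real k - real N) * \<delta> \<le> (real k - real N) * (min 1 t - s)"
          using k \<delta>(2) by (intro mult_left_mono) auto
        then show "- ((real k - real N) * (min 1 t - s)) \<le> - \<delta> * \<bar>real k - real N\<bar>"
          using k by (simp add: algebra_simps)
      qed simp
      finally have le: "2 powr ?F * 2 powr ?E * 2 powr ?H \<le> 2 powr (- \<delta> * \<bar>real k - real N\<bar>)" .
      have "2 powr ?F * (64 * 2 powr ?E * (32 * C * (A * 2 powr ?H)))
          = 2048 * (C * A) * (2 powr ?F * 2 powr ?E * 2 powr ?H)" by simp
      also have "\<dots> \<le> 2048 * (C * A) * 2 powr (- \<delta> * \<bar>real k - real N\<bar>)"
        using CA by (intro mult_left_mono le) auto
      finally show "2 powr ?F * (64 * 2 powr ?E * (32 * C * (A * 2 powr ?H)))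
          \<le> 2048 * C * A * 2 powr (- \<delta> * \<bar>real k - real N\<bar>)" by (simp only: mult.assoc)
    qed (use C in auto)
  qed
qed

end

lemma dyadic_avg_eq:
  "dyadic_avg \<psi>0 \<psi> N f x = 2 ^ N * distr_integral \<psi>0 \<psi> (dyadic_interval N \<lfloor>2 ^ N * x\<rfloor>) f"
proof -
  let ?m = "\<lfloor>2 ^ N * x\<rfloor>"
  have mem: "x \<in> dyadic_interval N \<mu> \<longleftrightarrow> \<mu> = ?m" for \<mu>
    by (auto simp: dyadic_interval_def floor_eq_iff field_simps eq_commute[of \<mu>])
  have "dyadic_avg \<psi>0 \<psi> N f x = (\<Sum>\<^sub>\<infinity>\<mu>\<in>{?m}. indicator (dyadic_interval N \<mu>) x *
      (2 ^ N * distr_integral \<psi>0 \<psi> (dyadic_interval N \<mu>) f))"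
    unfolding dyadic_avg_def by (rule infsum_cong_neutral) (auto simp: mem)
  then show ?thesis by (simp add: mem)
qed

lemma exponent_reciprocal:
  assumes "1 / 2 < (p::ereal)"
  shows "0 < p" "0 \<le> recip p" "recip p < 2" "1 / p = ereal (recip p)"
proof -
  have half: "(1 / 2 :: ereal) = ereal (1 / 2)" by (simp add: one_ereal_def numeral_eq_ereal)
  have "0 < p \<and> 0 \<le> recip p \<and> recip p < 2 \<and> 1 / p = ereal (recip p)"
  proof (cases p)
    case (real q)
    then have "1 / 2 < q" using assms half by simp
    then show ?thesis using real by (auto simp: recip_def one_ereal_def field_simps)
  next
    case PInf
    then show ?thesis by (simp add: recip_def zero_ereal_def)
  next
    case MInf
    then show ?thesis using assms half by simp
  qed
  then show "0 < p" "0 \<le> recip p" "recip p < 2" "1 / p = ereal (recip p)" by auto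
qed

theorem proposition2p1:
  shows "\<exists>K0 L0 :: nat. \<forall>K\<ge>K0. \<forall>L\<ge>L0. \<forall>\<psi>0 \<psi> :: real \<Rightarrow> real. daubechies_system K L \<psi>0 \<psi> \<longrightarrow>
    (\<forall>\<phi>0. resolution_generator \<phi>0 \<longrightarrow>
    (\<forall>(p::ereal) (r::ereal) (s::real).
      1 / 2 < p \<longrightarrow> 0 < r \<longrightarrow> 1 / p - 1 < ereal s \<longrightarrow> ereal s < min (1 / p) 1 \<longrightarrow>
      wavelet_characterization \<phi>0 \<psi>0 \<psi> s p \<longrightarrow>
      (\<exists>C::real. C > 0 \<and> (\<forall>f\<in>besov_space \<phi>0 s p \<infinity>.
        (\<forall>N\<ge>1. distr_of (\<lambda>x. dyadic_avg \<psi>0 \<psi> N f x - partial_sum_op \<psi>0 \<psi> N f x)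
            \<in> besov_space \<phi>0 s p r) \<and>
        (SUP N\<in>{1..}. besov_norm \<phi>0 s p r
            (distr_of (\<lambda>x. dyadic_avg \<psi>0 \<psi> N f x - partial_sum_op \<psi>0 \<psi> N f x)))
          \<le> ennreal C * besov_norm \<phi>0 s p \<infinity> f))))"
proof (rule exI[of _ 1], rule exI[of _ 1], intro allI impI)
  fix K L :: nat and \<psi>0 \<psi> :: "real \<Rightarrow> real" and \<phi>0 and p r :: ereal and s :: real
  assume KL: "1 \<le> K" "1 \<le> L" and sys: "daubechies_system K L \<psi>0 \<psi>" and gen: "resolution_generator \<phi>0"
    and p: "1 / 2 < p" and r: "0 < r" and s: "1 / p - 1 < ereal s" "ereal s < min (1 / p) 1"
    and char: "wavelet_characterization \<phi>0 \<psi>0 \<psi> s p"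
  define t where "t = recip p"
  have t: "0 \<le> t" "t < 2" and p0: "0 < p" and pt: "1 / p = ereal t"
    using exponent_reciprocal[OF p] by (simp_all add: t_def)
  have st: "t - 1 < s" "s < t" "s < 1"
    using s unfolding pt by (auto simp: one_ereal_def)
  define \<delta> where "\<delta> = min (2 + s - max 1 t) (min 1 t - s)"
  have \<delta>: "0 < \<delta>" "\<delta> \<le> 2 + s - max 1 t" "\<delta> \<le> min 1 t - s"
    using t st by (auto simp: \<delta>_def)
  obtain R M \<theta>' \<Psi> where R: "0 \<le> R" and M: "0 < M"
    and prof: "\<And>j. supported_in R (profile \<psi>0 \<psi> j)" "\<And>j. supported_in R (\<theta>' j)" "supported_in R \<Psi>"
    "\<And>j u. (profile \<psi>0 \<psi> j has_vector_derivative \<theta>' j u) (at u)" "\<And>j. continuous_on UNIV (\<theta>' j)"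
    "\<And>j u. 0 < j \<Longrightarrow> (\<Psi> has_vector_derivative profile \<psi>0 \<psi> j u) (at u)"
    "\<And>j u. norm (\<theta>' j u) \<le> M" "\<And>u. norm (\<Psi> u) \<le> M"
    by (rule profile_bounds[OF sys KL]) blast
  obtain C \<Phi>' \<Theta> where C: "0 < C" and ker:
    "\<And>k. continuous_on UNIV (\<Phi>' k)"
    "\<And>k x. (inv_fourier (resolution \<phi>0 k) has_vector_derivative \<Phi>' k x) (at x)"
    "\<And>k x. norm (inv_fourier (resolution \<phi>0 k) x) \<le> C * 2 ^ k * bump 6 (2 ^ k * x)"
    "\<And>k x. norm (\<Phi>' k x) \<le> C * 4 ^ k * bump 6 (2 ^ k * x)"
    "\<And>k x. 0 < k \<Longrightarrow> (\<Theta> k has_vector_derivative inv_fourier (resolution \<phi>0 k) x) (at x)"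
    "\<And>k x. 0 < k \<Longrightarrow> norm (\<Theta> k x) \<le> C * bump 6 (2 ^ k * x)"
    by (rule littlewood_paley_kernels[OF gen]) blast
  have "0 \<le> R + 1" using R by simp
  from cell_majorant_norm[OF this t(1) st] obtain C1 where C1: "0 < C1" and cell_majorant_bound:
    "\<And>N l A. 0 \<le> A \<Longrightarrow> (\<And>j. seq_norm t (\<lambda>\<nu>. l (j, \<nu>)) \<le> ennreal (A * 2 powr (- real j * (s - t)))) \<Longrightarrow>
      seq_norm t (cell_majorant (R + 1) N l) \<le> ennreal (C1 * A * 2 powr (- real N * (s - t)))"
    by blast
  obtain B where B: "0 < B" and char_bound:
    "\<And>f. f \<in> besov_space \<phi>0 s p \<infinity> \<Longrightarrow> wavelet_norm \<psi>0 \<psi> s p \<infinity> f \<le> ennreal B * besov_norm \<phi>0 s p \<infinity> f"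
    using char[unfolded wavelet_characterization_def, rule_format, of \<infinity>] by auto
  define Cr where "Cr = (if r = \<infinity> then 1 else geo_bound (\<delta> * real_of_ereal r) powr (1 / real_of_ereal r))"
  have Cr: "0 < Cr"
  proof (cases "r = \<infinity>")
    case False
    then have "0 < real_of_ereal r" using r by (cases r) auto
    then show ?thesis using False geo_bound_pos[of "\<delta> * real_of_ereal r"] \<delta> by (simp add: Cr_def)
  qed (simp add: Cr_def)
  \<comment> \<open>The constants of the kernels, of the profiles, of the majorant, of the characterization and of the
    sum over the blocks.\<close>
  define CC where "CC = 2048 * C * (2 * M * (C1 * B)) * Cr"
  have CC: "0 < CC" using C M C1 B Cr by (simp add: CC_def)
  have main: "tempered (distr_of (\<lambda>x. dyadic_avg \<psi>0 \<psi> N f x - partial_sum_op \<psi>0 \<psi> N f x)) \<and>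
      besov_norm \<phi>0 s p r (distr_of (\<lambda>x. dyadic_avg \<psi>0 \<psi> N f x - partial_sum_op \<psi>0 \<psi> N f x))
        \<le> ennreal CC * besov_norm \<phi>0 s p \<infinity> f"
    if f: "f \<in> besov_space \<phi>0 s p \<infinity>" for f N
  proof -
    obtain b where b: "besov_norm \<phi>0 s p \<infinity> f = ennreal b" "0 \<le> b"
      using f by (cases "besov_norm \<phi>0 s p \<infinity> f") (auto simp: besov_space_def)
    let ?g = "cell_majorant (R + 1) N (coeff_size \<psi>0 \<psi> f)"
    define S where "S = C1 * (B * b) * 2 powr (- real N * (s - t))"
    have S: "0 \<le> S" using C1 B b by (simp add: S_def)
    have "wavelet_norm \<psi>0 \<psi> s p \<infinity> f \<le> ennreal (B * b)"
      using char_bound[OF f] b B by (simp add: ennreal_mult)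
    then have "seq_norm t (\<lambda>\<nu>. coeff_size \<psi>0 \<psi> f (j, \<nu>)) \<le> ennreal (B * b * 2 powr (- real j * (s - t)))" for j
      unfolding t_def using B b by (intro coeff_norm_le[OF p0]) auto
    then have gn: "seq_norm t ?g \<le> ennreal S"
      unfolding S_def using B b by (intro cell_majorant_bound) auto
    have g_le: "?g \<mu> \<le> ennreal S" for \<mu>
      using point_le_recip_norm[OF t(1)] gn by (rule order_trans)
    let ?h = "\<lambda>\<mu>. 2 * M * enn2real (?g \<mu>)"
    obtain d P' Q where rem: "dyadic_remainder N (\<lambda>\<mu>. 2 ^ N * distr_integral \<psi>0 \<psi> (dyadic_interval N \<mu>) f) d
        (partial_sum_op \<psi>0 \<psi> N f) P' Q ?h (2 * M * S)"
      by (rule wavelet_remainder[OF R M prof S g_le])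
    interpret dyadic_remainder N "\<lambda>\<mu>. 2 ^ N * distr_integral \<psi>0 \<psi> (dyadic_interval N \<mu>) f" d
        "partial_sum_op \<psi>0 \<psi> N f" P' Q ?h "2 * M * S"
      by (rule rem)
    have G_eq: "(\<lambda>x. dyadic_avg \<psi>0 \<psi> N f x - partial_sum_op \<psi>0 \<psi> N f x) = G"
      by (simp add: fun_eq_iff dyadic_avg_eq G_def)
    have hn: "seq_norm t (\<lambda>\<mu>. ennreal (?h \<mu>)) \<le> ennreal (2 * M * (C1 * (B * b)) * 2 powr (- real N * (s - t)))"
    proof -
      have "ennreal (?h \<mu>) = ennreal (2 * M) * ?g \<mu>" for \<mu>
      proof -
        have "?g \<mu> < top" using g_le[of \<mu>] by (rule le_less_trans) simp
        then show ?thesis using M by (simp add: ennreal_mult)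
      qed
      then have "seq_norm t (\<lambda>\<mu>. ennreal (?h \<mu>)) = ennreal (2 * M) * seq_norm t ?g"
        using t(1) by (simp add: recip_norm_cmult)
      also have "\<dots> \<le> ennreal (2 * M) * ennreal S" by (intro mult_left_mono gn) simp
      also have "\<dots> = ennreal (2 * M * (C1 * (B * b)) * 2 powr (- real N * (s - t)))"
        using M S by (simp add: S_def ennreal_mult[symmetric] mult.assoc)
      finally show ?thesis .
    qed
    have A0: "0 \<le> 2 * M * (C1 * (B * b))" using M C1 B b by simp
    have "besov_norm \<phi>0 s p r (distr_of G) \<le> ennreal (2048 * C * (2 * M * (C1 * (B * b))) * Cr)"
      unfolding besov_norm_def Cr_def
    proof (rule lq_norm_geometric[OF \<delta>(1) r])
      show "0 \<le> 2048 * C * (2 * M * (C1 * (B * b)))"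
        using C M C1 B b by (intro mult_nonneg_nonneg) auto
      show "ennreal (2 powr (real k * s)) * Lp_norm p (LP_block \<phi>0 k (distr_of G))
          \<le> ennreal (2048 * C * (2 * M * (C1 * (B * b))) * 2 powr (- \<delta> * \<bar>real k - real N\<bar>))" for k
        by (rule besov_level_bound[OF C ker p0 t_def t(1) less_imp_le[OF t(2)] \<delta>(2,3) A0 hn])
    qed
    also have "2048 * C * (2 * M * (C1 * (B * b))) * Cr = CC * b" by (simp add: CC_def)
    also have "ennreal (CC * b) = ennreal CC * besov_norm \<phi>0 s p \<infinity> f"
      using CC b by (simp add: ennreal_mult)
    finally show ?thesis
      unfolding G_eq using tempered_bounded_function[OF G_borel G_bound] by simp
  qed
  show "\<exists>C::real. C > 0 \<and> (\<forall>f\<in>besov_space \<phi>0 s p \<infinity>.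
        (\<forall>N\<ge>1. distr_of (\<lambda>x. dyadic_avg \<psi>0 \<psi> N f x - partial_sum_op \<psi>0 \<psi> N f x)
            \<in> besov_space \<phi>0 s p r) \<and>
        (SUP N\<in>{1..}. besov_norm \<phi>0 s p r
            (distr_of (\<lambda>x. dyadic_avg \<psi>0 \<psi> N f x - partial_sum_op \<psi>0 \<psi> N f x)))
          \<le> ennreal C * besov_norm \<phi>0 s p \<infinity> f)"
  proof (intro exI[of _ CC] conjI ballI allI impI CC SUP_least)
    fix f :: distribution and N :: nat
    assume f: "f \<in> besov_space \<phi>0 s p \<infinity>"
    have "ennreal CC * besov_norm \<phi>0 s p \<infinity> f < \<infinity>"
      using f by (simp add: besov_space_def ennreal_mult_less_top)
    then show "distr_of (\<lambda>x. dyadic_avg \<psi>0 \<psi> N f x - partial_sum_op \<psi>0 \<psi> N f x) \<in> besov_space \<phi>0 s p r"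
      using main[OF f, of N] by (auto simp: besov_space_def intro: le_less_trans)
    show "besov_norm \<phi>0 s p r (distr_of (\<lambda>x. dyadic_avg \<psi>0 \<psi> N f x - partial_sum_op \<psi>0 \<psi> N f x))
        \<le> ennreal CC * besov_norm \<phi>0 s p \<infinity> f"
      using main[OF f, of N] by blast
  qed
qed

end
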